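(* Let $\lambda>0$, let $\pi\in\mathcal{M}$ and let $V(g,g')=\mathbb{E}_Z\{[L(Z,g)-L(Z,g')]^2\}$. Consider the SeqRand algorithm applied with $\delta_\lambda(Z,g,g')=\lambda[L(Z,g)-L(Z,g')]^2/2$ and $\hat\pi(\rho)=\rho$. Its expected risk $\mathbb{E}_{Z_1^n}\mathbb{E}_{g\sim\hat\mu}R(g)$, where $\hat\mu$ denotes the randomizing distribution, satisfies $$\mathbb{E}_{Z_1^n}\mathbb{E}_{g'\sim\hat\mu}R(g')\le\min_{\rho\in\mathcal{M}}\left\{\mathbb{E}_{g\sim\rho}R(g)+\frac{\lambda}{2}\mathbb{E}_{g\sim\rho}\mathbb{E}_{Z_1^n}\mathbb{E}_{g'\sim\hat\mu}V(g,g')+\frac{K(\rho,\pi)}{\lambda(n+1)}\right\}.$$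
   Context: Setting. $\mathcal{Z}=\mathcal{X}\times\mathcal{Y}$; the training set $Z_1^n=(Z_1,\dots,Z_n)$ consists of $n$ independent random variables with the same unknown distribution $P$ on $\mathcal{Z}$, and $Z$ denotes a random variable with distribution $P$. Prediction functions are measurable functions $\mathcal{X}\to\mathcal{Y}$; $\mathcal{G}$ is a measurable space of prediction functions and $\mathcal{M}$ is the set of probability distributions on $\mathcal{G}$. $L(z,g)\in\mathbb{R}$ is the loss of the prediction function $g$ on $z\in\mathcal{Z}$ (no convexity or boundedness assumed) and $R(g)=\mathbb{E}_{Z\sim P}L(Z,g)$. All manipulated quantities are implicitly assumed measurable. Notation. For a measurable $h:\mathcal{G}\to\mathbb{R}$, $\pi_{-h}(dg)=\frac{e^{-h(g)}}{\mathbb{E}_{g'\sim\pi}e^{-h(g')}}\,\pi(dg)$. $K(\rho,\pi)$ is the Kullback–Leibler divergence ($+\infty$ if $\rho\not\ll\pi$). SeqRand algorithm for this choice of $\delta_\lambda$ and $\hat\pi$. (1) Draw $\hat g_0$ according to $\pi$ and set $S_0\equiv0$. (2) For $i=1,\dots,n$, let $S_i(g)=S_{i-1}(g)+L(Z_i,g)+\frac{\lambda}{2}[L(Z_i,g)-L(Z_i,\hat g_{i-1})]^2$ for all $g\in\mathcal{G}$ and draw $\hat g_i$ according to $\pi_{-\lambda S_i}$. (3) Predict with a function drawn uniformly from $\{\hat g_0,\dots,\hat g_n\}$. The randomizing distribution $\hat\mu$ is the distribution of the output prediction function conditionally on the training set $Z_1^n$. *)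

theory Defs
  imports "HOL-Probability.Probability"
begin

text \<open>Expectation with values in [-\<infinity>, \<infinity>]: integral of the positive part minus integral
  of the negative part. On the type \<^typ>\<open>ereal\<close> one has \<infinity> - \<infinity> = \<infinity>, so an expectation
  that is undefined counts as \<infinity>.\<close>

definition ext_expectation :: "'a measure \<Rightarrow> ('a \<Rightarrow> ereal) \<Rightarrow> ereal" where
  "ext_expectation M f =
     enn2ereal (\<integral>\<^sup>+ x. e2ennreal (f x) \<partial>M) - enn2ereal (\<integral>\<^sup>+ x. e2ennreal (- f x) \<partial>M)"

text \<open>Kullback--Leibler divergence K(\<rho>, \<pi>) in [0, \<infinity>]. The library's \<^const>\<open>KL_divergence\<close>
  takes the reference measure \<pi> first, and is a Bochner integral, hence 0 if the
  log-density is not integrable. For \<rho> absolutely continuous w.r.t. \<pi> the negative part of the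
  log-density is always \<rho>-integrable, so non-integrability means that the divergence is \<infinity>.\<close>

definition KL :: "'g measure \<Rightarrow> 'g measure \<Rightarrow> ereal" where
  "KL \<rho> \<pi> =
     (if absolutely_continuous \<pi> \<rho> \<and> integrable \<rho> (entropy_density (exp 1) \<pi> \<rho>)
      then ereal (KL_divergence (exp 1) \<pi> \<rho>) else \<infinity>)"

text \<open>\<open>gibbs \<pi> h\<close> is the distribution written \<open>\<pi>\<close> with index \<open>-h\<close>: the sign is part of the
  definition.\<close>

definition gibbs :: "'g measure \<Rightarrow> ('g \<Rightarrow> real) \<Rightarrow> 'g measure" where
  "gibbs \<pi> h =
     density \<pi> (\<lambda>g. ennreal (exp (- h g)) / (\<integral>\<^sup>+ g'. ennreal (exp (- h g')) \<partial>\<pi>))"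

definition risk :: "'z measure \<Rightarrow> ('z \<Rightarrow> 'g \<Rightarrow> real) \<Rightarrow> 'g \<Rightarrow> ereal" where
  "risk P L g = ext_expectation P (\<lambda>z. ereal (L z g))"

definition sq_loss_diff :: "'z measure \<Rightarrow> ('z \<Rightarrow> 'g \<Rightarrow> real) \<Rightarrow> 'g \<Rightarrow> 'g \<Rightarrow> ennreal" where
  "sq_loss_diff P L g g' = (\<integral>\<^sup>+ z. ennreal ((L z g - L z g')\<^sup>2) \<partial>P)"

text \<open>The sequence \<open>zs\<close> holds the data \<open>zs 1, \<dots>, zs n\<close>, the sequence \<open>gs\<close> the functions
  \<open>gs 0, gs 1, \<dots>\<close> drawn so far.\<close>

primrec seqrand_S ::
  "('z \<Rightarrow> 'g \<Rightarrow> real) \<Rightarrow> ('z \<Rightarrow> 'g \<Rightarrow> 'g \<Rightarrow> real) \<Rightarrow> (nat \<Rightarrow> 'z) \<Rightarrow> (nat \<Rightarrow> 'g) \<Rightarrow> nat \<Rightarrow> 'g \<Rightarrow> real"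
where
  "seqrand_S L \<delta> zs gs 0 g = 0"
| "seqrand_S L \<delta> zs gs (Suc i) g =
     seqrand_S L \<delta> zs gs i g + L (zs (Suc i)) g + \<delta> (zs (Suc i)) g (gs i)"

text \<open>Joint conditional law of the draws with indices \<open>0, \<dots>, i\<close> given the data \<open>zs\<close>. The map
  \<open>pihat\<close> turns the current Gibbs distribution into the distribution that is sampled.\<close>

primrec seqrand_draws ::
  "'g measure \<Rightarrow> ('z \<Rightarrow> 'g \<Rightarrow> real) \<Rightarrow> real \<Rightarrow> ('z \<Rightarrow> 'g \<Rightarrow> 'g \<Rightarrow> real) \<Rightarrow>
   ('g measure \<Rightarrow> 'g measure) \<Rightarrow> 'g measure \<Rightarrow> (nat \<Rightarrow> 'z) \<Rightarrow> nat \<Rightarrow> (nat \<Rightarrow> 'g) measure"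
where
  "seqrand_draws G L lam \<delta> pihat \<pi> zs 0 =
     distr (pihat \<pi>) (PiM {..0} (\<lambda>_. G)) (\<lambda>g. \<lambda>_\<in>{..0}. g)"
| "seqrand_draws G L lam \<delta> pihat \<pi> zs (Suc i) =
     seqrand_draws G L lam \<delta> pihat \<pi> zs i \<bind> (\<lambda>gs.
       distr (pihat (gibbs \<pi> (\<lambda>g. lam * seqrand_S L \<delta> zs gs (Suc i) g)))
         (PiM {..Suc i} (\<lambda>_. G)) (\<lambda>g. gs(Suc i := g)))"

text \<open>The randomizing distribution: the conditional law, given the data, of the function
  whose index is drawn uniformly from \<open>{0, \<dots>, n}\<close>, independently of the draws.\<close>

definition seqrand ::
  "'g measure \<Rightarrow> ('z \<Rightarrow> 'g \<Rightarrow> real) \<Rightarrow> real \<Rightarrow> ('z \<Rightarrow> 'g \<Rightarrow> 'g \<Rightarrow> real) \<Rightarrow>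
   ('g measure \<Rightarrow> 'g measure) \<Rightarrow> 'g measure \<Rightarrow> nat \<Rightarrow> (nat \<Rightarrow> 'z) \<Rightarrow> 'g measure"
where
  "seqrand G L lam \<delta> pihat \<pi> n zs =
     seqrand_draws G L lam \<delta> pihat \<pi> zs n \<bind> (\<lambda>gs. distr (uniform_count_measure {..n}) G gs)"

end

theory Submission
  imports Defs
begin

text \<open>The draw \<open>g\<^sub>i\<close> has conditional law \<open>\<rho>\<^sub>i\<close>, the Gibbs distribution of the penalized cumulative loss
  \<open>S\<^sub>i\<close>, and the modified loss of the next observation \<open>z\<close> at \<open>g\<close> is
  \<open>L z g + \<delta> z g g\<^sub>i\<close>. Since \<open>cosh x \<le> exp (x\<^sup>2 / 2)\<close>, symmetrizing in two independent draws from
  \<open>\<rho>\<^sub>i\<close> shows that the variable \<open>exp (\<lambda> L z g\<^sub>i)\<close> times the \<open>\<rho>\<^sub>i\<close>-mean of \<open>exp (- \<lambda> (L z g + \<delta> z g g\<^sub>i))\<close> has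
  expectation at most 1. The product of these variables telescopes in the normalizers of the
  Gibbs distributions. Taking logarithms with \<open>ln x \<le> x - 1\<close> in place of Jensen's inequality, and
  bounding the last normalizer by the Donsker--Varadhan inequality, gives an inequality that holds
  pathwise; integrating it over \<open>n + 1\<close> independent observations and the draws yields the bound.

  The losses are unbounded, so integrability has to come from the bound itself: if the bound is
  finite at some \<open>\<rho>\<close>, there is a \<open>g\<^sub>0\<close> whose loss is at finite mean square distance from the loss of almost every
  output function. Either the loss of \<open>g\<^sub>0\<close> is integrable, which makes all the terms integrable, or its
  risk is \<open>- \<infinity>\<close>, which then spreads to both sides. In the integrable case the penalty dominates the
  risk, so the free energy is finite and the minimum is attained by a Gibbs distribution.\<close>

section \<open>Exponential inequalities\<close>

text \<open>The factor \<open>lam / 2\<close> in the penalty is dictated by scaling: with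
  \<open>u g = lam * L z g\<close>, the term \<open>lam * penalty z g g'\<close> is half the square
  of \<open>u g' - u g\<close>, which is what the bound on cosh costs. The exponential inequality
  therefore holds for each fixed sequence of observations; averaging over the data only serves to
  replace the observation paired with a draw by an independent copy. The factor \<open>n + 1\<close>
  counts the draws: each is paired with the observation that follows it, while the divergence is
  paid once, through the last normalizer.

  No logarithm of a gain or of a normalizer is ever integrated. They are eliminated pathwise, and
  what remains to be integrated are losses, modified losses and variables of mean at most 1.

  The second obstacle is that extended expectations with \<infinity> - \<infinity> = \<infinity> do
  not obey Fubini's theorem, so the iterated expectations in the theorem cannot be flattened in
  general. Two situations where this is possible turn out to cover every comparison with a bound
  below \<infinity>.\<close>

lemma cosh_le_exp_half_square: "cosh x \<le> exp (x\<^sup>2 / 2)" for x :: real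
proof -
  have pos: "cosh x \<le> exp (x\<^sup>2 / 2)" if "x \<ge> 0" for x :: real
  proof -
    \<comment> \<open>The derivative of \<open>f\<close> is \<open>x - tanh x\<close>, whose sign
      for nonnegative arguments is that of \<open>k\<close>; the derivative of \<open>k\<close> is
      \<open>x * sinh x\<close>.\<close>
    define f where "f = (\<lambda>x::real. x\<^sup>2 / 2 - ln (cosh x))"
    define k where "k = (\<lambda>x::real. x * cosh x - sinh x)"
    have k: "k 0 \<le> k y" if "0 \<le> y" for y
    proof (rule DERIV_nonneg_imp_nondecreasing[OF that])
      fix x :: real assume "0 \<le> x" "x \<le> y"
      moreover have "(k has_real_derivative x * sinh x) (at x)"
        unfolding k_def by (auto intro!: derivative_eq_intros)
      ultimately show "\<exists>D. (k has_real_derivative D) (at x) \<and> 0 \<le> D"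
        by (intro exI[of _ "x * sinh x"]) auto
    qed
    have "f 0 \<le> f x"
    proof (rule DERIV_nonneg_imp_nondecreasing[OF that])
      fix y :: real assume y: "0 \<le> y" "y \<le> x"
      have "(f has_real_derivative (y - sinh y / cosh y)) (at y)"
        unfolding f_def by (auto intro!: derivative_eq_intros simp: cosh_real_pos)
      moreover have "y - sinh y / cosh y \<ge> 0"
        using k[OF y(1)] cosh_real_pos[of y] unfolding k_def by (simp add: field_simps)
      ultimately show "\<exists>D. (f has_real_derivative D) (at y) \<and> 0 \<le> D" by blast
    qed
    then have "ln (cosh x) \<le> x\<^sup>2 / 2" by (simp add: f_def)
    then show ?thesis
      by (metis cosh_real_pos exp_le_cancel_iff exp_ln)
  qed
  show ?thesis
    using pos[of x] pos[of "-x"] by (cases "x \<ge> 0") auto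
qed

lemma exp_symmetrization: "exp (x - x\<^sup>2 / 2) + exp (- x - x\<^sup>2 / 2) \<le> 2" for x :: real
proof -
  have "exp (x - x\<^sup>2 / 2) + exp (- x - x\<^sup>2 / 2) = 2 * cosh x / exp (x\<^sup>2 / 2)"
    by (simp add: cosh_field_def exp_diff add_divide_distrib)
  also have "\<dots> \<le> 2"
    using cosh_le_exp_half_square[of x] by (simp add: divide_le_eq)
  finally show ?thesis .
qed

text \<open>Exchanging the two draws flips the linear term and keeps the square, so twice the
  integral is the mean of a sum that \<open>exp_symmetrization\<close> bounds by 2. With nonnegative
  integrals the exchange is legitimate for unbounded \<open>u\<close>.\<close>

lemma nn_integral_symmetrization:
  fixes u :: "'a \<Rightarrow> real"
  assumes "prob_space \<rho>" and [measurable]: "u \<in> borel_measurable \<rho>"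
  shows "(\<integral>\<^sup>+g'. \<integral>\<^sup>+g. ennreal (exp ((u g' - u g) - (u g' - u g)\<^sup>2 / 2)) \<partial>\<rho> \<partial>\<rho>) \<le> 1"
    (is "?I \<le> 1")
proof -
  interpret prob_space \<rho> by fact
  interpret pair_sigma_finite \<rho> \<rho> ..
  have "?I = (\<integral>\<^sup>+g'. \<integral>\<^sup>+g. ennreal (exp ((u g - u g') - (u g - u g')\<^sup>2 / 2)) \<partial>\<rho> \<partial>\<rho>)"
    by (rule Fubini') simp
  then have "2 * ?I = ?I + (\<integral>\<^sup>+g'. \<integral>\<^sup>+g. ennreal (exp ((u g - u g') - (u g - u g')\<^sup>2 / 2)) \<partial>\<rho> \<partial>\<rho>)"
    by (simp add: mult_2)
  also have "\<dots> = (\<integral>\<^sup>+g'. \<integral>\<^sup>+g. ennreal (exp ((u g' - u g) - (u g' - u g)\<^sup>2 / 2))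
      + ennreal (exp ((u g - u g') - (u g - u g')\<^sup>2 / 2)) \<partial>\<rho> \<partial>\<rho>)"
    by (simp add: nn_integral_add)
  also have "\<dots> \<le> (\<integral>\<^sup>+g'. \<integral>\<^sup>+g. 2 \<partial>\<rho> \<partial>\<rho>)"
  proof (intro nn_integral_mono)
    fix g g'
    have "exp ((u g' - u g) - (u g' - u g)\<^sup>2 / 2) + exp ((u g - u g') - (u g - u g')\<^sup>2 / 2) \<le> 2"
      using exp_symmetrization[of "u g' - u g"] by (simp add: power2_commute)
    then show "ennreal (exp ((u g' - u g) - (u g' - u g)\<^sup>2 / 2))
        + ennreal (exp ((u g - u g') - (u g - u g')\<^sup>2 / 2)) \<le> 2"
      by (metis ennreal_leI ennreal_numeral ennreal_plus exp_ge_zero zero_le_numeral)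
  qed
  also have "\<dots> = 2 * 1" by (simp add: emeasure_space_1)
  finally show ?thesis
    by (subst (asm) ennreal_mult_le_mult_iff) auto
qed

text \<open>The inequality \<open>ln x \<le> x - 1\<close> is applied to
  \<open>v = u / (D * C)\<close>, with \<open>D\<close> the density of \<rho> and \<open>C\<close>
  the \<pi>-mean of \<open>u\<close>. The function \<open>u\<close> is not written as an exponential
  because it may vanish on a \<rho>-null set of positive \<pi>-measure; the weight that defines the
  minimizer of the bound is of this kind.\<close>

lemma donsker_varadhan:
  fixes \<pi> \<rho> :: "'a measure" and u :: "'a \<Rightarrow> real"
  assumes "prob_space \<pi>" "prob_space \<rho>" and sets: "sets \<rho> = sets \<pi>"
    and ac: "absolutely_continuous \<pi> \<rho>"
    and int_ed: "integrable \<rho> (entropy_density (exp 1) \<pi> \<rho>)"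
    and u_int: "integrable \<pi> u" and u_nonneg: "\<And>x. 0 \<le> u x" and u_pos: "AE x in \<rho>. 0 < u x"
    and ln_int: "integrable \<rho> (\<lambda>x. ln (u x))"
  shows "0 < (\<integral>x. u x \<partial>\<pi>)"
    and "(\<integral>x. ln (u x) \<partial>\<rho>) \<le> ln (\<integral>x. u x \<partial>\<pi>) + KL_divergence (exp 1) \<pi> \<rho>"
proof -
  interpret \<pi>: prob_space \<pi> by fact
  interpret \<rho>: prob_space \<rho> by fact
  note [measurable_cong] = sets
  note [measurable] = borel_measurable_integrable[OF u_int]
  define C where "C = (\<integral>x. u x \<partial>\<pi>)"
  have C: "C > 0"
  proof (rule ccontr)
    assume "\<not> C > 0"
    then have "C = 0" using u_nonneg by (simp add: C_def integral_nonneg order.antisym not_less)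
    then have "AE x in \<pi>. u x = 0"
      using integral_nonneg_eq_0_iff_AE[OF u_int] u_nonneg by (simp add: C_def)
    then have "AE x in \<rho>. u x = 0" by (rule absolutely_continuous_AE[OF sets ac])
    with u_pos have "AE x in \<rho>. False" by eventually_elim simp
    then show False by simp
  qed
  then show "0 < (\<integral>x. u x \<partial>\<pi>)" by (simp add: C_def)
  obtain D where D: "D \<in> borel_measurable \<pi>" "AE x in \<pi>. RN_deriv \<pi> \<rho> x = ennreal (D x)"
    "AE x in \<rho>. 0 < D x" "\<And>x. 0 \<le> D x"
    using \<pi>.real_RN_deriv[OF \<rho>.finite_measure_axioms ac sets] by metis
  note [measurable] = D(1)
  have "density \<pi> (RN_deriv \<pi> \<rho>) = \<rho>"
    by (rule \<pi>.density_RN_deriv[OF ac sets])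
  moreover have "density \<pi> (RN_deriv \<pi> \<rho>) = density \<pi> (\<lambda>x. ennreal (D x))"
    using D(2) by (intro density_cong) auto
  ultimately have \<rho>: "density \<pi> (\<lambda>x. ennreal (D x)) = \<rho>" by simp
  have ed: "AE x in \<rho>. entropy_density (exp 1) \<pi> \<rho> x = ln (D x)"
    using absolutely_continuous_AE[OF sets ac D(2)]
    by eventually_elim (simp add: entropy_density_def log_def D(4))
  define v where "v x = u x / (D x * C)" for x
  have [measurable]: "v \<in> borel_measurable \<pi>" unfolding v_def by measurable
  have v_nonneg: "0 \<le> v x" for x using u_nonneg D(4) C by (simp add: v_def)
  have "(\<integral>\<^sup>+x. ennreal (v x) \<partial>\<rho>) = (\<integral>\<^sup>+x. ennreal (D x) * ennreal (v x) \<partial>\<pi>)"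
    unfolding \<rho>[symmetric] by (rule nn_integral_density) measurable
  also have "\<dots> \<le> (\<integral>\<^sup>+x. ennreal (u x / C) \<partial>\<pi>)"
  proof (rule nn_integral_mono)
    fix x
    \<comment> \<open>Where \<open>D x = 0\<close>, the left side is 0 because division by zero
      gives 0. Hence only an inequality, and \<open>v\<close> has \<rho>-mean at most 1.\<close>
    have "D x * v x \<le> u x / C" using u_nonneg C by (simp add: v_def)
    then show "ennreal (D x) * ennreal (v x) \<le> ennreal (u x / C)"
      by (simp add: ennreal_mult'[OF D(4), symmetric] ennreal_leI)
  qed
  also have "\<dots> = ennreal (\<integral>x. u x / C \<partial>\<pi>)"
    using u_int u_nonneg C by (intro nn_integral_eq_integral) auto
  also have "\<dots> = 1" using C by (simp add: C_def)
  finally have v_le: "(\<integral>\<^sup>+x. ennreal (v x) \<partial>\<rho>) \<le> 1" .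
  have v_int: "integrable \<rho> v"
    using v_le v_nonneg by (intro integrableI_nonneg) (auto intro: le_less_trans)
  have "(\<integral>x. v x \<partial>\<rho>) \<le> 1"
    using v_le v_nonneg v_int by (subst (asm) nn_integral_eq_integral) auto
  have "(\<integral>x. ln (u x) - entropy_density (exp 1) \<pi> \<rho> x - ln C \<partial>\<rho>) \<le> (\<integral>x. v x - 1 \<partial>\<rho>)"
  proof (rule integral_mono_AE)
    show "integrable \<rho> (\<lambda>x. ln (u x) - entropy_density (exp 1) \<pi> \<rho> x - ln C)"
      using ln_int int_ed by auto
    show "integrable \<rho> (\<lambda>x. v x - 1)" using v_int by auto
    show "AE x in \<rho>. ln (u x) - entropy_density (exp 1) \<pi> \<rho> x - ln C \<le> v x - 1"
      using ed u_pos D(3)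
    proof eventually_elim
      case (elim x)
      then have "ln (u x) - ln (D x) - ln C = ln (v x)" "0 < v x"
        using C by (simp_all add: v_def ln_div ln_mult)
      then show ?case using elim ln_le_minus_one[of "v x"] by simp
    qed
  qed
  then have "(\<integral>x. ln (u x) \<partial>\<rho>) - (\<integral>x. entropy_density (exp 1) \<pi> \<rho> x \<partial>\<rho>) - ln C \<le> (\<integral>x. v x \<partial>\<rho>) - 1"
    using ln_int int_ed v_int by (simp add: \<rho>.prob_space)
  with \<open>(\<integral>x. v x \<partial>\<rho>) \<le> 1\<close>
  show "(\<integral>x. ln (u x) \<partial>\<rho>) \<le> ln (\<integral>x. u x \<partial>\<pi>) + KL_divergence (exp 1) \<pi> \<rho>"
    by (simp add: KL_divergence_def C_def)
qed

section \<open>Integration\<close>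

text \<open>The hypothesis \<open>eq\<close> says that the images of \<open>M\<close> under the maps
  \<open>T i\<close> add up to \<open>c\<close> times \<open>N\<close>, although the single images
  may differ. Each image is dominated by the sum, which gives integrability; the identity passes
  from nonnegative to real functions through positive and negative parts.\<close>

lemma
  fixes f ::"'b \<Rightarrow> real" and T :: "'i \<Rightarrow> 'a \<Rightarrow> 'b"
  assumes I: "finite I" and T: "\<And>i. i \<in> I \<Longrightarrow> T i \<in> M \<rightarrow>\<^sub>M N" and c: "0 \<le> c"
    and eq: "\<And>\<phi>. \<phi> \<in> borel_measurable N \<Longrightarrow>
      (\<Sum>i\<in>I. \<integral>\<^sup>+x. \<phi> (T i x) \<partial>M) = ennreal c * (\<integral>\<^sup>+y. \<phi> y \<partial>N)"
    and f: "integrable N f"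
  shows integrable_transfer: "i \<in> I \<Longrightarrow> integrable M (\<lambda>x. f (T i x))"
    and sum_integral_transfer: "(\<Sum>i\<in>I. \<integral>x. f (T i x) \<partial>M) = c * (\<integral>y. f y \<partial>N)"
proof -
  have int: "integrable M (\<lambda>x. h (T i x))" if i: "i \<in> I" and h: "integrable N h" for i and h :: "'b \<Rightarrow> real"
  proof (rule integrableI_bounded)
    note [measurable] = borel_measurable_integrable[OF h]
    show "(\<lambda>x. h (T i x)) \<in> borel_measurable M"
      by (rule measurable_compose[OF T[OF i]]) measurable
    have "(\<integral>\<^sup>+x. ennreal (norm (h (T i x))) \<partial>M) \<le> (\<Sum>i\<in>I. \<integral>\<^sup>+x. ennreal (norm (h (T i x))) \<partial>M)"
      using I i by (intro member_le_sum) auto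
    also have "\<dots> = ennreal c * (\<integral>\<^sup>+y. ennreal (norm (h y)) \<partial>N)"
      by (rule eq) measurable
    also have "\<dots> < \<infinity>"
      using h by (auto simp: integrable_iff_bounded ennreal_mult_less_top)
    finally show "(\<integral>\<^sup>+x. ennreal (norm (h (T i x))) \<partial>M) < \<infinity>" .
  qed
  then show "i \<in> I \<Longrightarrow> integrable M (\<lambda>x. f (T i x))" using f by blast
  have nonneg: "(\<Sum>i\<in>I. \<integral>x. h (T i x) \<partial>M) = c * (\<integral>y. h y \<partial>N)"
    if h: "integrable N h" and pos: "\<And>x. 0 \<le> h x" for h
  proof -
    have "ennreal (\<Sum>i\<in>I. \<integral>x. h (T i x) \<partial>M) = (\<Sum>i\<in>I. \<integral>\<^sup>+x. ennreal (h (T i x)) \<partial>M)"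
      using pos int[OF _ h]
      by (subst sum_ennreal[symmetric]) (auto intro!: sum.cong simp: nn_integral_eq_integral)
    also have "\<dots> = ennreal c * (\<integral>\<^sup>+y. ennreal (h y) \<partial>N)"
      using borel_measurable_integrable[OF h] by (intro eq) measurable
    also have "\<dots> = ennreal (c * (\<integral>y. h y \<partial>N))"
      using c pos h by (simp add: nn_integral_eq_integral ennreal_mult')
    finally show ?thesis
      using c pos by (subst (asm) ennreal_inj) (auto intro!: sum_nonneg mult_nonneg_nonneg)
  qed
  have parts: "integrable N (\<lambda>y. max 0 (f y))" "integrable N (\<lambda>y. max 0 (- f y))"
    using f by auto
  have "(\<Sum>i\<in>I. \<integral>x. f (T i x) \<partial>M) = (\<Sum>i\<in>I. (\<integral>x. max 0 (f (T i x)) \<partial>M) - (\<integral>x. max 0 (- f (T i x)) \<partial>M))"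
  proof (rule sum.cong[OF refl])
    fix i assume "i \<in> I"
    then have "(\<integral>x. max 0 (f (T i x)) \<partial>M) - (\<integral>x. max 0 (- f (T i x)) \<partial>M)
      = (\<integral>x. max 0 (f (T i x)) - max 0 (- f (T i x)) \<partial>M)"
      using int[OF _ parts(1)] int[OF _ parts(2)] by simp
    also have "\<dots> = (\<integral>x. f (T i x) \<partial>M)" by (rule Bochner_Integration.integral_cong) auto
    finally show "(\<integral>x. f (T i x) \<partial>M) = (\<integral>x. max 0 (f (T i x)) \<partial>M) - (\<integral>x. max 0 (- f (T i x)) \<partial>M)" ..
  qed
  also have "\<dots> = c * (\<integral>y. max 0 (f y) \<partial>N) - c * (\<integral>y. max 0 (- f y) \<partial>N)"
    by (simp add: sum_subtractf nonneg[OF parts(1)] nonneg[OF parts(2)])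
  also have "\<dots> = c * (\<integral>y. max 0 (f y) - max 0 (- f y) \<partial>N)"
    using parts by (simp add: right_diff_distrib)
  also have "(\<integral>y. max 0 (f y) - max 0 (- f y) \<partial>N) = (\<integral>y. f y \<partial>N)"
    by (rule Bochner_Integration.integral_cong) auto
  finally show "(\<Sum>i\<in>I. \<integral>x. f (T i x) \<partial>M) = c * (\<integral>y. f y \<partial>N)" .
qed

lemma enn2ereal_eq_enn2real: "x < \<infinity> \<Longrightarrow> enn2ereal x = ereal (enn2real x)"
  by (cases x) auto

lemma ext_expectation_eq_integral:
  fixes h :: "'a \<Rightarrow> real"
  assumes h: "integrable M h" and eq: "AE x in M. f x = ereal (h x)"
  shows "ext_expectation M f = ereal (\<integral>x. h x \<partial>M)"
proof -
  have pos: "(\<integral>\<^sup>+x. e2ennreal (f x) \<partial>M) = (\<integral>\<^sup>+x. ennreal (h x) \<partial>M)"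
    using eq by (intro nn_integral_cong_AE) (auto simp: e2ennreal_ereal)
  have neg: "(\<integral>\<^sup>+x. e2ennreal (- f x) \<partial>M) = (\<integral>\<^sup>+x. ennreal (- h x) \<partial>M)"
    using eq by (intro nn_integral_cong_AE) (auto simp: e2ennreal_ereal)
  have "(\<integral>\<^sup>+x. ennreal (h x) \<partial>M) \<noteq> \<infinity>" "(\<integral>\<^sup>+x. ennreal (- h x) \<partial>M) \<noteq> \<infinity>"
    using h by (auto simp: real_integrable_def)
  then have "enn2ereal (\<integral>\<^sup>+x. ennreal (h x) \<partial>M) = ereal (enn2real (\<integral>\<^sup>+x. ennreal (h x) \<partial>M))"
    "enn2ereal (\<integral>\<^sup>+x. ennreal (- h x) \<partial>M) = ereal (enn2real (\<integral>\<^sup>+x. ennreal (- h x) \<partial>M))"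
    by (simp_all add: enn2ereal_eq_enn2real less_top)
  then show ?thesis
    unfolding ext_expectation_def pos neg using real_lebesgue_integral_def[OF h] by simp
qed

text \<open>Because \<infinity> - \<infinity> = \<infinity>, an infinite positive part makes the
  expectation \<infinity> whatever the negative part is.\<close>

lemma ext_expectation_less_top:
  assumes "ext_expectation M f < \<infinity>"
  shows "(\<integral>\<^sup>+x. e2ennreal (f x) \<partial>M) < \<infinity>"
  using assms unfolding ext_expectation_def by (cases "(\<integral>\<^sup>+x. e2ennreal (f x) \<partial>M) = \<infinity>") (auto simp: less_top)

lemma AE_less_top_of_ext_expectation:
  assumes "f \<in> borel_measurable M" and "ext_expectation M f < \<infinity>"
  shows "AE x in M. f x < \<infinity>"
proof -
  have "AE x in M. e2ennreal (f x) \<noteq> \<infinity>"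
    using assms(1) ext_expectation_less_top[OF assms(2)] by (intro nn_integral_PInf_AE) auto
  then show ?thesis by eventually_elim (auto simp: less_top)
qed

lemma ext_expectation_eq_minus_infinity:
  "ext_expectation M f = - \<infinity>
    \<longleftrightarrow> (\<integral>\<^sup>+x. e2ennreal (f x) \<partial>M) < \<infinity> \<and> (\<integral>\<^sup>+x. e2ennreal (- f x) \<partial>M) = \<infinity>"
  unfolding ext_expectation_def
  by (cases "\<integral>\<^sup>+x. e2ennreal (f x) \<partial>M"; cases "\<integral>\<^sup>+x. e2ennreal (- f x) \<partial>M")
     (auto simp: less_top)

lemma ext_expectation_minus_infinity:
  assumes "prob_space M" and "AE x in M. f x = - \<infinity>"
  shows "ext_expectation M f = - \<infinity>"
proof -
  interpret prob_space M by fact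
  have "(\<integral>\<^sup>+x. e2ennreal (f x) \<partial>M) = (\<integral>\<^sup>+x. 0 \<partial>M)"
    using assms(2) by (intro nn_integral_cong_AE) (auto simp: e2ennreal_neg)
  moreover have "(\<integral>\<^sup>+x. e2ennreal (- f x) \<partial>M) = (\<integral>\<^sup>+x. \<infinity> \<partial>M)"
    using assms(2) by (intro nn_integral_cong_AE) auto
  ultimately show ?thesis
    unfolding ext_expectation_eq_minus_infinity by (simp add: emeasure_space_1)
qed

text \<open>Young's inequality, by completing a square. The parameter is kept free:
  \<open>e = lam / 8\<close> later makes risk differences cost only half of the penalty, while
  \<open>e = 1\<close> is enough for mere integrability.\<close>

lemma abs_le_square_plus: "\<bar>x\<bar> \<le> e * x\<^sup>2 + 1 / (4 * e)" if "e > 0" for x e :: real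
proof -
  have "0 \<le> (2 * e * \<bar>x\<bar> - 1)\<^sup>2 / (4 * e)" using that by simp
  also have "\<dots> = e * \<bar>x\<bar>\<^sup>2 - \<bar>x\<bar> + 1 / (4 * e)"
    using that by (simp only: power2_eq_square) (simp add: field_simps)
  finally show ?thesis by simp
qed

lemma integrable_enn2real:
  assumes "f \<in> borel_measurable M" "(\<integral>\<^sup>+x. f x \<partial>M) < \<infinity>"
  shows "integrable M (\<lambda>x. enn2real (f x))"
    and "(\<integral>x. enn2real (f x) \<partial>M) = enn2real (\<integral>\<^sup>+x. f x \<partial>M)"
proof -
  have "AE x in M. f x \<noteq> \<infinity>" using assms by (intro nn_integral_PInf_AE) auto
  then have "(\<integral>\<^sup>+x. ennreal (enn2real (f x)) \<partial>M) = (\<integral>\<^sup>+x. f x \<partial>M)"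
    by (intro nn_integral_cong_AE) (auto simp: less_top)
  then show "integrable M (\<lambda>x. enn2real (f x))" "(\<integral>x. enn2real (f x) \<partial>M) = enn2real (\<integral>\<^sup>+x. f x \<partial>M)"
    using assms by (auto intro: integrableI_nonneg simp: integral_eq_nn_integral)
qed

text \<open>Fubini's theorem for a kernel instead of a product: the positive and the negative part
  are handled separately by \<open>nn_integral_bind\<close>, and both inner integrals are finite for
  almost every \<open>x\<close>.\<close>

lemma
  fixes h :: "'b \<Rightarrow> real"
  assumes K: "K \<in> M \<rightarrow>\<^sub>M subprob_algebra N" and h: "integrable (M \<bind> K) h"
    and h_meas: "h \<in> borel_measurable N"
  shows AE_integrable_bind: "AE x in M. integrable (K x) h"
    and integrable_integral_bind: "integrable M (\<lambda>x. \<integral>y. h y \<partial>K x)"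
    and integral_bind_eq: "(\<integral>x. \<integral>y. h y \<partial>K x \<partial>M) = (\<integral>y. h y \<partial>(M \<bind> K))"
proof -
  have meas: "(\<lambda>x. \<integral>\<^sup>+y. f y \<partial>K x) \<in> borel_measurable M" if "f \<in> borel_measurable N" for f :: "'b \<Rightarrow> ennreal"
    by (rule measurable_compose[OF K nn_integral_measurable_subprob_algebra[OF that]])
  have nn: "(\<integral>\<^sup>+x. \<integral>\<^sup>+y. f y \<partial>K x \<partial>M) = (\<integral>\<^sup>+y. f y \<partial>(M \<bind> K))" if "f \<in> borel_measurable N" for f :: "'b \<Rightarrow> ennreal"
    by (rule nn_integral_bind[OF that K, symmetric])
  have h1: "(\<lambda>y. ennreal (h y)) \<in> borel_measurable N" and h2: "(\<lambda>y. ennreal (- h y)) \<in> borel_measurable N"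
    using h_meas by measurable
  have fin: "(\<integral>\<^sup>+x. \<integral>\<^sup>+y. ennreal (h y) \<partial>K x \<partial>M) < \<infinity>" "(\<integral>\<^sup>+x. \<integral>\<^sup>+y. ennreal (- h y) \<partial>K x \<partial>M) < \<infinity>"
    using h unfolding nn[OF h1] nn[OF h2] by (auto simp: real_integrable_def less_top)
  have "AE x in M. (\<integral>\<^sup>+y. ennreal (h y) \<partial>K x) \<noteq> \<infinity>" "AE x in M. (\<integral>\<^sup>+y. ennreal (- h y) \<partial>K x) \<noteq> \<infinity>"
    using fin by (intro nn_integral_PInf_AE meas h1 h2; simp)+
  then show AE_int: "AE x in M. integrable (K x) h"
    using AE_space
  proof eventually_elim
    case (elim x)
    have "h \<in> borel_measurable (K x)"
      using h_meas unfolding measurable_cong_sets[OF sets_kernel[OF K elim(3)] refl] .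
    then show ?case using elim by (simp add: real_integrable_def)
  qed
  have eq: "AE x in M. enn2real (\<integral>\<^sup>+y. ennreal (h y) \<partial>K x) - enn2real (\<integral>\<^sup>+y. ennreal (- h y) \<partial>K x) = (\<integral>y. h y \<partial>K x)"
    using AE_int by eventually_elim (simp add: real_lebesgue_integral_def)
  note pos = integrable_enn2real[OF meas[OF h1] fin(1)] and neg = integrable_enn2real[OF meas[OF h2] fin(2)]
  have meas_int: "(\<lambda>x. \<integral>y. h y \<partial>K x) \<in> borel_measurable M"
    by (rule measurable_compose[OF K integral_measurable_subprob_algebra[OF h_meas]])
  show "integrable M (\<lambda>x. \<integral>y. h y \<partial>K x)"
    by (rule integrable_cong_AE_imp[OF Bochner_Integration.integrable_diff[OF pos(1) neg(1)] meas_int])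
       (use eq in \<open>auto simp: eq_commute\<close>)
  have "(\<integral>x. \<integral>y. h y \<partial>K x \<partial>M)
      = (\<integral>x. enn2real (\<integral>\<^sup>+y. ennreal (h y) \<partial>K x) - enn2real (\<integral>\<^sup>+y. ennreal (- h y) \<partial>K x) \<partial>M)"
    using eq pos(1) neg(1) meas_int by (intro integral_cong_AE) (auto simp: eq_commute)
  also have "\<dots> = (\<integral>y. h y \<partial>(M \<bind> K))"
    using pos neg by (simp add: nn[OF h1] nn[OF h2] real_lebesgue_integral_def[OF h])
  finally show "(\<integral>x. \<integral>y. h y \<partial>K x \<partial>M) = (\<integral>y. h y \<partial>(M \<bind> K))" .
qed

text \<open>Every inner expectation can be finite while both parts are infinite over
  \<open>M \<bind> K\<close>, so some assumption on the mixture is unavoidable. Here it is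
  integrability; the next lemma treats the value \<open>- \<infinity>\<close>.\<close>

lemma ext_expectation_bind:
  fixes h :: "'b \<Rightarrow> real"
  assumes K: "K \<in> M \<rightarrow>\<^sub>M subprob_algebra N" and h: "integrable (M \<bind> K) h"
    and h_meas [measurable]: "h \<in> borel_measurable N" and f [measurable]: "f \<in> borel_measurable N"
    and eq: "AE y in M \<bind> K. f y = ereal (h y)"
  shows "ext_expectation M (\<lambda>x. ext_expectation (K x) f) = ereal (\<integral>y. h y \<partial>(M \<bind> K))"
proof -
  have "AE x in M. AE y in K x. f y = ereal (h y)"
    using eq by (subst (asm) AE_bind[OF K]) measurable
  with AE_integrable_bind[OF K h h_meas]
  have "AE x in M. ext_expectation (K x) f = ereal (\<integral>y. h y \<partial>K x)"
    by eventually_elim (rule ext_expectation_eq_integral)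
  then show ?thesis
    unfolding integral_bind_eq[OF K h h_meas, symmetric]
    by (rule ext_expectation_eq_integral[OF integrable_integral_bind[OF K h h_meas]])
qed

lemma ext_expectation_bind_minus_infinity:
  assumes M: "prob_space M" and K: "K \<in> M \<rightarrow>\<^sub>M prob_algebra N"
    and f [measurable]: "f \<in> borel_measurable N"
    and eq: "AE y in M \<bind> K. f y = - \<infinity>"
  shows "ext_expectation M (\<lambda>x. ext_expectation (K x) f) = - \<infinity>"
proof (rule ext_expectation_minus_infinity[OF M])
  have "AE x in M. AE y in K x. f y = - \<infinity>"
    using eq by (subst (asm) AE_bind[OF measurable_prob_algebraD[OF K]]) measurable
  then show "AE x in M. ext_expectation (K x) f = - \<infinity>"
    using AE_space
  proof eventually_elim
    case (elim x)
    have "prob_space (K x)" using measurable_space[OF K elim(2)] by (simp add: space_prob_algebra)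
    then show ?case using elim(1) by (rule ext_expectation_minus_infinity)
  qed
qed

section \<open>The law of the draws\<close>

locale seqrand_setting =
  fixes P :: "'z measure" and G :: "'g measure" and L :: "'z \<Rightarrow> 'g \<Rightarrow> real"
    and lam :: real and \<pi> :: "'g measure"
  assumes prob_P: "prob_space P"
    and loss_measurable: "(\<lambda>(z, g). L z g) \<in> borel_measurable (P \<Otimes>\<^sub>M G)"
    and lam_pos: "lam > 0"
    and prior: "\<pi> \<in> space (prob_algebra G)"
begin

lemma prob_prior: "prob_space \<pi>" and sets_prior [measurable_cong, simp]: "sets \<pi> = sets G"
  using prior by (auto simp: space_prob_algebra)

lemma space_prior [simp]: "space \<pi> = space G"
  by (rule sets_eq_imp_space_eq) simp

lemma emeasure_prior_space [simp]: "emeasure \<pi> (space G) = 1"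
  using prob_space.emeasure_space_1[OF prob_prior] by simp

lemma measurable_loss [measurable (raw)]:
  assumes "a \<in> M \<rightarrow>\<^sub>M P" "b \<in> M \<rightarrow>\<^sub>M G"
  shows "(\<lambda>x. L (a x) (b x)) \<in> borel_measurable M"
  using measurable_compose[OF measurable_Pair[OF assms] loss_measurable] by simp

abbreviation "penalty \<equiv> (\<lambda>z g g'. lam * (L z g - L z g')\<^sup>2 / 2)"
abbreviation "cumloss \<equiv> seqrand_S L penalty"
abbreviation "posterior zs gs i \<equiv> gibbs \<pi> (\<lambda>g. lam * cumloss zs gs i g)"
abbreviation "draws zs i \<equiv> seqrand_draws G L lam penalty (\<lambda>\<rho>. \<rho>) \<pi> zs i"

definition normalizer :: "(nat \<Rightarrow> 'z) \<Rightarrow> (nat \<Rightarrow> 'g) \<Rightarrow> nat \<Rightarrow> real" where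
  "normalizer zs gs i = (\<integral>g. exp (- (lam * cumloss zs gs i g)) \<partial>\<pi>)"

lemma cumloss_cong:
  assumes "\<And>j. j \<in> {1..i} \<Longrightarrow> zs j = zs' j" "\<And>j. j < i \<Longrightarrow> gs j = gs' j"
  shows "cumloss zs gs i = cumloss zs' gs' i"
  using assms by (induction i) (auto simp: fun_eq_iff)

text \<open>Causality of the algorithm. It is the source of all independence used below: draw
  \<open>i\<close> cannot depend on the observation with index \<open>Suc i\<close>, and the output
  cannot depend on the one with index \<open>Suc n\<close>.\<close>

lemma draws_cong:
  assumes "\<And>j. j \<in> {1..i} \<Longrightarrow> zs j = zs' j"
  shows "draws zs i = draws zs' i"
  using assms
proof (induction i)
  case (Suc i)
  have "cumloss zs gs (Suc i) = cumloss zs' gs (Suc i)" for gs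
    using Suc.prems by (intro cumloss_cong) auto
  moreover have "draws zs i = draws zs' i"
    using Suc by auto
  ultimately show ?case by simp
qed simp

lemma cumloss_eq_sum:
  "cumloss zs gs i g = (\<Sum>j<i. L (zs (Suc j)) g + penalty (zs (Suc j)) g (gs j))"
  by (induction i) auto

text \<open>The quadratic penalty makes the modified loss bounded below in \<open>g\<close>, although the loss
  itself is not; this is why the Gibbs distributions are well defined.\<close>

lemma modified_loss_lower_bound: "L z g' - 1 / (2 * lam) \<le> L z g + penalty z g g'"
proof -
  define x where "x = L z g - L z g'"
  have "0 \<le> (lam * x + 1)\<^sup>2 / (2 * lam)" using lam_pos by simp
  also have "\<dots> = lam * x\<^sup>2 / 2 + x + 1 / (2 * lam)"
    using lam_pos by (simp add: power2_eq_square field_simps)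
  finally show ?thesis by (simp add: x_def)
qed

lemma cumloss_lower_bound: "\<exists>c. \<forall>g. c \<le> cumloss zs gs i g"
  unfolding cumloss_eq_sum
  by (intro exI[of _ "\<Sum>j<i. L (zs (Suc j)) (gs j) - 1 / (2 * lam)"] allI sum_mono
      modified_loss_lower_bound)

lemma measurable_cumloss:
  assumes "\<And>j. j < i \<Longrightarrow> (\<lambda>x. zs x (Suc j)) \<in> M \<rightarrow>\<^sub>M P"
    and "\<And>j. j < i \<Longrightarrow> (\<lambda>x. gs x j) \<in> M \<rightarrow>\<^sub>M G" and [measurable]: "a \<in> M \<rightarrow>\<^sub>M G"
  shows "(\<lambda>x. cumloss (zs x) (gs x) i (a x)) \<in> borel_measurable M"
  unfolding cumloss_eq_sum
proof (rule borel_measurable_sum)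
  fix j assume "j \<in> {..<i}"
  then have [measurable]: "(\<lambda>x. zs x (Suc j)) \<in> M \<rightarrow>\<^sub>M P" "(\<lambda>x. gs x j) \<in> M \<rightarrow>\<^sub>M G"
    using assms by auto
  show "(\<lambda>x. L (zs x (Suc j)) (a x) + penalty (zs x (Suc j)) (a x) (gs x j)) \<in> borel_measurable M"
    by measurable
qed

lemma measurable_cumloss_fixed:
  assumes "\<And>j. j < i \<Longrightarrow> zs (Suc j) \<in> space P" "\<And>j. j < i \<Longrightarrow> gs j \<in> space G"
  shows "cumloss zs gs i \<in> borel_measurable G"
  using assms by (intro measurable_cumloss[of i "\<lambda>_. zs" G "\<lambda>_. gs" "\<lambda>x. x"]) auto

section \<open>Gibbs distributions of the penalized cumulative losses\<close>

context
  fixes zs gs i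
  assumes zs: "\<And>j. j < i \<Longrightarrow> zs (Suc j) \<in> space P" and gs: "\<And>j. j < i \<Longrightarrow> gs j \<in> space G"
begin

lemma integrable_exp_cumloss: "integrable \<pi> (\<lambda>g. exp (- (lam * cumloss zs gs i g)))"
proof -
  interpret prob_space \<pi> by (rule prob_prior)
  have [measurable]: "cumloss zs gs i \<in> borel_measurable G"
    by (rule measurable_cumloss_fixed) (simp_all add: zs gs)
  obtain c where c: "c \<le> cumloss zs gs i g" for g using cumloss_lower_bound by blast
  show ?thesis
    using c lam_pos by (intro integrable_const_bound[of _ "exp (- (lam * c))"]) auto
qed

lemma normalizer_pos: "0 < normalizer zs gs i"
proof -
  interpret prob_space \<pi> by (rule prob_prior)
  have "(\<integral>g. 0 \<partial>\<pi>) < normalizer zs gs i"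
    unfolding normalizer_def
    using emeasure_space_1
    by (intro integral_less_AE_space) (simp_all add: integrable_exp_cumloss)
  then show ?thesis by simp
qed

lemma nn_integral_exp_cumloss:
  "(\<integral>\<^sup>+g. ennreal (exp (- (lam * cumloss zs gs i g))) \<partial>\<pi>) = ennreal (normalizer zs gs i)"
  unfolding normalizer_def by (intro nn_integral_eq_integral integrable_exp_cumloss) simp

lemma posterior_eq:
  "posterior zs gs i
    = density \<pi> (\<lambda>g. ennreal (exp (- (lam * cumloss zs gs i g)) / normalizer zs gs i))"
  unfolding gibbs_def nn_integral_exp_cumloss
  using normalizer_pos by (simp add: divide_ennreal)

lemma prob_posterior: "prob_space (posterior zs gs i)"
proof -
  have [measurable]: "cumloss zs gs i \<in> borel_measurable G"
    by (rule measurable_cumloss_fixed) (simp_all add: zs gs)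
  have "(\<integral>\<^sup>+g. ennreal (exp (- (lam * cumloss zs gs i g)) / normalizer zs gs i) \<partial>\<pi>)
      = (\<integral>\<^sup>+g. ennreal (exp (- (lam * cumloss zs gs i g))) / ennreal (normalizer zs gs i) \<partial>\<pi>)"
    using normalizer_pos by (simp add: divide_ennreal)
  also have "\<dots> = ennreal (normalizer zs gs i) / ennreal (normalizer zs gs i)"
    by (simp add: nn_integral_divide nn_integral_exp_cumloss)
  also have "\<dots> = 1" using normalizer_pos by (simp add: divide_ennreal)
  finally have total: "(\<integral>\<^sup>+g. ennreal (exp (- (lam * cumloss zs gs i g)) / normalizer zs gs i) \<partial>\<pi>) = 1" .
  have "emeasure (posterior zs gs i) (space \<pi>)
      = (\<integral>\<^sup>+g. ennreal (exp (- (lam * cumloss zs gs i g)) / normalizer zs gs i) * indicator (space \<pi>) g \<partial>\<pi>)"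
    unfolding posterior_eq by (rule emeasure_density[OF _ sets.top]) measurable
  also have "\<dots> = 1"
    unfolding total[symmetric] by (rule nn_integral_cong) simp
  finally show ?thesis
    by (intro prob_spaceI) (simp add: gibbs_def)
qed

end

lemma sets_posterior [simp]: "sets (posterior zs gs i) = sets G"
  by (simp add: gibbs_def)

lemma posterior_0: "posterior zs gs 0 = \<pi>"
  by (simp add: gibbs_def density_1)

text \<open>The index sets are arbitrary supersets of what is read, since the data will be indexed
  by \<open>{1..n}\<close>, by \<open>{1..Suc n}\<close> and by the latter with one observation
  removed.\<close>

lemma measurable_posterior [measurable]:
  assumes I: "{1..i} \<subseteq> I" and K: "{..<i} \<subseteq> K"
  shows "(\<lambda>(zs, gs). posterior zs gs i)
    \<in> PiM I (\<lambda>_. P) \<Otimes>\<^sub>M PiM K (\<lambda>_. G) \<rightarrow>\<^sub>M prob_algebra G" (is "_ \<in> ?M \<rightarrow>\<^sub>M _")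
proof -
  interpret prob_space \<pi> by (rule prob_prior)
  have z: "(\<lambda>x. fst (fst x) (Suc j)) \<in> ?M \<Otimes>\<^sub>M G \<rightarrow>\<^sub>M P" if "j < i" for j
  proof -
    have "Suc j \<in> I" using that I by auto
    then show ?thesis
      by (rule measurable_compose[OF measurable_compose[OF measurable_fst measurable_fst]
          measurable_component_singleton])
  qed
  have g: "(\<lambda>x. snd (fst x) j) \<in> ?M \<Otimes>\<^sub>M G \<rightarrow>\<^sub>M G" if "j < i" for j
  proof -
    have "j \<in> K" using that K by auto
    then show ?thesis
      by (rule measurable_compose[OF measurable_compose[OF measurable_fst measurable_snd]
          measurable_component_singleton])
  qed
  have S [measurable]: "(\<lambda>x. cumloss (fst (fst x)) (snd (fst x)) i (snd x)) \<in> borel_measurable (?M \<Otimes>\<^sub>M G)"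
    by (intro measurable_cumloss z g) auto
  show ?thesis
    unfolding split_beta
  proof (intro measurable_prob_algebraI measurable_subprob_algebra)
    fix x assume x: "x \<in> space ?M"
    have zx: "fst x (Suc j) \<in> space P" if "j < i" for j
    proof -
      have "Suc j \<in> I" using that I by auto
      then show ?thesis using x by (auto simp: space_pair_measure space_PiM PiE_iff)
    qed
    have gx: "snd x j \<in> space G" if "j < i" for j
      using x that K by (auto simp: space_pair_measure space_PiM PiE_iff)
    show "prob_space (posterior (fst x) (snd x) i)"
      by (rule prob_posterior) (simp_all add: zx gx)
    then show "subprob_space (posterior (fst x) (snd x) i)"
      by (rule prob_space_imp_subprob_space)
  next
    fix A assume [measurable]: "A \<in> sets G"
    define c where "c x = (\<integral>\<^sup>+g'. ennreal (exp (- (lam * cumloss (fst x) (snd x) i g'))) \<partial>\<pi>)" for x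
    have [measurable]: "c \<in> borel_measurable ?M" unfolding c_def by measurable
    have "(\<lambda>x. \<integral>\<^sup>+g. ennreal (exp (- (lam * cumloss (fst x) (snd x) i g))) / c x * indicator A g \<partial>\<pi>)
      \<in> borel_measurable ?M"
      by measurable
    moreover have "emeasure (posterior (fst x) (snd x) i) A
        = (\<integral>\<^sup>+g. ennreal (exp (- (lam * cumloss (fst x) (snd x) i g))) / c x * indicator A g \<partial>\<pi>)"
      if "x \<in> space ?M" for x
    proof -
      have [measurable]: "cumloss (fst x) (snd x) i \<in> borel_measurable G"
        using measurable_Pair2[OF S that] by simp
      show ?thesis unfolding gibbs_def c_def by (subst emeasure_density) auto
    qed
    ultimately show "(\<lambda>x. emeasure (posterior (fst x) (snd x) i) A) \<in> borel_measurable ?M"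
      by (simp cong: measurable_cong)
  qed auto
qed

section \<open>The draws as a probability kernel of the data\<close>

lemma measurable_draws:
  assumes I: "{1..i} \<subseteq> I"
  shows "(\<lambda>zs. draws zs i) \<in> PiM I (\<lambda>_. P) \<rightarrow>\<^sub>M prob_algebra (PiM {..i} (\<lambda>_. G))"
  using I
proof (induction i)
  case 0
  have "distr \<pi> (PiM {..0} (\<lambda>_. G)) (\<lambda>g. \<lambda>_\<in>{..0}. g) \<in> space (prob_algebra (PiM {..0} (\<lambda>_. G)))"
    by (auto simp: space_prob_algebra intro!: prob_space.prob_space_distr[OF prob_prior])
  then show ?case unfolding seqrand_draws.simps(1) by (rule measurable_const)
next
  case (Suc i)
  have [measurable]: "(\<lambda>zs. draws zs i) \<in> PiM I (\<lambda>_. P) \<rightarrow>\<^sub>M prob_algebra (PiM {..i} (\<lambda>_. G))"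
    using Suc by (intro Suc.IH) auto
  have K: "{..<Suc i} \<subseteq> {..i}" by auto
  have "(\<lambda>x. distr (posterior (fst x) (snd x) (Suc i)) (PiM {..Suc i} (\<lambda>_. G)) (\<lambda>g. (snd x)(Suc i := g)))
     \<in> PiM I (\<lambda>_. P) \<Otimes>\<^sub>M PiM {..i} (\<lambda>_. G) \<rightarrow>\<^sub>M prob_algebra (PiM {..Suc i} (\<lambda>_. G))"
  proof (rule measurable_distr_prob_space2)
    show "(\<lambda>x. posterior (fst x) (snd x) (Suc i)) \<in> PiM I (\<lambda>_. P) \<Otimes>\<^sub>M PiM {..i} (\<lambda>_. G) \<rightarrow>\<^sub>M prob_algebra G"
      using measurable_posterior[OF Suc.prems K] by (simp add: split_beta)
    show "(\<lambda>(x, g). (snd x)(Suc i := g)) \<in> (PiM I (\<lambda>_. P) \<Otimes>\<^sub>M PiM {..i} (\<lambda>_. G)) \<Otimes>\<^sub>M G \<rightarrow>\<^sub>M PiM {..Suc i} (\<lambda>_. G)"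
      unfolding split_beta
      by (rule measurable_fun_upd[of _ "{..i}"]) (auto simp: atMost_Suc)
  qed
  then show ?case
    unfolding seqrand_draws.simps(2)
    by (intro measurable_bind_prob_space2[where N="PiM {..i} (\<lambda>_. G)"]) (auto simp: split_beta)
qed

lemma draws_in_prob_algebra:
  assumes "{1..i} \<subseteq> I" "zs \<in> space (PiM I (\<lambda>_. P))"
  shows "draws zs i \<in> space (prob_algebra (PiM {..i} (\<lambda>_. G)))"
  using measurable_space[OF measurable_draws assms(2)] assms(1) by blast

lemma
  assumes "{1..i} \<subseteq> I" "zs \<in> space (PiM I (\<lambda>_. P))"
  shows prob_draws: "prob_space (draws zs i)"
    and sets_draws: "sets (draws zs i) = sets (PiM {..i} (\<lambda>_. G))"
    and space_draws: "space (draws zs i) = space (PiM {..i} (\<lambda>_. G))"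
  using draws_in_prob_algebra[OF assms] by (auto simp: space_prob_algebra dest: sets_eq_imp_space_eq)

lemma measurable_posterior_fixed:
  assumes I: "{1..Suc i} \<subseteq> I" and zs: "zs \<in> space (PiM I (\<lambda>_. P))"
  shows "(\<lambda>gs. posterior zs gs (Suc i)) \<in> PiM {..i} (\<lambda>_. G) \<rightarrow>\<^sub>M prob_algebra G"
  using measurable_compose[OF measurable_Pair1'[OF zs] measurable_posterior[OF I, of "{..i}"]]
  by (simp add: lessThan_Suc_atMost)

lemma nn_integral_draws_Suc:
  assumes I: "{1..Suc i} \<subseteq> I" and zs: "zs \<in> space (PiM I (\<lambda>_. P))"
    and F: "F \<in> borel_measurable (PiM {..Suc i} (\<lambda>_. G))"
  shows "(\<integral>\<^sup>+gs. F gs \<partial>draws zs (Suc i))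
    = (\<integral>\<^sup>+gs. \<integral>\<^sup>+g. F (gs(Suc i := g)) \<partial>posterior zs gs (Suc i) \<partial>draws zs i)"
proof -
  have I': "{1..i} \<subseteq> I" using I by auto
  note sets = sets_draws[OF I' zs] and space = space_draws[OF I' zs]
  have upd: "(\<lambda>g. gs(Suc i := g)) \<in> G \<rightarrow>\<^sub>M PiM {..Suc i} (\<lambda>_. G)" if "gs \<in> space (PiM {..i} (\<lambda>_. G))" for gs
    using that by (intro measurable_fun_upd[of _ "{..i}"]) (auto simp: atMost_Suc)
  have "(\<lambda>gs. distr (posterior zs gs (Suc i)) (PiM {..Suc i} (\<lambda>_. G)) (\<lambda>g. gs(Suc i := g)))
     \<in> PiM {..i} (\<lambda>_. G) \<rightarrow>\<^sub>M prob_algebra (PiM {..Suc i} (\<lambda>_. G))"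
  proof (rule measurable_distr_prob_space2[OF measurable_posterior_fixed[OF I zs]])
    show "(\<lambda>(gs, g). gs(Suc i := g)) \<in> PiM {..i} (\<lambda>_. G) \<Otimes>\<^sub>M G \<rightarrow>\<^sub>M PiM {..Suc i} (\<lambda>_. G)"
      unfolding split_beta by (rule measurable_fun_upd[of _ "{..i}"]) (auto simp: atMost_Suc)
  qed
  then have K: "(\<lambda>gs. distr (posterior zs gs (Suc i)) (PiM {..Suc i} (\<lambda>_. G)) (\<lambda>g. gs(Suc i := g)))
     \<in> draws zs i \<rightarrow>\<^sub>M subprob_algebra (PiM {..Suc i} (\<lambda>_. G))"
    unfolding measurable_cong_sets[OF sets refl] by (rule measurable_prob_algebraD)
  have "(\<integral>\<^sup>+gs. F gs \<partial>draws zs (Suc i)) = (\<integral>\<^sup>+gs. \<integral>\<^sup>+gs'. F gs'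
      \<partial>distr (posterior zs gs (Suc i)) (PiM {..Suc i} (\<lambda>_. G)) (\<lambda>g. gs(Suc i := g)) \<partial>draws zs i)"
    unfolding seqrand_draws.simps(2) by (rule nn_integral_bind[OF F K])
  also have "\<dots> = (\<integral>\<^sup>+gs. \<integral>\<^sup>+g. F (gs(Suc i := g)) \<partial>posterior zs gs (Suc i) \<partial>draws zs i)"
  proof (rule nn_integral_cong)
    fix gs assume "gs \<in> space (draws zs i)"
    then have upd': "(\<lambda>g. gs(Suc i := g)) \<in> posterior zs gs (Suc i) \<rightarrow>\<^sub>M PiM {..Suc i} (\<lambda>_. G)"
      using upd unfolding space measurable_cong_sets[OF sets_posterior refl] by blast
    show "(\<integral>\<^sup>+gs'. F gs' \<partial>distr (posterior zs gs (Suc i)) (PiM {..Suc i} (\<lambda>_. G)) (\<lambda>g. gs(Suc i := g)))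
      = (\<integral>\<^sup>+g. F (gs(Suc i := g)) \<partial>posterior zs gs (Suc i))"
      by (rule nn_integral_distr[OF upd']) (simp only: measurable_distr_eq1 F)
  qed
  finally show ?thesis .
qed

lemma prob_posterior_fixed:
  assumes I: "{1..Suc i} \<subseteq> I" and zs: "zs \<in> space (PiM I (\<lambda>_. P))"
    and gs: "gs \<in> space (PiM {..i} (\<lambda>_. G))"
  shows "prob_space (posterior zs gs (Suc i))"
  using measurable_space[OF measurable_posterior_fixed[OF I zs] gs] by (simp add: space_prob_algebra)

text \<open>Each later step appends one coordinate through a probability kernel, and an integrand
  that ignores this coordinate integrates to itself. The restriction is there because points of
  \<open>PiM {..i} (\<lambda>_. G)\<close> are undefined outside \<open>{..i}\<close>.\<close>

lemma nn_integral_draws_marginal: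
  assumes "i \<le> m" and "{1..m} \<subseteq> I" and zs: "zs \<in> space (PiM I (\<lambda>_. P))"
    and F [measurable]: "F \<in> borel_measurable (PiM {..i} (\<lambda>_. G))"
  shows "(\<integral>\<^sup>+gs. F (restrict gs {..i}) \<partial>draws zs m) = (\<integral>\<^sup>+gs. F gs \<partial>draws zs i)"
  using assms(1,2)
proof (induction m rule: dec_induct)
  case base
  show ?case
    by (rule nn_integral_cong)
       (simp add: space_draws[OF base zs] space_PiM PiE_iff extensional_restrict)
next
  case (step m)
  have I: "{1..m} \<subseteq> I" using step.prems by auto
  have "(\<lambda>gs. F (restrict gs {..i})) \<in> borel_measurable (PiM {..Suc m} (\<lambda>_. G))"
    using step.hyps by (intro measurable_compose[OF measurable_restrict_subset F]) auto
  then have "(\<integral>\<^sup>+gs. F (restrict gs {..i}) \<partial>draws zs (Suc m)) =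
    (\<integral>\<^sup>+gs. \<integral>\<^sup>+g. F (restrict (gs(Suc m := g)) {..i}) \<partial>posterior zs gs (Suc m) \<partial>draws zs m)"
    by (rule nn_integral_draws_Suc[OF step.prems zs])
  also have "\<dots> = (\<integral>\<^sup>+gs. F (restrict gs {..i}) \<partial>draws zs m)"
  proof (rule nn_integral_cong)
    fix gs assume "gs \<in> space (draws zs m)"
    then interpret prob_space "posterior zs gs (Suc m)"
      by (intro prob_posterior_fixed[OF step.prems zs]) (simp add: space_draws[OF I zs])
    have "restrict (gs(Suc m := g)) {..i} = restrict gs {..i}" for g
      using step.hyps by (auto simp: restrict_def)
    then show "(\<integral>\<^sup>+g. F (restrict (gs(Suc m := g)) {..i}) \<partial>posterior zs gs (Suc m)) = F (restrict gs {..i})"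
      using emeasure_space_1 by simp
  qed
  also have "\<dots> = (\<integral>\<^sup>+gs. F gs \<partial>draws zs i)" by (rule step.IH[OF I])
  finally show ?case .
qed

section \<open>The exponential moment of one step\<close>

lemma space_G_not_empty: "space G \<noteq> {}"
  using prob_space.not_empty[OF prob_prior] by simp

text \<open>Conditioning on the draws before index \<open>i\<close>. The hypothesis quantifies over
  full sequences and then overwrites coordinate \<open>i\<close>, so that it has the same form for
  \<open>i = 0\<close>, where the conditional law is \<pi>, as for later draws.\<close>

lemma nn_integral_draws_last_le_1:
  assumes I: "{1..i} \<subseteq> I" and zs: "zs \<in> space (PiM I (\<lambda>_. P))"
    and F: "F \<in> borel_measurable (PiM {..i} (\<lambda>_. G))"
    and le: "\<And>gs. gs \<in> space (PiM {..i} (\<lambda>_. G)) \<Longrightarrow> (\<integral>\<^sup>+g. F (gs(i := g)) \<partial>posterior zs gs i) \<le> 1"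
  shows "(\<integral>\<^sup>+gs. F gs \<partial>draws zs i) \<le> 1"
proof -
  \<comment> \<open>Any point of \<open>G\<close> serves: it fills coordinate \<open>i\<close>,
    which \<open>F (gs(i := g))\<close> overwrites and \<open>posterior zs gs i\<close> does not
    read.\<close>
  obtain g0 where g0: "g0 \<in> space G" using space_G_not_empty by blast
  show ?thesis
  proof (cases i)
    case 0
    define gs0 where "gs0 = (\<lambda>_\<in>{..0::nat}. g0)"
    have gs0: "gs0 \<in> space (PiM {..i} (\<lambda>_. G))"
      using g0 by (auto simp: space_PiM gs0_def 0)
    have m: "(\<lambda>g. \<lambda>_\<in>{..0}. g) \<in> \<pi> \<rightarrow>\<^sub>M PiM {..0::nat} (\<lambda>_. G)"
      by measurable
    have "(\<integral>\<^sup>+gs. F gs \<partial>draws zs i) = (\<integral>\<^sup>+g. F (\<lambda>_\<in>{..0}. g) \<partial>\<pi>)"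
      unfolding 0 seqrand_draws.simps(1) using F[unfolded 0] by (intro nn_integral_distr[OF m]) simp
    also have "\<dots> = (\<integral>\<^sup>+g. F (gs0(i := g)) \<partial>posterior zs gs0 i)"
      unfolding 0 posterior_0
      by (intro nn_integral_cong arg_cong[of _ _ F]) (auto simp: gs0_def fun_eq_iff)
    also have "\<dots> \<le> 1" by (rule le[OF gs0])
    finally show ?thesis .
  next
    case (Suc k)
    have I': "{1..k} \<subseteq> I" using I Suc by auto
    interpret prob_space "draws zs k" by (rule prob_draws[OF I' zs])
    have "(\<integral>\<^sup>+gs. F gs \<partial>draws zs i) =
        (\<integral>\<^sup>+gs. \<integral>\<^sup>+g. F (gs(i := g)) \<partial>posterior zs gs i \<partial>draws zs k)"
      unfolding Suc by (rule nn_integral_draws_Suc[OF I[unfolded Suc] zs F[unfolded Suc]])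
    also have "\<dots> \<le> (\<integral>\<^sup>+gs. 1 \<partial>draws zs k)"
    proof (rule nn_integral_mono)
      fix gs assume "gs \<in> space (draws zs k)"
      then have gs: "gs(i := g0) \<in> space (PiM {..i} (\<lambda>_. G))"
        using g0 by (auto simp: space_draws[OF I' zs] Suc space_PiM PiE_iff extensional_def)
      have "posterior zs (gs(i := g0)) i = posterior zs gs i"
        by (subst cumloss_cong[of i zs zs "gs(i := g0)" gs]) auto
      with le[OF gs] show "(\<integral>\<^sup>+g. F (gs(i := g)) \<partial>posterior zs gs i) \<le> 1" by simp
    qed
    also have "\<dots> = 1" using emeasure_space_1 by simp
    finally show ?thesis .
  qed
qed

text \<open>Normalized so that the mean over the draw with index \<open>i\<close> is at most 1, while the product over
  \<open>i\<close> telescopes.\<close>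

definition gain :: "(nat \<Rightarrow> 'z) \<Rightarrow> (nat \<Rightarrow> 'g) \<Rightarrow> nat \<Rightarrow> real" where
  "gain zs gs i = exp (lam * L (zs (Suc i)) (gs i)) * normalizer zs gs (Suc i) / normalizer zs gs i"

lemma normalizer_cong:
  assumes "\<And>j. j \<in> {1..i} \<Longrightarrow> zs j = zs' j" "\<And>j. j < i \<Longrightarrow> gs j = gs' j"
  shows "normalizer zs gs i = normalizer zs' gs' i"
  unfolding normalizer_def using cumloss_cong[of i zs zs' gs gs'] assms by simp

lemma measurable_normalizer:
  assumes "\<And>j. j < i \<Longrightarrow> (\<lambda>x. zs x (Suc j)) \<in> M \<rightarrow>\<^sub>M P"
    and "\<And>j. j < i \<Longrightarrow> (\<lambda>x. gs x j) \<in> M \<rightarrow>\<^sub>M G"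
  shows "(\<lambda>x. normalizer (zs x) (gs x) i) \<in> borel_measurable M"
proof -
  interpret prob_space \<pi> by (rule prob_prior)
  have [measurable]: "(\<lambda>x. cumloss (zs (fst x)) (gs (fst x)) i (snd x)) \<in> borel_measurable (M \<Otimes>\<^sub>M G)"
    by (intro measurable_cumloss measurable_compose[OF measurable_fst] assms) auto
  show ?thesis unfolding normalizer_def by measurable
qed

lemma measurable_gain:
  assumes z: "\<And>j. j \<le> i \<Longrightarrow> (\<lambda>x. zs x (Suc j)) \<in> M \<rightarrow>\<^sub>M P"
    and g: "\<And>j. j \<le> i \<Longrightarrow> (\<lambda>x. gs x j) \<in> M \<rightarrow>\<^sub>M G"
  shows "(\<lambda>x. gain (zs x) (gs x) i) \<in> borel_measurable M"
proof -
  have [measurable]: "(\<lambda>x. normalizer (zs x) (gs x) i) \<in> borel_measurable M"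
    "(\<lambda>x. normalizer (zs x) (gs x) (Suc i)) \<in> borel_measurable M"
    "(\<lambda>x. L (zs x (Suc i)) (gs x i)) \<in> borel_measurable M"
    by (intro measurable_normalizer measurable_loss z g; simp)+
  show ?thesis unfolding gain_def by measurable
qed

text \<open>Given the earlier draws, \<open>gain\<close> as a function of the last draw g' is the
  mean, over g drawn from the same Gibbs distribution, of the integrand in
  \<open>nn_integral_symmetrization\<close>. Averaging over g' completes the double integral. The
  data stay fixed throughout.\<close>

lemma nn_integral_gain:
  assumes I: "{1..Suc i} \<subseteq> I" and zs: "zs \<in> space (PiM I (\<lambda>_. P))"
  shows "(\<integral>\<^sup>+gs. ennreal (gain zs gs i) \<partial>draws zs i) \<le> 1"
proof (rule nn_integral_draws_last_le_1)
  show "{1..i} \<subseteq> I" using I by auto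
  have z: "zs (Suc j) \<in> space P" if "j \<le> i" for j
  proof -
    have "Suc j \<in> I" using I that by auto
    then show ?thesis using zs by (auto simp: space_PiM PiE_iff)
  qed
  show "zs \<in> space (PiM I (\<lambda>_. P))" by (rule zs)
  show "(\<lambda>gs. ennreal (gain zs gs i)) \<in> borel_measurable (PiM {..i} (\<lambda>_. G))"
    using measurable_gain[of i "\<lambda>_. zs" "PiM {..i} (\<lambda>_. G)" "\<lambda>gs. gs"] z by simp
  fix gs assume gs: "gs \<in> space (PiM {..i} (\<lambda>_. G))"
  then have g: "gs j \<in> space G" if "j \<le> i" for j
    using that by (auto simp: space_PiM PiE_iff)
  define \<rho> where "\<rho> = posterior zs gs i"
  define z' where "z' = zs (Suc i)"
  define u where "u = (\<lambda>g. lam * L z' g)"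
  have [measurable_cong]: "sets \<rho> = sets G" by (simp add: \<rho>_def)
  have space_\<rho>: "space \<rho> = space G" by (rule sets_eq_imp_space_eq) fact
  have prob: "prob_space \<rho>" unfolding \<rho>_def by (rule prob_posterior) (simp_all add: z g)
  have [measurable]: "(\<lambda>g. L z' g) \<in> borel_measurable G"
    using measurable_loss[of "\<lambda>_. z'" G "\<lambda>g. g"] z by (simp add: z'_def)
  have [measurable]: "u \<in> borel_measurable \<rho>" unfolding u_def by measurable
  have [measurable]: "cumloss zs gs i \<in> borel_measurable G"
    by (rule measurable_cumloss_fixed) (simp_all add: z g)
  have pos: "0 < normalizer zs gs i" by (rule normalizer_pos) (simp_all add: z g)
  have "ennreal (gain zs (gs(i := g')) i)
      = (\<integral>\<^sup>+g. ennreal (exp ((u g' - u g) - (u g' - u g)\<^sup>2 / 2)) \<partial>\<rho>)" if g': "g' \<in> space G" for g'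
  proof -
    let ?gs = "gs(i := g')"
    \<comment> \<open>Coordinate \<open>i\<close> enters neither the cumulative loss nor the
      normalizer at index \<open>i\<close>; the new draw is first felt at \<open>Suc i\<close>, as
      the reference point of the penalty.\<close>
    have same: "normalizer zs ?gs i = normalizer zs gs i" "cumloss zs ?gs i = cumloss zs gs i"
      by (intro normalizer_cong cumloss_cong; simp)+
    have "(\<integral>\<^sup>+g. ennreal (exp ((u g' - u g) - (u g' - u g)\<^sup>2 / 2)) \<partial>\<rho>)
      = (\<integral>\<^sup>+g. ennreal (exp (- (lam * cumloss zs gs i g)) / normalizer zs gs i)
          * ennreal (exp ((u g' - u g) - (u g' - u g)\<^sup>2 / 2)) \<partial>\<pi>)"
    proof -
      have "\<rho> = density \<pi> (\<lambda>g. ennreal (exp (- (lam * cumloss zs gs i g)) / normalizer zs gs i))"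
        unfolding \<rho>_def by (rule posterior_eq) (simp_all add: z g)
      moreover have "u \<in> borel_measurable \<pi>" unfolding u_def by measurable
      ultimately show ?thesis by (simp only:) (rule nn_integral_density; measurable)
    qed
    also have "\<dots> = (\<integral>\<^sup>+g. ennreal (exp (u g') / normalizer zs gs i)
        * ennreal (exp (- (lam * cumloss zs ?gs (Suc i) g))) \<partial>\<pi>)"
    proof (rule nn_integral_cong)
      fix g
      \<comment> \<open>The step to \<open>Suc i\<close> adds the loss and the penalty of
        \<open>z'\<close>, and \<open>lam\<close> times this increment is
        \<open>u g + (u g' - u g)\<^sup>2 / 2\<close>.\<close>
      have "- (lam * cumloss zs gs i g) + ((u g' - u g) - (u g' - u g)\<^sup>2 / 2)
          = u g' - lam * cumloss zs ?gs (Suc i) g"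
        unfolding seqrand_S.simps same(2) u_def z'_def
        by (simp add: power2_eq_square algebra_simps)
      then have "exp (- (lam * cumloss zs gs i g)) * exp ((u g' - u g) - (u g' - u g)\<^sup>2 / 2)
          = exp (u g') * exp (- (lam * cumloss zs ?gs (Suc i) g))"
        by (simp only: exp_add[symmetric] diff_conv_add_uminus)
      then have "exp (- (lam * cumloss zs gs i g)) / normalizer zs gs i
            * exp ((u g' - u g) - (u g' - u g)\<^sup>2 / 2)
          = exp (u g') / normalizer zs gs i * exp (- (lam * cumloss zs ?gs (Suc i) g))"
        by (simp only: times_divide_eq_left)
      then show "ennreal (exp (- (lam * cumloss zs gs i g)) / normalizer zs gs i)
          * ennreal (exp ((u g' - u g) - (u g' - u g)\<^sup>2 / 2))
        = ennreal (exp (u g') / normalizer zs gs i)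
          * ennreal (exp (- (lam * cumloss zs ?gs (Suc i) g)))"
        by (simp only: ennreal_mult''[OF exp_ge_zero, symmetric])
    qed
    also have "\<dots> = ennreal (exp (u g') / normalizer zs gs i) * ennreal (normalizer zs ?gs (Suc i))"
    proof (subst nn_integral_cmult)
      show "(\<lambda>g. ennreal (exp (- (lam * cumloss zs ?gs (Suc i) g)))) \<in> borel_measurable \<pi>"
        unfolding seqrand_S.simps same(2) by (simp add: z'_def[symmetric])
      show "ennreal (exp (u g') / normalizer zs gs i)
          * (\<integral>\<^sup>+g. ennreal (exp (- (lam * cumloss zs ?gs (Suc i) g))) \<partial>\<pi>)
        = ennreal (exp (u g') / normalizer zs gs i) * ennreal (normalizer zs ?gs (Suc i))"
        by (subst nn_integral_exp_cumloss) (auto simp: z g g')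
    qed
    also have "\<dots> = ennreal (gain zs ?gs i)"
    proof -
      have "0 < normalizer zs ?gs (Suc i)" by (rule normalizer_pos) (auto simp: z g g')
      then show ?thesis
        using pos by (simp add: gain_def same u_def z'_def ennreal_mult[symmetric])
    qed
    finally show ?thesis by (rule sym)
  qed
  then have "(\<integral>\<^sup>+g'. ennreal (gain zs (gs(i := g')) i) \<partial>\<rho>)
     = (\<integral>\<^sup>+g'. \<integral>\<^sup>+g. ennreal (exp ((u g' - u g) - (u g' - u g)\<^sup>2 / 2)) \<partial>\<rho> \<partial>\<rho>)"
    by (intro nn_integral_cong) (simp add: space_\<rho>)
  also have "\<dots> \<le> 1" by (rule nn_integral_symmetrization[OF prob]) fact
  finally show "(\<integral>\<^sup>+g. ennreal (gain zs (gs(i := g)) i) \<partial>posterior zs gs i) \<le> 1"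
    by (simp add: \<rho>_def)
qed

section \<open>Independence of a draw from the next observation\<close>

lemma prob_data: "prob_space (PiM I (\<lambda>_. P))"
  by (intro prob_space_PiM prob_P)

lemma nn_integral_data_insert:
  assumes "finite A" "k \<notin> A" "f \<in> borel_measurable (PiM (insert k A) (\<lambda>_. P))"
  shows "(\<integral>\<^sup>+zs. f zs \<partial>PiM (insert k A) (\<lambda>_. P)) = (\<integral>\<^sup>+zs. \<integral>\<^sup>+z. f (zs(k := z)) \<partial>P \<partial>PiM A (\<lambda>_. P))"
proof -
  interpret product_sigma_finite "\<lambda>_. P"
    by (rule product_sigma_finite.intro) (rule prob_space_imp_sigma_finite[OF prob_P])
  show ?thesis using assms by (rule product_nn_integral_insert)
qed

lemma borel_measurable_nn_integral_draws:
  assumes I: "{1..i} \<subseteq> I"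
    and F: "(\<lambda>(zs, gs). F zs gs) \<in> borel_measurable (PiM I (\<lambda>_. P) \<Otimes>\<^sub>M PiM {..i} (\<lambda>_. G))"
  shows "(\<lambda>zs. \<integral>\<^sup>+gs. F zs gs \<partial>draws zs i) \<in> borel_measurable (PiM I (\<lambda>_. P))"
  using measurable_prob_algebraD[OF measurable_draws[OF I]]
  by (rule nn_integral_measurable_subprob_algebra2[OF F])

text \<open>After the later draws are integrated out, only \<open>draws zs i\<close> is left, which
  by \<open>draws_cong\<close> does not read observation \<open>Suc i\<close>. That observation may
  thus be replaced by a fresh one with law \<open>P\<close>.\<close>

lemma nn_integral_resample:
  assumes i: "i \<le> n"
    and \<phi> [measurable]: "\<phi> \<in> borel_measurable (P \<Otimes>\<^sub>M G)"
  shows "(\<integral>\<^sup>+zs. \<integral>\<^sup>+gs. \<phi> (zs (Suc i), gs i) \<partial>draws zs n \<partial>PiM {1..Suc n} (\<lambda>_. P))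
    = (\<integral>\<^sup>+zs. \<integral>\<^sup>+gs. \<integral>\<^sup>+z. \<phi> (z, gs i) \<partial>P \<partial>draws zs n \<partial>PiM {1..Suc n} (\<lambda>_. P))"
proof -
  interpret P: prob_space P by (rule prob_P)
  let ?I = "{1..Suc n}"
  \<comment> \<open>All observations but the one to be resampled. Since \<open>A\<close> still
    contains \<open>{1..i}\<close>, the law \<open>draws zs i\<close> is well defined on data
    indexed by \<open>A\<close>.\<close>
  define A where "A = {1..Suc n} - {Suc i}"
  have I: "?I = insert (Suc i) A" and A: "finite A" "Suc i \<notin> A" and iA: "{1..i} \<subseteq> A"
    using i by (auto simp: A_def)
  have sub: "{1..n} \<subseteq> ?I" "{1..i} \<subseteq> ?I" using i by auto
  have [measurable]: "(\<lambda>zs. zs (Suc i)) \<in> PiM ?I (\<lambda>_. P) \<rightarrow>\<^sub>M P"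
    using i by (intro measurable_component_singleton) auto
  have gi [measurable]: "(\<lambda>gs. gs i) \<in> PiM {..i} (\<lambda>_. G) \<rightarrow>\<^sub>M G"
    by (intro measurable_component_singleton) auto
  have marginal: "(\<integral>\<^sup>+gs. f (gs i) \<partial>draws zs n) = (\<integral>\<^sup>+gs. f (gs i) \<partial>draws zs i)"
    if "zs \<in> space (PiM ?I (\<lambda>_. P))" "f \<in> borel_measurable G" for f :: "'g \<Rightarrow> ennreal" and zs
    using nn_integral_draws_marginal[OF i sub(1) that(1) measurable_compose[OF gi that(2)]] by simp
  have split: "(\<integral>\<^sup>+zs. \<integral>\<^sup>+gs. F (zs (Suc i)) (gs i) \<partial>draws zs n \<partial>PiM ?I (\<lambda>_. P))
    = (\<integral>\<^sup>+zs. \<integral>\<^sup>+z. \<integral>\<^sup>+gs. F z (gs i) \<partial>draws zs i \<partial>P \<partial>PiM A (\<lambda>_. P))"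
    if [measurable]: "case_prod F \<in> borel_measurable (P \<Otimes>\<^sub>M G)" for F :: "'z \<Rightarrow> 'g \<Rightarrow> ennreal"
  proof -
    have "(\<integral>\<^sup>+zs. \<integral>\<^sup>+gs. F (zs (Suc i)) (gs i) \<partial>draws zs n \<partial>PiM ?I (\<lambda>_. P))
       = (\<integral>\<^sup>+zs. \<integral>\<^sup>+gs. F (zs (Suc i)) (gs i) \<partial>draws zs i \<partial>PiM ?I (\<lambda>_. P))"
    proof (rule nn_integral_cong)
      fix zs assume zs: "zs \<in> space (PiM ?I (\<lambda>_. P))"
      then have "zs (Suc i) \<in> space P" using i by (auto simp: space_PiM PiE_iff)
      then have "F (zs (Suc i)) \<in> borel_measurable G" by measurable
      then show "(\<integral>\<^sup>+gs. F (zs (Suc i)) (gs i) \<partial>draws zs n) = (\<integral>\<^sup>+gs. F (zs (Suc i)) (gs i) \<partial>draws zs i)"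
        by (rule marginal[OF zs])
    qed
    also have "\<dots> = (\<integral>\<^sup>+zs. \<integral>\<^sup>+z. \<integral>\<^sup>+gs. F ((zs(Suc i := z)) (Suc i)) (gs i)
        \<partial>draws (zs(Suc i := z)) i \<partial>P \<partial>PiM A (\<lambda>_. P))"
    proof -
      have "(\<lambda>zs. \<integral>\<^sup>+gs. F (zs (Suc i)) (gs i) \<partial>draws zs i) \<in> borel_measurable (PiM ?I (\<lambda>_. P))"
        by (rule borel_measurable_nn_integral_draws[OF sub(2)]) measurable
      then show ?thesis
        unfolding I by (rule nn_integral_data_insert[OF A])
    qed
    also have "\<dots> = (\<integral>\<^sup>+zs. \<integral>\<^sup>+z. \<integral>\<^sup>+gs. F z (gs i) \<partial>draws zs i \<partial>P \<partial>PiM A (\<lambda>_. P))"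
    proof (intro nn_integral_cong)
      fix zs z
      have "draws (zs(Suc i := z)) i = draws zs i" by (rule draws_cong) auto
      then show "(\<integral>\<^sup>+gs. F ((zs(Suc i := z)) (Suc i)) (gs i) \<partial>draws (zs(Suc i := z)) i)
        = (\<integral>\<^sup>+gs. F z (gs i) \<partial>draws zs i)" by simp
    qed
    finally show ?thesis .
  qed
  have "(\<integral>\<^sup>+zs. \<integral>\<^sup>+gs. \<phi> (zs (Suc i), gs i) \<partial>draws zs n \<partial>PiM ?I (\<lambda>_. P))
    = (\<integral>\<^sup>+zs. \<integral>\<^sup>+z. \<integral>\<^sup>+gs. \<phi> (z, gs i) \<partial>draws zs i \<partial>P \<partial>PiM A (\<lambda>_. P))"
    by (rule split) simp
  \<comment> \<open>The integral over \<open>z\<close> is now vacuous. It is kept so that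
    \<open>split\<close>, applied to a function of the draw alone, can be read backwards to restore
    the full data and all the draws.\<close>
  also have "\<dots> = (\<integral>\<^sup>+zs. \<integral>\<^sup>+z. \<integral>\<^sup>+gs. \<integral>\<^sup>+z'. \<phi> (z', gs i) \<partial>P \<partial>draws zs i \<partial>P \<partial>PiM A (\<lambda>_. P))"
  proof (rule nn_integral_cong)
    fix zs assume zs: "zs \<in> space (PiM A (\<lambda>_. P))"
    interpret Q: prob_space "draws zs i" by (rule prob_draws[OF iA zs])
    interpret pair_sigma_finite "draws zs i" P ..
    note [measurable_cong] = sets_draws[OF iA zs]
    have "(\<integral>\<^sup>+z. \<integral>\<^sup>+gs. \<phi> (z, gs i) \<partial>draws zs i \<partial>P) = (\<integral>\<^sup>+gs. \<integral>\<^sup>+z. \<phi> (z, gs i) \<partial>P \<partial>draws zs i)"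
      by (rule Fubini') measurable
    then show "(\<integral>\<^sup>+z. \<integral>\<^sup>+gs. \<phi> (z, gs i) \<partial>draws zs i \<partial>P)
      = (\<integral>\<^sup>+z. \<integral>\<^sup>+gs. \<integral>\<^sup>+z'. \<phi> (z', gs i) \<partial>P \<partial>draws zs i \<partial>P)"
      using P.emeasure_space_1 by simp
  qed
  also have "\<dots> = (\<integral>\<^sup>+zs. \<integral>\<^sup>+gs. \<integral>\<^sup>+z. \<phi> (z, gs i) \<partial>P \<partial>draws zs n \<partial>PiM ?I (\<lambda>_. P))"
    by (rule split[symmetric]) measurable
  finally show ?thesis .
qed

section \<open>The output distribution and its average over the data\<close>

abbreviation "output n zs \<equiv> seqrand G L lam penalty (\<lambda>\<rho>. \<rho>) \<pi> n zs"

lemma measurable_pick: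
  "(\<lambda>gs. distr (uniform_count_measure {..n::nat}) G gs) \<in> PiM {..n} (\<lambda>_. G) \<rightarrow>\<^sub>M prob_algebra G"
proof (rule measurable_distr_prob_space2)
  show "(\<lambda>gs. uniform_count_measure {..n}) \<in> PiM {..n} (\<lambda>_. G) \<rightarrow>\<^sub>M prob_algebra (count_space {..n})"
    by (intro measurable_const)
       (auto simp: space_prob_algebra sets_uniform_count_measure_count_space intro!: prob_space_uniform_count_measure)
  show "(\<lambda>(gs, k). gs k) \<in> PiM {..n} (\<lambda>_. G) \<Otimes>\<^sub>M count_space {..n} \<rightarrow>\<^sub>M G"
    unfolding split_beta
    by (rule measurable_compose_countable'[OF _ measurable_snd, where f="\<lambda>k x. fst x k"])
       (auto intro: measurable_compose[OF measurable_fst measurable_component_singleton])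
qed

lemma measurable_output:
  assumes "{1..n} \<subseteq> I"
  shows "output n \<in> PiM I (\<lambda>_. P) \<rightarrow>\<^sub>M prob_algebra G"
  unfolding seqrand_def
  by (rule measurable_bind_prob_space2[OF measurable_draws[OF assms]])
     (unfold split_beta, rule measurable_compose[OF measurable_snd measurable_pick])

lemma output_cong:
  assumes "\<And>j. j \<in> {1..n} \<Longrightarrow> zs j = zs' j"
  shows "output n zs = output n zs'"
  unfolding seqrand_def using draws_cong[OF assms] by simp

lemma nn_integral_output:
  assumes I: "{1..n} \<subseteq> I" and zs: "zs \<in> space (PiM I (\<lambda>_. P))" and f: "f \<in> borel_measurable G"
  shows "of_nat (Suc n) * (\<integral>\<^sup>+g. f g \<partial>output n zs) = (\<Sum>i\<le>n. \<integral>\<^sup>+gs. f (gs i) \<partial>draws zs n)"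
proof -
  have pick: "(\<integral>\<^sup>+g. f g \<partial>distr (uniform_count_measure {..n}) G gs) = (\<Sum>i\<le>n. ennreal (1 / Suc n) * f (gs i))"
    if "gs \<in> space (PiM {..n} (\<lambda>_. G))" for gs
  proof -
    have "gs \<in> uniform_count_measure {..n} \<rightarrow>\<^sub>M G"
      using that by (auto simp: space_PiM measurable_cong_sets[OF sets_uniform_count_measure_count_space refl])
    then show ?thesis
      using f by (simp add: nn_integral_distr uniform_count_measure_def nn_integral_point_measure_finite)
  qed
  have comp: "(\<lambda>gs. f (gs i)) \<in> borel_measurable (draws zs n)" if "i \<le> n" for i
    unfolding measurable_cong_sets[OF sets_draws[OF I zs] refl]
  proof -
    have "i \<in> {..n}" using that by simp
    then have "(\<lambda>gs. gs i) \<in> PiM {..n} (\<lambda>_. G) \<rightarrow>\<^sub>M G" by (rule measurable_component_singleton)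
    then show "(\<lambda>gs. f (gs i)) \<in> borel_measurable (PiM {..n} (\<lambda>_. G))"
      using f by (rule measurable_compose)
  qed
  have "(\<integral>\<^sup>+g. f g \<partial>output n zs)
      = (\<integral>\<^sup>+gs. \<integral>\<^sup>+g. f g \<partial>distr (uniform_count_measure {..n}) G gs \<partial>draws zs n)"
    unfolding seqrand_def using measurable_prob_algebraD[OF measurable_pick]
    by (intro nn_integral_bind[OF f]) (simp add: measurable_cong_sets[OF sets_draws[OF I zs] refl])
  also have "\<dots> = (\<integral>\<^sup>+gs. (\<Sum>i\<le>n. ennreal (1 / Suc n) * f (gs i)) \<partial>draws zs n)"
    by (rule nn_integral_cong) (simp add: pick space_draws[OF I zs])
  also have "\<dots> = (\<Sum>i\<le>n. ennreal (1 / Suc n) * (\<integral>\<^sup>+gs. f (gs i) \<partial>draws zs n))"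
    using comp by (subst nn_integral_sum) (auto simp: nn_integral_cmult)
  finally show ?thesis
    by (simp only: sum_distrib_left[symmetric] mult.assoc[symmetric] ennreal_of_nat_eq_real_of_nat
        ennreal_mult'[symmetric] of_nat_0_le_iff) simp
qed

text \<open>The unconditional law of the output function. The squared-difference term of the bound
  sees the algorithm only through it, and so does the expected risk once the iterated expectation is
  flattened.\<close>

definition mixture :: "nat \<Rightarrow> 'g measure" where
  "mixture n = PiM {1..n} (\<lambda>_. P) \<bind> output n"

lemma
  shows prob_mixture: "prob_space (mixture n)"
    and sets_mixture [measurable_cong, simp]: "sets (mixture n) = sets G"
proof -
  have "PiM {1..n} (\<lambda>_. P) \<in> space (prob_algebra (PiM {1..n} (\<lambda>_. P)))"
    by (simp add: space_prob_algebra prob_data)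
  then have "mixture n \<in> space (prob_algebra G)"
    unfolding mixture_def
    using measurable_space[OF measurable_bind_prob_space[OF measurable_ident measurable_output[OF order_refl]]]
    by simp
  then show "prob_space (mixture n)" "sets (mixture n) = sets G"
    by (simp_all add: space_prob_algebra)
qed

lemma nn_integral_mixture:
  assumes "f \<in> borel_measurable G"
  shows "(\<integral>\<^sup>+g. f g \<partial>mixture n) = (\<integral>\<^sup>+zs. \<integral>\<^sup>+g. f g \<partial>output n zs \<partial>PiM {1..n} (\<lambda>_. P))"
  unfolding mixture_def
  by (rule nn_integral_bind[OF assms measurable_prob_algebraD[OF measurable_output[OF order_refl]]])

text \<open>The output ignores observation \<open>Suc n\<close>, so its law can be computed on the
  longer sample, which is the one that supplies an unseen observation for the last draw.\<close>

lemma nn_integral_mixture_Suc: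
  assumes f: "f \<in> borel_measurable G"
  shows "(\<integral>\<^sup>+g. f g \<partial>mixture n) = (\<integral>\<^sup>+zs. \<integral>\<^sup>+g. f g \<partial>output n zs \<partial>PiM {1..Suc n} (\<lambda>_. P))"
proof -
  interpret P: prob_space P by (rule prob_P)
  have I: "{1..Suc n} = insert (Suc n) {1..n}" by auto
  have "(\<lambda>zs. \<integral>\<^sup>+g. f g \<partial>output n zs) \<in> borel_measurable (PiM (insert (Suc n) {1..n}) (\<lambda>_. P))"
    by (rule measurable_compose[OF measurable_prob_algebraD[OF measurable_output]
          nn_integral_measurable_subprob_algebra[OF f]]) auto
  then have "(\<integral>\<^sup>+zs. \<integral>\<^sup>+g. f g \<partial>output n zs \<partial>PiM {1..Suc n} (\<lambda>_. P))
    = (\<integral>\<^sup>+zs. \<integral>\<^sup>+z. \<integral>\<^sup>+g. f g \<partial>output n (zs(Suc n := z)) \<partial>P \<partial>PiM {1..n} (\<lambda>_. P))"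
    unfolding I by (intro nn_integral_data_insert) auto
  also have "\<dots> = (\<integral>\<^sup>+zs. \<integral>\<^sup>+z. \<integral>\<^sup>+g. f g \<partial>output n zs \<partial>P \<partial>PiM {1..n} (\<lambda>_. P))"
  proof (intro nn_integral_cong)
    fix zs z
    have "output n (zs(Suc n := z)) = output n zs" by (rule output_cong) auto
    then show "(\<integral>\<^sup>+g. f g \<partial>output n (zs(Suc n := z))) = (\<integral>\<^sup>+g. f g \<partial>output n zs)" by simp
  qed
  finally show ?thesis
    using P.emeasure_space_1 by (simp add: nn_integral_mixture[OF f])
qed

text \<open>The observation with index \<open>n + 1\<close> is not seen by the algorithm. It plays for the draw with
  index \<open>n\<close> the role that the observation \<open>i + 1\<close> plays for the draw with index \<open>i\<close>.\<close>

definition joint :: "nat \<Rightarrow> ((nat \<Rightarrow> 'z) \<times> (nat \<Rightarrow> 'g)) measure" where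
  "joint n = PiM {1..Suc n} (\<lambda>_. P) \<bind> (\<lambda>zs.
     distr (draws zs n) (PiM {1..Suc n} (\<lambda>_. P) \<Otimes>\<^sub>M PiM {..n} (\<lambda>_. G)) (Pair zs))"

lemma measurable_joint_kernel:
  "(\<lambda>zs. distr (draws zs n) (PiM {1..Suc n} (\<lambda>_. P) \<Otimes>\<^sub>M PiM {..n} (\<lambda>_. G)) (Pair zs))
    \<in> PiM {1..Suc n} (\<lambda>_. P) \<rightarrow>\<^sub>M prob_algebra (PiM {1..Suc n} (\<lambda>_. P) \<Otimes>\<^sub>M PiM {..n} (\<lambda>_. G))"
  by (rule measurable_distr_prob_space2[OF measurable_draws]) auto

lemma
  shows prob_joint: "prob_space (joint n)"
    and sets_joint [measurable_cong, simp]: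
      "sets (joint n) = sets (PiM {1..Suc n} (\<lambda>_. P) \<Otimes>\<^sub>M PiM {..n} (\<lambda>_. G))"
proof -
  have "PiM {1..Suc n} (\<lambda>_. P) \<in> space (prob_algebra (PiM {1..Suc n} (\<lambda>_. P)))"
    by (simp add: space_prob_algebra prob_data)
  then have "joint n \<in> space (prob_algebra (PiM {1..Suc n} (\<lambda>_. P) \<Otimes>\<^sub>M PiM {..n} (\<lambda>_. G)))"
    unfolding joint_def
    using measurable_space[OF measurable_bind_prob_space[OF measurable_ident measurable_joint_kernel]]
    by simp
  then show "prob_space (joint n)"
    "sets (joint n) = sets (PiM {1..Suc n} (\<lambda>_. P) \<Otimes>\<^sub>M PiM {..n} (\<lambda>_. G))"
    by (simp_all add: space_prob_algebra)
qed

lemma nn_integral_joint: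
  assumes f: "f \<in> borel_measurable (PiM {1..Suc n} (\<lambda>_. P) \<Otimes>\<^sub>M PiM {..n} (\<lambda>_. G))"
  shows "(\<integral>\<^sup>+x. f x \<partial>joint n) = (\<integral>\<^sup>+zs. \<integral>\<^sup>+gs. f (zs, gs) \<partial>draws zs n \<partial>PiM {1..Suc n} (\<lambda>_. P))"
proof -
  have I: "{1..n} \<subseteq> {1..Suc n}" by auto
  have "(\<integral>\<^sup>+x. f x \<partial>joint n) = (\<integral>\<^sup>+zs. \<integral>\<^sup>+x. f x
      \<partial>distr (draws zs n) (PiM {1..Suc n} (\<lambda>_. P) \<Otimes>\<^sub>M PiM {..n} (\<lambda>_. G)) (Pair zs) \<partial>PiM {1..Suc n} (\<lambda>_. P))"
    unfolding joint_def
    by (rule nn_integral_bind[OF f measurable_prob_algebraD[OF measurable_joint_kernel]])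
  also have "\<dots> = (\<integral>\<^sup>+zs. \<integral>\<^sup>+gs. f (zs, gs) \<partial>draws zs n \<partial>PiM {1..Suc n} (\<lambda>_. P))"
  proof (rule nn_integral_cong)
    fix zs assume zs: "zs \<in> space (PiM {1..Suc n} (\<lambda>_. P))"
    have "Pair zs \<in> draws zs n \<rightarrow>\<^sub>M PiM {1..Suc n} (\<lambda>_. P) \<Otimes>\<^sub>M PiM {..n} (\<lambda>_. G)"
      unfolding measurable_cong_sets[OF sets_draws[OF I zs] refl] by (rule measurable_Pair1'[OF zs])
    then show "(\<integral>\<^sup>+x. f x \<partial>distr (draws zs n) (PiM {1..Suc n} (\<lambda>_. P) \<Otimes>\<^sub>M PiM {..n} (\<lambda>_. G)) (Pair zs))
      = (\<integral>\<^sup>+gs. f (zs, gs) \<partial>draws zs n)"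
      by (rule nn_integral_distr) (simp only: measurable_distr_eq1 f)
  qed
  finally show ?thesis .
qed

section \<open>Draws paired with the observations that follow them\<close>

abbreviation "obs_draw i \<equiv> (\<lambda>(zs, gs). (zs (Suc i), gs i))"

lemma measurable_joint_components:
  assumes "i \<le> n"
  shows "(\<lambda>x. fst x (Suc i)) \<in> joint n \<rightarrow>\<^sub>M P" "(\<lambda>x. snd x i) \<in> joint n \<rightarrow>\<^sub>M G"
proof -
  have 1: "Suc i \<in> {1..Suc n}" and 2: "i \<in> {..n}" using assms by auto
  show "(\<lambda>x. fst x (Suc i)) \<in> joint n \<rightarrow>\<^sub>M P"
    unfolding measurable_cong_sets[OF sets_joint refl]
    by (rule measurable_compose[OF measurable_fst measurable_component_singleton[OF 1]])
  show "(\<lambda>x. snd x i) \<in> joint n \<rightarrow>\<^sub>M G"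
    unfolding measurable_cong_sets[OF sets_joint refl]
    by (rule measurable_compose[OF measurable_snd measurable_component_singleton[OF 2]])
qed

lemma measurable_obs_draw:
  "i \<le> n \<Longrightarrow> obs_draw i \<in> joint n \<rightarrow>\<^sub>M P \<Otimes>\<^sub>M G"
  unfolding split_beta by (intro measurable_Pair measurable_joint_components)

text \<open>Resampling makes the observation independent of the draw, and the uniform choice of the
  index turns the sum over the draws into \<open>n + 1\<close> copies of the output law. Only the
  sum has such a description, because the draws have different laws.\<close>

lemma nn_integral_sum_obs_draw:
  assumes \<phi> [measurable]: "\<phi> \<in> borel_measurable (P \<Otimes>\<^sub>M G)"
  shows "(\<Sum>i\<le>n. \<integral>\<^sup>+x. \<phi> (obs_draw i x) \<partial>joint n) = of_nat (Suc n) * (\<integral>\<^sup>+x. \<phi> x \<partial>(P \<Otimes>\<^sub>M mixture n))"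
proof -
  interpret P: prob_space P by (rule prob_P)
  interpret \<mu>: prob_space "mixture n" by (rule prob_mixture)
  interpret pair_sigma_finite P "mixture n" ..
  let ?D = "PiM {1..Suc n} (\<lambda>_. P)"
  define \<psi> where "\<psi> g = (\<integral>\<^sup>+z. \<phi> (z, g) \<partial>P)" for g
  have [measurable]: "\<psi> \<in> borel_measurable G" unfolding \<psi>_def by measurable
  have I: "{1..n} \<subseteq> {1..Suc n}" by auto
  have single: "(\<integral>\<^sup>+x. \<phi> (obs_draw i x) \<partial>joint n) = (\<integral>\<^sup>+zs. \<integral>\<^sup>+gs. \<psi> (gs i) \<partial>draws zs n \<partial>?D)"
    if "i \<le> n" for i
  proof -
    have "(\<lambda>x. \<phi> (obs_draw i x)) \<in> borel_measurable (?D \<Otimes>\<^sub>M PiM {..n} (\<lambda>_. G))"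
      using measurable_compose[OF measurable_obs_draw[OF that] \<phi>]
      unfolding measurable_cong_sets[OF sets_joint refl] .
    then show ?thesis
      unfolding \<psi>_def using nn_integral_resample[OF that \<phi>] by (simp add: nn_integral_joint)
  qed
  have meas: "(\<lambda>zs. \<integral>\<^sup>+gs. \<psi> (gs i) \<partial>draws zs n) \<in> borel_measurable ?D" if "i \<le> n" for i
  proof (rule borel_measurable_nn_integral_draws[OF I])
    have "(\<lambda>x. snd x i) \<in> ?D \<Otimes>\<^sub>M PiM {..n} (\<lambda>_. G) \<rightarrow>\<^sub>M G"
      using that by (intro measurable_compose[OF measurable_snd measurable_component_singleton]) auto
    then show "(\<lambda>(zs, gs). \<psi> (gs i)) \<in> borel_measurable (?D \<Otimes>\<^sub>M PiM {..n} (\<lambda>_. G))"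
      unfolding split_beta by measurable
  qed
  have "(\<Sum>i\<le>n. \<integral>\<^sup>+x. \<phi> (obs_draw i x) \<partial>joint n) = (\<integral>\<^sup>+zs. (\<Sum>i\<le>n. \<integral>\<^sup>+gs. \<psi> (gs i) \<partial>draws zs n) \<partial>?D)"
    using meas by (subst nn_integral_sum) (auto simp: single)
  also have "\<dots> = (\<integral>\<^sup>+zs. of_nat (Suc n) * (\<integral>\<^sup>+g. \<psi> g \<partial>output n zs) \<partial>?D)"
    by (intro nn_integral_cong nn_integral_output[OF I, symmetric]) auto
  also have "\<dots> = of_nat (Suc n) * (\<integral>\<^sup>+zs. \<integral>\<^sup>+g. \<psi> g \<partial>output n zs \<partial>?D)"
    by (intro nn_integral_cmult measurable_compose[OF measurable_prob_algebraD[OF measurable_output]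
          nn_integral_measurable_subprob_algebra]) auto
  also have "\<dots> = of_nat (Suc n) * (\<integral>\<^sup>+g. \<psi> g \<partial>mixture n)"
    by (simp add: nn_integral_mixture_Suc)
  also have "\<dots> = of_nat (Suc n) * (\<integral>\<^sup>+x. \<phi> x \<partial>(P \<Otimes>\<^sub>M mixture n))"
    unfolding \<psi>_def by (subst nn_integral_snd[symmetric]) auto
  finally show ?thesis .
qed

lemma nn_integral_gain_joint:
  assumes i: "i \<le> n"
  shows "(\<integral>\<^sup>+x. ennreal (gain (fst x) (snd x) i) \<partial>joint n) \<le> 1"
proof -
  interpret D: prob_space "PiM {1..Suc n} (\<lambda>_. P)" by (rule prob_data)
  let ?D = "PiM {1..Suc n} (\<lambda>_. P)"
  have I: "{1..n} \<subseteq> {1..Suc n}" "{1..Suc i} \<subseteq> {1..Suc n}" using i by auto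
  have "(\<lambda>x. gain (fst x) (snd x) i) \<in> borel_measurable (joint n)"
    using i by (intro measurable_gain[of i "\<lambda>x. fst x" "joint n" "\<lambda>x. snd x"] measurable_joint_components) auto
  then have "(\<integral>\<^sup>+x. ennreal (gain (fst x) (snd x) i) \<partial>joint n)
    = (\<integral>\<^sup>+zs. \<integral>\<^sup>+gs. ennreal (gain zs gs i) \<partial>draws zs n \<partial>?D)"
    unfolding measurable_cong_sets[OF sets_joint refl] by (subst nn_integral_joint) auto
  also have "\<dots> \<le> (\<integral>\<^sup>+zs. 1 \<partial>?D)"
  proof (rule nn_integral_mono)
    fix zs assume zs: "zs \<in> space ?D"
    have z: "zs (Suc j) \<in> space P" if "j \<le> i" for j
      using zs that i by (auto simp: space_PiM PiE_iff)
    have meas: "(\<lambda>gs. ennreal (gain zs gs i)) \<in> borel_measurable (PiM {..i} (\<lambda>_. G))"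
      using measurable_gain[of i "\<lambda>_. zs" "PiM {..i} (\<lambda>_. G)" "\<lambda>gs. gs"] z by simp
    have "gain zs (restrict gs {..i}) i = gain zs gs i" for gs
      using normalizer_cong[of "Suc i" zs zs "restrict gs {..i}" gs] normalizer_cong[of i zs zs "restrict gs {..i}" gs]
      by (simp add: gain_def)
    then have "(\<integral>\<^sup>+gs. ennreal (gain zs gs i) \<partial>draws zs n) = (\<integral>\<^sup>+gs. ennreal (gain zs gs i) \<partial>draws zs i)"
      using nn_integral_draws_marginal[OF i I(1) zs meas] by simp
    also have "\<dots> \<le> 1" by (rule nn_integral_gain[OF I(2) zs])
    finally show "(\<integral>\<^sup>+gs. ennreal (gain zs gs i) \<partial>draws zs n) \<le> 1" .
  qed
  also have "\<dots> = 1" using D.emeasure_space_1 by simp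
  finally show ?thesis .
qed

section \<open>Integrating the pathwise inequality\<close>

lemma normalizer_0: "normalizer zs gs 0 = 1"
  using prob_space.prob_space[OF prob_prior] by (simp add: normalizer_def)

lemma sum_ln_gain:
  assumes z: "\<And>j. j \<le> n \<Longrightarrow> zs (Suc j) \<in> space P" and g: "\<And>j. j \<le> n \<Longrightarrow> gs j \<in> space G"
  shows "(\<Sum>i\<le>n. ln (gain zs gs i))
    = lam * (\<Sum>i\<le>n. L (zs (Suc i)) (gs i)) + ln (normalizer zs gs (Suc n))"
proof -
  have pos: "0 < normalizer zs gs i" if "i \<le> Suc n" for i
    using that by (intro normalizer_pos z g) auto
  have "(\<Sum>i\<le>n. ln (gain zs gs i)) = (\<Sum>i\<le>n. lam * L (zs (Suc i)) (gs i)
      + (ln (normalizer zs gs (Suc i)) - ln (normalizer zs gs i)))"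
  proof (rule sum.cong[OF refl])
    fix i assume "i \<in> {..n}"
    then have "0 < normalizer zs gs i" "0 < normalizer zs gs (Suc i)" by (auto intro!: pos)
    then show "ln (gain zs gs i) = lam * L (zs (Suc i)) (gs i)
      + (ln (normalizer zs gs (Suc i)) - ln (normalizer zs gs i))"
      by (simp add: gain_def ln_div ln_mult)
  qed
  also have "\<dots> = lam * (\<Sum>i\<le>n. L (zs (Suc i)) (gs i))
      + (\<Sum>i<Suc n. ln (normalizer zs gs (Suc i)) - ln (normalizer zs gs i))"
    by (simp only: sum.distrib sum_distrib_left lessThan_Suc_atMost)
  also have "(\<Sum>i<Suc n. ln (normalizer zs gs (Suc i)) - ln (normalizer zs gs i)) = ln (normalizer zs gs (Suc n))"
    by (subst sum_lessThan_telescope) (simp add: normalizer_0)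
  finally show ?thesis .
qed

text \<open>For almost every path, \<open>ln x \<le> x - 1\<close> bounds the telescoped sum of the
  log gains from above, and Donsker--Varadhan bounds the log of the last normalizer from below. The
  two integrability hypotheses are those of the losses and the modified losses, carried over to
  \<open>joint n\<close> by \<open>integrable_transfer\<close>; with the gains these are the only
  random quantities in the final inequality.\<close>

lemma regret_bound:
  assumes \<rho>: "\<rho> \<in> space (prob_algebra G)"
    and ac: "absolutely_continuous \<pi> \<rho>"
    and int_ed: "integrable \<rho> (entropy_density (exp 1) \<pi> \<rho>)"
    and int_L: "integrable (P \<Otimes>\<^sub>M mixture n) (\<lambda>(z, g). L z g)"
    and int_S: "integrable ((P \<Otimes>\<^sub>M mixture n) \<Otimes>\<^sub>M \<rho>) (\<lambda>((z, g'), g). L z g + penalty z g g')"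
  shows "lam * (real (Suc n) * (\<integral>x. (case x of (z, g) \<Rightarrow> L z g) \<partial>(P \<Otimes>\<^sub>M mixture n)))
    \<le> lam * (real (Suc n)
        * (\<integral>x. (case x of ((z, g'), g) \<Rightarrow> L z g + penalty z g g') \<partial>((P \<Otimes>\<^sub>M mixture n) \<Otimes>\<^sub>M \<rho>)))
      + KL_divergence (exp 1) \<pi> \<rho>"
proof -
  let ?\<mu> = "mixture n" and ?J = "joint n"
  have "prob_space \<rho>" and [measurable_cong]: "sets \<rho> = sets G"
    using \<rho> by (auto simp: space_prob_algebra)
  interpret \<rho>: prob_space \<rho> by fact
  interpret P: prob_space P by (rule prob_P)
  interpret \<mu>: prob_space ?\<mu> by (rule prob_mixture)
  interpret J: prob_space ?J by (rule prob_joint)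
  interpret J\<rho>: pair_sigma_finite ?J \<rho> ..
  interpret P\<mu>: pair_prob_space P ?\<mu> ..
  interpret N: pair_sigma_finite "P \<Otimes>\<^sub>M ?\<mu>" \<rho> ..
  have sets_N: "sets (P \<Otimes>\<^sub>M ?\<mu>) = sets (P \<Otimes>\<^sub>M G)"
    by (intro sets_pair_measure_cong) auto
  define F where "F = (\<lambda>((z, g'), g). L z g + penalty z g g')"
  define c where "c = real (Suc n)"
  have T: "obs_draw i \<in> ?J \<rightarrow>\<^sub>M P \<Otimes>\<^sub>M ?\<mu>" if "i \<in> {..n}" for i
    using measurable_obs_draw[of i n] that by (simp add: measurable_cong_sets[OF refl sets_N])
  have eq: "(\<Sum>i\<le>n. \<integral>\<^sup>+x. \<phi> (obs_draw i x) \<partial>?J) = ennreal c * (\<integral>\<^sup>+y. \<phi> y \<partial>(P \<Otimes>\<^sub>M ?\<mu>))"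
    if "\<phi> \<in> borel_measurable (P \<Otimes>\<^sub>M ?\<mu>)" for \<phi>
    using nn_integral_sum_obs_draw[of \<phi> n] that
    by (simp add: c_def ennreal_of_nat_eq_real_of_nat measurable_cong_sets[OF sets_N refl] del: of_nat_Suc)
  \<comment> \<open>The pair of an observation and a draw, completed by a comparison function drawn
    independently from \<rho>.\<close>
  define T' :: "nat \<Rightarrow> ((nat \<Rightarrow> 'z) \<times> (nat \<Rightarrow> 'g)) \<times> 'g \<Rightarrow> ('z \<times> 'g) \<times> 'g"
    where "T' i = (\<lambda>x. (obs_draw i (fst x), snd x))" for i
  have T': "T' i \<in> ?J \<Otimes>\<^sub>M \<rho> \<rightarrow>\<^sub>M (P \<Otimes>\<^sub>M ?\<mu>) \<Otimes>\<^sub>M \<rho>" if "i \<in> {..n}" for i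
    unfolding T'_def using measurable_compose[OF measurable_fst T[OF that]] by (rule measurable_Pair) simp
  have eq': "(\<Sum>i\<le>n. \<integral>\<^sup>+x. \<phi> (T' i x) \<partial>(?J \<Otimes>\<^sub>M \<rho>)) = ennreal c * (\<integral>\<^sup>+y. \<phi> y \<partial>((P \<Otimes>\<^sub>M ?\<mu>) \<Otimes>\<^sub>M \<rho>))"
    if \<phi>: "\<phi> \<in> borel_measurable ((P \<Otimes>\<^sub>M ?\<mu>) \<Otimes>\<^sub>M \<rho>)" for \<phi>
  proof -
    have meas: "(\<lambda>x. \<phi> (T' i x)) \<in> borel_measurable (?J \<Otimes>\<^sub>M \<rho>)" if "i \<in> {..n}" for i
      by (rule measurable_compose[OF T'[OF that] \<phi>])
    have "(\<Sum>i\<le>n. \<integral>\<^sup>+x. \<phi> (T' i x) \<partial>(?J \<Otimes>\<^sub>M \<rho>)) = (\<Sum>i\<le>n. \<integral>\<^sup>+g. \<integral>\<^sup>+x. \<phi> (obs_draw i x, g) \<partial>?J \<partial>\<rho>)"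
      using J\<rho>.nn_integral_snd[OF meas] by (intro sum.cong) (auto simp: T'_def)
    also have "\<dots> = (\<integral>\<^sup>+g. (\<Sum>i\<le>n. \<integral>\<^sup>+x. \<phi> (obs_draw i x, g) \<partial>?J) \<partial>\<rho>)"
    proof (rule nn_integral_sum[symmetric])
      fix i assume "i \<in> {..n}"
      from measurable_pair_swap[OF meas[OF this]]
      show "(\<lambda>g. \<integral>\<^sup>+x. \<phi> (obs_draw i x, g) \<partial>?J) \<in> borel_measurable \<rho>"
        by (intro J.borel_measurable_nn_integral) (simp add: T'_def split_beta)
    qed
    also have "\<dots> = (\<integral>\<^sup>+g. ennreal c * (\<integral>\<^sup>+y. \<phi> (y, g) \<partial>(P \<Otimes>\<^sub>M ?\<mu>)) \<partial>\<rho>)"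
      by (intro nn_integral_cong eq measurable_Pair1[OF \<phi>])
    also have "\<dots> = ennreal c * (\<integral>\<^sup>+g. (\<integral>\<^sup>+y. \<phi> (y, g) \<partial>(P \<Otimes>\<^sub>M ?\<mu>)) \<partial>\<rho>)"
      by (rule nn_integral_cmult) (intro P\<mu>.borel_measurable_nn_integral,
          use measurable_pair_swap[OF \<phi>] in \<open>simp add: split_beta\<close>)
    also have "(\<integral>\<^sup>+g. (\<integral>\<^sup>+y. \<phi> (y, g) \<partial>(P \<Otimes>\<^sub>M ?\<mu>)) \<partial>\<rho>) = (\<integral>\<^sup>+y. \<phi> y \<partial>((P \<Otimes>\<^sub>M ?\<mu>) \<Otimes>\<^sub>M \<rho>))"
      by (rule N.nn_integral_snd[OF \<phi>])
    finally show ?thesis .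
  qed
  have c: "0 \<le> c" by (simp add: c_def)
  note int_LJ = integrable_transfer[where I="{..n}" and T=obs_draw, OF finite_atMost T c eq int_L]
  note sum_LJ = sum_integral_transfer[where I="{..n}" and T=obs_draw, OF finite_atMost T c eq int_L]
  note int_SJ = integrable_transfer[where I="{..n}" and T=T', OF finite_atMost T' c eq' int_S[folded F_def]]
  note sum_SJ = sum_integral_transfer[where I="{..n}" and T=T', OF finite_atMost T' c eq' int_S[folded F_def]]

  \<comment> \<open>Index \<open>Suc n\<close> is one step beyond the algorithm, whose last Gibbs
    distribution uses index \<open>n\<close>. The extra term contains the unseen observation and the
    penalty relative to draw \<open>n\<close>.\<close>
  define S where "S x g = cumloss (fst x) (snd x) (Suc n) g" for x g
  have S: "S x g = (\<Sum>i\<le>n. F (T' i (x, g)))" for x g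
    unfolding S_def cumloss_eq_sum lessThan_Suc_atMost by (simp add: F_def T'_def split_beta)
  have int_S': "integrable (?J \<Otimes>\<^sub>M \<rho>) (\<lambda>(x, g). S x g)"
    unfolding S split_beta using int_SJ by (intro Bochner_Integration.integrable_sum) auto
  have "(\<integral>x. (case x of (x, g) \<Rightarrow> S x g) \<partial>(?J \<Otimes>\<^sub>M \<rho>)) = (\<Sum>i\<le>n. \<integral>x. F (T' i x) \<partial>(?J \<Otimes>\<^sub>M \<rho>))"
    unfolding S split_beta prod.collapse using int_SJ by (intro Bochner_Integration.integral_sum) auto
  also have "\<dots> = c * (\<integral>y. F y \<partial>((P \<Otimes>\<^sub>M ?\<mu>) \<Otimes>\<^sub>M \<rho>))" by (rule sum_SJ)
  finally have integral_S: "(\<integral>x. \<integral>g. S x g \<partial>\<rho> \<partial>?J) = c * (\<integral>y. F y \<partial>((P \<Otimes>\<^sub>M ?\<mu>) \<Otimes>\<^sub>M \<rho>))"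
    using J\<rho>.integral_fst'[OF int_S'] by simp

  have gain_meas: "(\<lambda>x. gain (fst x) (snd x) i) \<in> borel_measurable ?J" if "i \<le> n" for i
    using that by (intro measurable_gain[of i "\<lambda>x. fst x" ?J "\<lambda>x. snd x"] measurable_joint_components) auto
  have zg: "fst x (Suc j) \<in> space P" "snd x j \<in> space G" if "x \<in> space ?J" "j \<le> n" for x j
    using measurable_space[OF measurable_joint_components(1)] measurable_space[OF measurable_joint_components(2)] that
    by auto
  have norm_pos: "0 < normalizer (fst x) (snd x) i" if "x \<in> space ?J" "i \<le> Suc n" for x i
    using that by (intro normalizer_pos zg) auto
  have gain_pos: "0 < gain (fst x) (snd x) i" if "x \<in> space ?J" "i \<le> n" for x i
    using that norm_pos[of x i] norm_pos[of x "Suc i"] by (simp add: gain_def)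
  have gain_int: "integrable ?J (\<lambda>x. gain (fst x) (snd x) i)"
    and gain_le: "(\<integral>x. gain (fst x) (snd x) i \<partial>?J) \<le> 1" if i: "i \<le> n" for i
  proof -
    have AE_pos: "AE x in ?J. 0 \<le> gain (fst x) (snd x) i"
      using gain_pos[OF _ i] by (intro AE_I2) (simp add: less_imp_le)
    show "integrable ?J (\<lambda>x. gain (fst x) (snd x) i)"
      using nn_integral_gain_joint[OF i]
      by (intro integrableI_nonneg gain_meas[OF i] AE_pos) (auto intro: le_less_trans)
    then show "(\<integral>x. gain (fst x) (snd x) i \<partial>?J) \<le> 1"
      using nn_integral_gain_joint[OF i] AE_pos by (subst (asm) nn_integral_eq_integral) auto
  qed

  have "(\<integral>x. lam * (\<Sum>i\<le>n. L (fst x (Suc i)) (snd x i)) \<partial>?J)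
    \<le> (\<integral>x. (\<Sum>i\<le>n. gain (fst x) (snd x) i - 1) + lam * (\<integral>g. S x g \<partial>\<rho>) + KL_divergence (exp 1) \<pi> \<rho> \<partial>?J)"
  proof (rule integral_mono_AE)
    show "integrable ?J (\<lambda>x. lam * (\<Sum>i\<le>n. L (fst x (Suc i)) (snd x i)))"
      using int_LJ by (intro integrable_mult_right Bochner_Integration.integrable_sum) (simp add: split_beta)
    show "integrable ?J (\<lambda>x. (\<Sum>i\<le>n. gain (fst x) (snd x) i - 1) + lam * (\<integral>g. S x g \<partial>\<rho>) + KL_divergence (exp 1) \<pi> \<rho>)"
      using gain_int J\<rho>.integrable_fst'[OF int_S']
      by (intro Bochner_Integration.integrable_add Bochner_Integration.integrable_sum
          Bochner_Integration.integrable_diff integrable_mult_right J.integrable_const) auto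
    \<comment> \<open>Only for almost every path is \<open>S x\<close> integrable under \<rho>, as
      Donsker--Varadhan requires; this is what Fubini's theorem provides.\<close>
    show "AE x in ?J. lam * (\<Sum>i\<le>n. L (fst x (Suc i)) (snd x i))
      \<le> (\<Sum>i\<le>n. gain (fst x) (snd x) i - 1) + lam * (\<integral>g. S x g \<partial>\<rho>) + KL_divergence (exp 1) \<pi> \<rho>"
      using J\<rho>.AE_integrable_fst'[OF int_S'] AE_space
    proof eventually_elim
      case (elim x)
      have int_x: "integrable \<pi> (\<lambda>g. exp (- (lam * S x g)))"
        unfolding S_def using elim by (intro integrable_exp_cumloss zg) auto
      have "(\<integral>g. ln (exp (- (lam * S x g))) \<partial>\<rho>)
          \<le> ln (\<integral>g. exp (- (lam * S x g)) \<partial>\<pi>) + KL_divergence (exp 1) \<pi> \<rho>"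
        using elim \<open>prob_space \<rho>\<close> \<open>sets \<rho> = sets G\<close>
        by (intro donsker_varadhan prob_prior ac int_ed int_x) auto
      then have "- (lam * (\<integral>g. S x g \<partial>\<rho>)) \<le> ln (normalizer (fst x) (snd x) (Suc n)) + KL_divergence (exp 1) \<pi> \<rho>"
        by (simp add: S_def normalizer_def)
      moreover have "(\<Sum>i\<le>n. ln (gain (fst x) (snd x) i)) \<le> (\<Sum>i\<le>n. gain (fst x) (snd x) i - 1)"
        using gain_pos[OF elim(2)] by (intro sum_mono ln_le_minus_one) auto
      moreover have "(\<Sum>i\<le>n. ln (gain (fst x) (snd x) i))
        = lam * (\<Sum>i\<le>n. L (fst x (Suc i)) (snd x i)) + ln (normalizer (fst x) (snd x) (Suc n))"
        using elim by (intro sum_ln_gain zg) auto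
      ultimately show ?case by linarith
    qed
  qed
  also have "\<dots> = (\<Sum>i\<le>n. (\<integral>x. gain (fst x) (snd x) i \<partial>?J) - 1) + lam * (\<integral>x. \<integral>g. S x g \<partial>\<rho> \<partial>?J)
      + KL_divergence (exp 1) \<pi> \<rho>"
  proof -
    have "integrable ?J (\<lambda>x. gain (fst x) (snd x) i - 1)"
      and "(\<integral>x. gain (fst x) (snd x) i - 1 \<partial>?J) = (\<integral>x. gain (fst x) (snd x) i \<partial>?J) - 1"
      if "i \<le> n" for i
      using gain_int[OF that] by (simp_all add: J.prob_space)
    then have "integrable ?J (\<lambda>x. \<Sum>i\<le>n. gain (fst x) (snd x) i - 1)"
      and "(\<integral>x. (\<Sum>i\<le>n. gain (fst x) (snd x) i - 1) \<partial>?J)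
        = (\<Sum>i\<le>n. (\<integral>x. gain (fst x) (snd x) i \<partial>?J) - 1)"
      by (auto simp only: atMost_iff intro!: Bochner_Integration.integrable_sum
          trans[OF Bochner_Integration.integral_sum] sum.cong)
    then show ?thesis
      using J\<rho>.integrable_fst'[OF int_S'] by (simp add: J.prob_space)
  qed
  \<comment> \<open>Each gain has mean at most 1, so the sum of the centred gains drops out.\<close>
  also have "\<dots> \<le> lam * (c * (\<integral>y. F y \<partial>((P \<Otimes>\<^sub>M ?\<mu>) \<Otimes>\<^sub>M \<rho>))) + KL_divergence (exp 1) \<pi> \<rho>"
    using gain_le unfolding integral_S by (auto intro!: sum_nonpos)
  also have "(\<integral>x. lam * (\<Sum>i\<le>n. L (fst x (Suc i)) (snd x i)) \<partial>?J)
      = lam * (\<Sum>i\<le>n. \<integral>x. L (fst x (Suc i)) (snd x i) \<partial>?J)"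
    using int_LJ by (subst Bochner_Integration.integral_mult_right_zero, subst Bochner_Integration.integral_sum)
      (auto simp: split_beta)
  also have "(\<Sum>i\<le>n. \<integral>x. L (fst x (Suc i)) (snd x i) \<partial>?J)
      = c * (\<integral>x. (case x of (z, g) \<Rightarrow> L z g) \<partial>(P \<Otimes>\<^sub>M ?\<mu>))"
    using sum_LJ by (simp add: split_beta)
  finally show ?thesis by (simp only: F_def c_def split_beta)
qed

end

section \<open>The trade-off between risk and divergence\<close>

text \<open>Isolates the minimization over \<rho> from the algorithm: \<mu> stands for
  \<open>mixture n\<close> and \<beta> for \<open>lam * (real n + 1)\<close>.\<close>

locale seqrand_tradeoff = seqrand_setting P G L lam \<pi>
  for P :: "'z measure" and G :: "'g measure" and L :: "'z \<Rightarrow> 'g \<Rightarrow> real"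
    and lam :: real and \<pi> :: "'g measure" +
  fixes \<mu> :: "'g measure" and \<beta> :: real
  assumes prob_mu: "prob_space \<mu>" and sets_mu [measurable_cong, simp]: "sets \<mu> = sets G"
    and beta_pos: "\<beta> > 0"
begin

lemma space_mu [simp]: "space \<mu> = space G"
  by (rule sets_eq_imp_space_eq) simp

definition mean_sq :: "'g \<Rightarrow> ennreal" where
  "mean_sq g = (\<integral>\<^sup>+g'. sq_loss_diff P L g g' \<partial>\<mu>)"

definition bound :: "'g measure \<Rightarrow> ereal" where
  "bound \<rho> = ext_expectation \<rho> (risk P L) + ereal (lam / 2) * enn2ereal (\<integral>\<^sup>+g. mean_sq g \<partial>\<rho>)
    + KL \<rho> \<pi> / ereal \<beta>"

abbreviation "mean_loss g \<equiv> (\<integral>z. L z g \<partial>P)"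
abbreviation "real_sq g \<equiv> enn2real (mean_sq g)"

lemma loss_fixed [measurable]: "g \<in> space G \<Longrightarrow> (\<lambda>z. L z g) \<in> borel_measurable P"
  using measurable_loss[of "\<lambda>z. z" P "\<lambda>_. g"] by simp

lemma measurable_sq_loss_diff [measurable]:
  "(\<lambda>(g, g'). sq_loss_diff P L g g') \<in> borel_measurable (G \<Otimes>\<^sub>M G)"
proof -
  interpret P: prob_space P by (rule prob_P)
  show ?thesis unfolding sq_loss_diff_def split_beta by measurable
qed

lemma measurable_mean_sq [measurable]: "mean_sq \<in> borel_measurable G"
proof -
  interpret \<mu>: prob_space \<mu> by (rule prob_mu)
  have "mean_sq = (\<lambda>g. \<integral>\<^sup>+g'. sq_loss_diff P L g g' \<partial>\<mu>)" by (simp add: mean_sq_def fun_eq_iff)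
  also have "\<dots> \<in> borel_measurable G"
    by (rule \<mu>.borel_measurable_nn_integral) (use measurable_sq_loss_diff in simp)
  finally show ?thesis .
qed

lemma measurable_mean_loss [measurable]: "mean_loss \<in> borel_measurable G"
proof -
  interpret P: prob_space P by (rule prob_P)
  show ?thesis by measurable
qed

lemma risk_eq: "risk P L g = enn2ereal (\<integral>\<^sup>+z. ennreal (L z g) \<partial>P) - enn2ereal (\<integral>\<^sup>+z. ennreal (- L z g) \<partial>P)"
  by (simp add: risk_def ext_expectation_def e2ennreal_ereal)

lemma measurable_risk [measurable]: "risk P L \<in> borel_measurable G"
proof -
  interpret P: prob_space P by (rule prob_P)
  show ?thesis
    unfolding risk_eq[abs_def] by measurable
qed

lemma risk_integrable: "integrable P (\<lambda>z. L z g) \<Longrightarrow> risk P L g = ereal (mean_loss g)"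
  unfolding risk_def by (rule ext_expectation_eq_integral) auto

section \<open>Mean square distances between losses\<close>

lemma sq_loss_diff_triangle:
  assumes [measurable]: "g1 \<in> space G" "g2 \<in> space G" "g3 \<in> space G"
  shows "sq_loss_diff P L g1 g2 \<le> 2 * sq_loss_diff P L g1 g3 + 2 * sq_loss_diff P L g2 g3"
proof -
  have "sq_loss_diff P L g1 g2
      \<le> (\<integral>\<^sup>+z. 2 * ennreal ((L z g1 - L z g3)\<^sup>2) + 2 * ennreal ((L z g2 - L z g3)\<^sup>2) \<partial>P)"
    unfolding sq_loss_diff_def
  proof (rule nn_integral_mono)
    fix z
    have "0 \<le> ((L z g1 - L z g3) + (L z g2 - L z g3))\<^sup>2" by simp
    then have "(L z g1 - L z g2)\<^sup>2 \<le> 2 * (L z g1 - L z g3)\<^sup>2 + 2 * (L z g2 - L z g3)\<^sup>2"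
      by (simp add: power2_eq_square algebra_simps)
    then have "ennreal ((L z g1 - L z g2)\<^sup>2) \<le> ennreal (2 * (L z g1 - L z g3)\<^sup>2 + 2 * (L z g2 - L z g3)\<^sup>2)"
      by (rule ennreal_leI)
    then show "ennreal ((L z g1 - L z g2)\<^sup>2) \<le> 2 * ennreal ((L z g1 - L z g3)\<^sup>2) + 2 * ennreal ((L z g2 - L z g3)\<^sup>2)"
      by (simp add: ennreal_plus ennreal_mult)
  qed
  also have "\<dots> = 2 * sq_loss_diff P L g1 g3 + 2 * sq_loss_diff P L g2 g3"
    unfolding sq_loss_diff_def by (subst nn_integral_add) (auto simp: nn_integral_cmult)
  finally show ?thesis .
qed

text \<open>The triangle inequality averaged over a middle point drawn from \<mu>. Functions with
  finite \<open>mean_sq\<close> are therefore at finite distance from one another, so that a single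
  reference function controls all of them.\<close>

lemma sq_loss_diff_le_mean_sq:
  assumes g: "g1 \<in> space G" "g2 \<in> space G"
  shows "sq_loss_diff P L g1 g2 \<le> 2 * mean_sq g1 + 2 * mean_sq g2"
proof -
  interpret \<mu>: prob_space \<mu> by (rule prob_mu)
  have [measurable]: "(\<lambda>g'. sq_loss_diff P L g g') \<in> borel_measurable \<mu>" if "g \<in> space G" for g
    using measurable_Pair2[OF measurable_sq_loss_diff that] by (simp cong: measurable_cong_sets)
  have "sq_loss_diff P L g1 g2 = (\<integral>\<^sup>+g'. sq_loss_diff P L g1 g2 \<partial>\<mu>)"
    using \<mu>.emeasure_space_1 by simp
  also have "\<dots> \<le> (\<integral>\<^sup>+g'. 2 * sq_loss_diff P L g1 g' + 2 * sq_loss_diff P L g2 g' \<partial>\<mu>)"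
    using g by (intro nn_integral_mono sq_loss_diff_triangle) auto
  also have "\<dots> = 2 * mean_sq g1 + 2 * mean_sq g2"
    using g unfolding mean_sq_def by (subst nn_integral_add) (auto simp: nn_integral_cmult)
  finally show ?thesis .
qed

lemma integrable_sq_diff:
  assumes [measurable]: "g \<in> space G" "g' \<in> space G" and fin: "sq_loss_diff P L g g' < \<infinity>"
  shows "integrable P (\<lambda>z. (L z g - L z g')\<^sup>2)"
  using fin by (intro integrableI_nonneg) (auto simp: sq_loss_diff_def)

lemma integrable_diff:
  assumes [measurable]: "g \<in> space G" "g' \<in> space G" and fin: "sq_loss_diff P L g g' < \<infinity>"
  shows "integrable P (\<lambda>z. L z g - L z g')"
proof -
  interpret P: prob_space P by (rule prob_P)
  show ?thesis
  proof (rule Bochner_Integration.integrable_bound)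
    show "integrable P (\<lambda>z. 1 * (L z g - L z g')\<^sup>2 + 1 / (4 * 1))"
      using integrable_sq_diff[OF assms] by auto
    show "AE z in P. norm (L z g - L z g') \<le> norm (1 * (L z g - L z g')\<^sup>2 + 1 / (4 * 1))"
      using abs_le_square_plus[of 1] by (auto intro!: AE_I2)
  qed measurable
qed

lemma integrable_loss_transfer:
  assumes "g \<in> space G" "g' \<in> space G" "sq_loss_diff P L g g' < \<infinity>" "integrable P (\<lambda>z. L z g)"
  shows "integrable P (\<lambda>z. L z g')"
  using Bochner_Integration.integrable_diff[OF assms(4) integrable_diff[OF assms(1-3)]] by simp

text \<open>A finite mean square distance makes the difference of the losses integrable. Adding an
  integrable function changes neither the finiteness of the positive part nor the divergence of the
  negative part.\<close>

lemma risk_transfer: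
  assumes g [measurable]: "g \<in> space G" "g' \<in> space G" and fin: "sq_loss_diff P L g g' < \<infinity>"
    and minf: "risk P L g = - \<infinity>"
  shows "risk P L g' = - \<infinity>"
proof -
  let ?d = "\<integral>\<^sup>+z. ennreal \<bar>L z g - L z g'\<bar> \<partial>P"
  have d: "?d < \<infinity>"
    using integrable_diff[OF g fin] by (simp add: integrable_iff_bounded)
  have risk_minf: "risk P L g = - \<infinity> \<longleftrightarrow>
    (\<integral>\<^sup>+z. ennreal (L z g) \<partial>P) < \<infinity> \<and> (\<integral>\<^sup>+z. ennreal (- L z g) \<partial>P) = \<infinity>" for g
    unfolding risk_def ext_expectation_eq_minus_infinity by (simp add: e2ennreal_ereal)
  have le: "(\<integral>\<^sup>+z. ennreal (f z) \<partial>P) \<le> (\<integral>\<^sup>+z. ennreal (f' z) \<partial>P) + ?d"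
    if [measurable]: "f \<in> borel_measurable P" "f' \<in> borel_measurable P"
      and le: "\<And>z. f z \<le> f' z + \<bar>L z g - L z g'\<bar>" for f f'
  proof -
    have "(\<integral>\<^sup>+z. ennreal (f z) \<partial>P) \<le> (\<integral>\<^sup>+z. ennreal (f' z) + ennreal \<bar>L z g - L z g'\<bar> \<partial>P)"
    proof (rule nn_integral_mono)
      fix z
      have "ennreal (f z) \<le> ennreal (max 0 (f' z) + \<bar>L z g - L z g'\<bar>)"
        using le[of z] by (intro ennreal_leI) auto
      also have "\<dots> = ennreal (f' z) + ennreal \<bar>L z g - L z g'\<bar>"
        by (simp add: ennreal_plus ennreal_max_0 del: ennreal_plus[symmetric])
      finally show "ennreal (f z) \<le> ennreal (f' z) + ennreal \<bar>L z g - L z g'\<bar>" .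
    qed
    then show ?thesis by (simp add: nn_integral_add)
  qed
  have "(\<integral>\<^sup>+z. ennreal (L z g') \<partial>P) \<le> (\<integral>\<^sup>+z. ennreal (L z g) \<partial>P) + ?d"
    by (rule le) auto
  also have "\<dots> < \<infinity>" using minf d unfolding risk_minf by (simp add: less_top)
  finally have a: "(\<integral>\<^sup>+z. ennreal (L z g') \<partial>P) < \<infinity>" .
  have "(\<integral>\<^sup>+z. ennreal (- L z g) \<partial>P) \<le> (\<integral>\<^sup>+z. ennreal (- L z g') \<partial>P) + ?d"
    by (rule le) auto
  then have "(\<integral>\<^sup>+z. ennreal (- L z g') \<partial>P) = \<infinity>"
    using minf d unfolding risk_minf by (auto simp: top_unique less_top)
  with a show ?thesis by (simp add: risk_minf)
qed

text \<open>In \<open>ereal\<close> sums \<infinity> absorbs \<open>- \<infinity>\<close>. So a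
  bound below \<infinity> keeps each of its three terms below \<infinity>, even if the risk term is
  \<open>- \<infinity>\<close>.\<close>

lemma bound_less_top:
  assumes "bound \<rho> < \<infinity>"
  shows "ext_expectation \<rho> (risk P L) < \<infinity>" "(\<integral>\<^sup>+g. mean_sq g \<partial>\<rho>) < \<infinity>"
    "absolutely_continuous \<pi> \<rho>" "integrable \<rho> (entropy_density (exp 1) \<pi> \<rho>)"
proof -
  let ?a = "ext_expectation \<rho> (risk P L)" and ?W = "\<integral>\<^sup>+g. mean_sq g \<partial>\<rho>"
  show "?a < \<infinity>" using assms unfolding bound_def by (cases ?a) auto
  show "?W < \<infinity>"
  proof (rule ccontr)
    assume "\<not> ?W < \<infinity>"
    then have "?W = top" unfolding infinity_ennreal_def not_less top_unique .
    then have "ereal (lam / 2) * enn2ereal ?W = \<infinity>" using lam_pos by simp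
    then have "bound \<rho> = \<infinity>" unfolding bound_def by (simp only: ereal_plus_eq_PInfty simp_thms)
    with assms show False by simp
  qed
  have "absolutely_continuous \<pi> \<rho> \<and> integrable \<rho> (entropy_density (exp 1) \<pi> \<rho>)"
  proof (rule ccontr)
    assume "\<not> ?thesis"
    then have "KL \<rho> \<pi> = \<infinity>" by (auto simp: KL_def)
    then have "KL \<rho> \<pi> / ereal \<beta> = \<infinity>" using beta_pos by simp
    then have "bound \<rho> = \<infinity>" unfolding bound_def by (simp only: ereal_plus_eq_PInfty simp_thms)
    with assms show False by simp
  qed
  then show "absolutely_continuous \<pi> \<rho>" "integrable \<rho> (entropy_density (exp 1) \<pi> \<rho>)" by auto
qed

lemma AE_mean_sq_finite:
  assumes [simp]: "sets \<rho> = sets G" and "(\<integral>\<^sup>+g. mean_sq g \<partial>\<rho>) < \<infinity>"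
  shows "AE g in \<rho>. mean_sq g < \<infinity>"
proof -
  have "mean_sq \<in> borel_measurable \<rho>" using measurable_mean_sq by (simp cong: measurable_cong_sets)
  then have "AE g in \<rho>. mean_sq g \<noteq> \<infinity>"
    using assms(2) by (intro nn_integral_PInf_AE) auto
  then show ?thesis by eventually_elim (simp add: less_top)
qed

lemma obtain_reference:
  assumes \<rho>: "\<rho> \<in> space (prob_algebra G)" and fin: "bound \<rho> < \<infinity>"
  obtains g where "g \<in> space G" "mean_sq g < \<infinity>" "integrable P (\<lambda>z. L z g) \<or> risk P L g = - \<infinity>"
proof -
  have sets [simp]: "sets \<rho> = sets G" using \<rho> by (simp add: space_prob_algebra)
  interpret \<rho>: prob_space \<rho> using \<rho> by (simp add: space_prob_algebra)
  have "risk P L \<in> borel_measurable \<rho>" using measurable_risk by (simp cong: measurable_cong_sets)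
  then have "AE g in \<rho>. risk P L g < \<infinity>"
    using bound_less_top(1)[OF fin] by (rule AE_less_top_of_ext_expectation)
  moreover have "AE g in \<rho>. mean_sq g < \<infinity>"
    by (rule AE_mean_sq_finite[OF sets bound_less_top(2)[OF fin]])
  ultimately have "AE g in \<rho>. g \<in> space G \<and> mean_sq g < \<infinity> \<and> risk P L g < \<infinity>"
    using AE_space by eventually_elim (simp add: sets_eq_imp_space_eq[OF sets])
  then obtain g where g: "g \<in> space G" "mean_sq g < \<infinity>" "risk P L g < \<infinity>"
    using eventually_happens'[OF \<rho>.ae_filter_bot] by blast
  have [measurable]: "(\<lambda>z. L z g) \<in> borel_measurable P" using g(1) by measurable
  have a: "(\<integral>\<^sup>+z. ennreal (L z g) \<partial>P) < \<infinity>"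
    using ext_expectation_less_top[OF g(3)[unfolded risk_def]] by (simp add: e2ennreal_ereal)
  \<comment> \<open>So far only the positive part of the loss is known to have a finite integral;
    the negative part decides between the two alternatives.\<close>
  have "integrable P (\<lambda>z. L z g) \<or> risk P L g = - \<infinity>"
  proof (cases "(\<integral>\<^sup>+z. ennreal (- L z g) \<partial>P) < \<infinity>")
    case True
    with a show ?thesis by (auto simp: real_integrable_def)
  next
    case False
    with a show ?thesis
      unfolding risk_def ext_expectation_eq_minus_infinity by (auto simp: e2ennreal_ereal less_top)
  qed
  with g that show ?thesis by blast
qed

lemma AE_sq_loss_diff_finite:
  assumes "g \<in> space G" "mean_sq g < \<infinity>"
  shows "AE g' in \<mu>. sq_loss_diff P L g g' < \<infinity>"
proof -
  have "(\<lambda>g'. sq_loss_diff P L g g') \<in> borel_measurable \<mu>"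
    using measurable_Pair2[OF measurable_sq_loss_diff assms(1)] by (simp cong: measurable_cong_sets)
  then have "AE g' in \<mu>. sq_loss_diff P L g g' \<noteq> \<infinity>"
    using assms by (intro nn_integral_PInf_AE) (auto simp: mean_sq_def)
  then show ?thesis by eventually_elim (simp add: less_top)
qed

lemma sq_loss_diff_finite:
  assumes "g \<in> space G" "mean_sq g < \<infinity>" "g' \<in> space G" "mean_sq g' < \<infinity>"
  shows "sq_loss_diff P L g g' < \<infinity>"
  by (rule le_less_trans[OF sq_loss_diff_le_mean_sq[OF assms(1,3)]])
     (use assms(2,4) in \<open>auto simp: ennreal_mult_less_top\<close>)

text \<open>The value \<open>- \<infinity>\<close> spreads through \<open>risk_transfer\<close>. The
  other two terms of a bound below \<infinity> are real numbers, hence cannot compensate it.\<close>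

lemma degenerate:
  assumes g: "g \<in> space G" "mean_sq g < \<infinity>" "risk P L g = - \<infinity>"
  shows "AE g' in \<mu>. risk P L g' = - \<infinity>"
    and "\<rho> \<in> space (prob_algebra G) \<Longrightarrow> bound \<rho> < \<infinity> \<Longrightarrow> bound \<rho> = - \<infinity>"
proof -
  show "AE g' in \<mu>. risk P L g' = - \<infinity>"
    using AE_sq_loss_diff_finite[OF g(1,2)] AE_space
    by eventually_elim (auto intro: risk_transfer[OF g(1) _ _ g(3)])
  assume \<rho>: "\<rho> \<in> space (prob_algebra G)" and fin: "bound \<rho> < \<infinity>"
  have sets [simp]: "sets \<rho> = sets G" and prob: "prob_space \<rho>" using \<rho> by (auto simp: space_prob_algebra)
  have "AE g' in \<rho>. risk P L g' = - \<infinity>"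
    using AE_mean_sq_finite[OF sets bound_less_top(2)[OF fin]] AE_space
  proof eventually_elim
    case (elim g')
    then have "g' \<in> space G" by (simp add: sets_eq_imp_space_eq[OF sets])
    then show ?case
      using sq_loss_diff_finite[OF g(1,2)] elim by (intro risk_transfer[OF g(1) _ _ g(3)]) auto
  qed
  then have "ext_expectation \<rho> (risk P L) = - \<infinity>"
    by (rule ext_expectation_minus_infinity[OF prob])
  moreover have "enn2ereal (\<integral>\<^sup>+g. mean_sq g \<partial>\<rho>) = ereal (enn2real (\<integral>\<^sup>+g. mean_sq g \<partial>\<rho>))"
    using bound_less_top(2)[OF fin] by (simp add: enn2ereal_eq_enn2real)
  moreover have "KL \<rho> \<pi> = ereal (KL_divergence (exp 1) \<pi> \<rho>)"
    using bound_less_top(3,4)[OF fin] by (simp add: KL_def)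
  ultimately show "bound \<rho> = - \<infinity>" using beta_pos by (simp add: bound_def)
qed

section \<open>Domination of the risk by the penalty\<close>

definition "slack g0 = lam / 4 * real_sq g0 + 2 / lam"

context
  fixes g0 :: 'g
  assumes g0: "g0 \<in> space G" "mean_sq g0 < \<infinity>" "integrable P (\<lambda>z. L z g0)"
begin

lemma integrable_loss:
  assumes "g \<in> space G" "mean_sq g < \<infinity>"
  shows "integrable P (\<lambda>z. L z g)"
  using sq_loss_diff_finite[OF g0(1,2) assms] assms g0
  by (intro integrable_loss_transfer[OF g0(1) _ _ g0(3)]) auto

text \<open>\<open>slack g0\<close> collects what does not depend on \<open>g\<close>: the constant
  \<open>2 / lam\<close> of \<open>abs_le_square_plus\<close> at \<open>e = lam / 8\<close>, and the
  contribution of \<open>mean_sq g0\<close> from \<open>sq_loss_diff_le_mean_sq\<close>.\<close>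

lemma mean_abs_diff_le:
  assumes g: "g \<in> space G" "mean_sq g < \<infinity>"
  shows "(\<integral>z. \<bar>L z g - L z g0\<bar> \<partial>P) \<le> lam / 4 * real_sq g + slack g0"
proof -
  interpret P: prob_space P by (rule prob_P)
  have fin: "sq_loss_diff P L g g0 < \<infinity>" by (rule sq_loss_diff_finite) (use g g0 in auto)
  note int_sq = integrable_sq_diff[OF g(1) g0(1) fin] and int_d = integrable_diff[OF g(1) g0(1) fin]
  have "ennreal (\<integral>z. (L z g - L z g0)\<^sup>2 \<partial>P) = sq_loss_diff P L g g0"
    using int_sq unfolding sq_loss_diff_def by (intro nn_integral_eq_integral[symmetric]) auto
  also have "\<dots> \<le> 2 * mean_sq g + 2 * mean_sq g0"
    by (rule sq_loss_diff_le_mean_sq) (use g g0 in auto)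
  also have "\<dots> = 2 * ennreal (real_sq g) + 2 * ennreal (real_sq g0)"
    using g g0 by simp
  also have "\<dots> = ennreal (2 * real_sq g + 2 * real_sq g0)"
    by (simp add: ennreal_plus ennreal_mult)
  finally have sq: "(\<integral>z. (L z g - L z g0)\<^sup>2 \<partial>P) \<le> 2 * real_sq g + 2 * real_sq g0"
    by (subst (asm) ennreal_le_iff) auto
  \<comment> \<open>The factor 2 in \<open>sq\<close> turns \<open>lam / 8\<close> into
    \<open>lam / 4\<close>, half of the coefficient \<open>lam / 2\<close> that the objective
    offers.\<close>
  have "(\<integral>z. \<bar>L z g - L z g0\<bar> \<partial>P) \<le> (\<integral>z. lam / 8 * (L z g - L z g0)\<^sup>2 + 1 / (4 * (lam / 8)) \<partial>P)"
    using int_sq int_d lam_pos by (intro integral_mono abs_le_square_plus) auto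
  also have "\<dots> = lam / 8 * (\<integral>z. (L z g - L z g0)\<^sup>2 \<partial>P) + 2 / lam"
    using int_sq by (simp add: P.prob_space)
  also have "\<dots> \<le> lam / 8 * (2 * real_sq g + 2 * real_sq g0) + 2 / lam"
    using sq lam_pos by (intro add_right_mono mult_left_mono) auto
  finally show ?thesis by (simp add: slack_def algebra_simps)
qed

lemma mean_loss_close:
  assumes g: "g \<in> space G" "mean_sq g < \<infinity>"
  shows "\<bar>mean_loss g - mean_loss g0\<bar> \<le> lam / 4 * real_sq g + slack g0"
proof -
  have "mean_loss g - mean_loss g0 = (\<integral>z. L z g - L z g0 \<partial>P)"
    using integrable_loss[OF g] g0(3) by simp
  then have "\<bar>mean_loss g - mean_loss g0\<bar> \<le> (\<integral>z. \<bar>L z g - L z g0\<bar> \<partial>P)"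
    by (metis integral_abs_bound)
  then show ?thesis using mean_abs_diff_le[OF g] by linarith
qed

definition "obj g = mean_loss g + lam / 2 * real_sq g"

lemma measurable_obj [measurable]: "obj \<in> borel_measurable G"
  unfolding obj_def[abs_def] by measurable

text \<open>Half of the penalty pays for the deviation of the risk. The half that survives bounds
  \<open>weight\<close> and later makes \<open>mean_sq\<close> integrable under the
  minimizer.\<close>

lemma obj_lower:
  assumes "g \<in> space G" "mean_sq g < \<infinity>"
  shows "mean_loss g0 - slack g0 + lam / 4 * real_sq g \<le> obj g"
  using mean_loss_close[OF assms] by (simp add: obj_def abs_le_iff)

context
  fixes \<rho>
  assumes rho: "\<rho> \<in> space (prob_algebra G)" and sq_fin: "(\<integral>\<^sup>+g. mean_sq g \<partial>\<rho>) < \<infinity>"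
begin

lemma sets_rho: "sets \<rho> = sets G" and prob_rho: "prob_space \<rho>"
  using rho by (auto simp: space_prob_algebra)

lemma space_rho: "space \<rho> = space G"
  by (rule sets_eq_imp_space_eq[OF sets_rho])

lemma AE_rho: "AE g in \<rho>. g \<in> space G \<and> mean_sq g < \<infinity>"
  using AE_mean_sq_finite[OF sets_rho sq_fin] AE_space
  by eventually_elim (simp add: space_rho)

lemma measurable_mean_sq_rho: "mean_sq \<in> borel_measurable \<rho>"
  unfolding measurable_cong_sets[OF sets_rho refl] by (rule measurable_mean_sq)

lemma integrable_real_sq: "integrable \<rho> real_sq"
  by (rule integrable_enn2real[OF measurable_mean_sq_rho sq_fin])

lemma mean_sq_integral: "enn2ereal (\<integral>\<^sup>+g. mean_sq g \<partial>\<rho>) = ereal (\<integral>g. real_sq g \<partial>\<rho>)"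
  using integrable_enn2real(2)[OF measurable_mean_sq_rho sq_fin] sq_fin by (simp add: enn2ereal_eq_enn2real)

lemma integrable_mean_loss: "integrable \<rho> mean_loss"
proof -
  interpret \<rho>: prob_space \<rho> by (rule prob_rho)
  note [measurable_cong] = sets_rho
  show ?thesis
  proof (rule Bochner_Integration.integrable_bound)
    show "integrable \<rho> (\<lambda>g. \<bar>mean_loss g0\<bar> + (lam / 4 * real_sq g + slack g0))"
      using integrable_real_sq by auto
    show "AE g in \<rho>. norm (mean_loss g) \<le> norm (\<bar>mean_loss g0\<bar> + (lam / 4 * real_sq g + slack g0))"
      using AE_rho
    proof eventually_elim
      case (elim g)
      then show ?case using mean_loss_close[of g] by auto
    qed
  qed measurable
qed

lemma integrable_obj: "integrable \<rho> obj"
  unfolding obj_def[abs_def] using integrable_mean_loss integrable_real_sq by auto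

lemma bound_eq:
  assumes ac: "absolutely_continuous \<pi> \<rho>" "integrable \<rho> (entropy_density (exp 1) \<pi> \<rho>)"
  shows "bound \<rho> = ereal ((\<integral>g. obj g \<partial>\<rho>) + KL_divergence (exp 1) \<pi> \<rho> / \<beta>)"
proof -
  have "AE g in \<rho>. risk P L g = ereal (mean_loss g)"
    using AE_rho
  proof eventually_elim
    case (elim g)
    show ?case by (rule risk_integrable[OF integrable_loss]) (use elim in auto)
  qed
  then have "ext_expectation \<rho> (risk P L) = ereal (\<integral>g. mean_loss g \<partial>\<rho>)"
    by (rule ext_expectation_eq_integral[OF integrable_mean_loss])
  moreover have "(\<integral>g. obj g \<partial>\<rho>) = (\<integral>g. mean_loss g \<partial>\<rho>) + lam / 2 * (\<integral>g. real_sq g \<partial>\<rho>)"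
    unfolding obj_def using integrable_mean_loss integrable_real_sq by simp
  ultimately show ?thesis
    using ac beta_pos by (simp add: bound_def KL_def mean_sq_integral)
qed

text \<open>The loss at \<open>g\<close> is at most the loss at \<open>g0\<close> plus the deviation
  in absolute value, and the \<open>P\<close>-mean of the deviation is affine in
  \<open>real_sq g\<close>, which is \<rho>-integrable.\<close>

lemma integrable_loss_pair: "integrable (P \<Otimes>\<^sub>M \<rho>) (\<lambda>(z, g). L z g)"
proof -
  interpret P: prob_space P by (rule prob_P)
  interpret \<rho>: prob_space \<rho> by (rule prob_rho)
  note [measurable_cong] = sets_rho
  interpret pair_sigma_finite P \<rho> ..
  interpret swap: pair_sigma_finite \<rho> P ..
  have "integrable (\<rho> \<Otimes>\<^sub>M P) (\<lambda>(g, z). L z g)"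
  proof (rule swap.Fubini_integrable)
    show "(\<lambda>(g, z). L z g) \<in> borel_measurable (\<rho> \<Otimes>\<^sub>M P)" by measurable
    show "AE g in \<rho>. integrable P (\<lambda>z. case (g, z) of (g, z) \<Rightarrow> L z g)"
      using AE_rho by eventually_elim (auto intro: integrable_loss)
    show "integrable \<rho> (\<lambda>g. \<integral>z. norm (case (g, z) of (g, z) \<Rightarrow> L z g) \<partial>P)"
    proof (rule Bochner_Integration.integrable_bound)
      show "integrable \<rho> (\<lambda>g. (\<integral>z. \<bar>L z g0\<bar> \<partial>P) + (lam / 4 * real_sq g + slack g0))"
        using integrable_real_sq by auto
      show "AE g in \<rho>. norm (\<integral>z. norm (case (g, z) of (g, z) \<Rightarrow> L z g) \<partial>P)
          \<le> norm ((\<integral>z. \<bar>L z g0\<bar> \<partial>P) + (lam / 4 * real_sq g + slack g0))"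
        using AE_rho
      proof eventually_elim
        case (elim g)
        then have int: "integrable P (\<lambda>z. L z g)" by (intro integrable_loss) auto
        have "(\<integral>z. \<bar>L z g\<bar> \<partial>P) \<le> (\<integral>z. \<bar>L z g0\<bar> + \<bar>L z g - L z g0\<bar> \<partial>P)"
          using int g0(3) by (intro integral_mono) auto
        also have "\<dots> = (\<integral>z. \<bar>L z g0\<bar> \<partial>P) + (\<integral>z. \<bar>L z g - L z g0\<bar> \<partial>P)"
          using int g0(3) by simp
        also have "\<dots> \<le> (\<integral>z. \<bar>L z g0\<bar> \<partial>P) + (lam / 4 * real_sq g + slack g0)"
          using mean_abs_diff_le[of g] elim by simp
        finally show ?case by (simp add: integral_nonneg)
      qed
    qed measurable
  qed
  from swap.integrable_product_swap[OF this] show ?thesis by simp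
qed

end

text \<open>\<open>mean_sq g0\<close> is the integral over \<open>P \<Otimes>\<^sub>M \<mu>\<close>
  of the squared difference to the loss of \<open>g0\<close>. Its finiteness thus makes the loss the
  sum of an integrable function of \<open>z\<close> and a square integrable remainder.\<close>

lemma integrable_loss_mu: "integrable (P \<Otimes>\<^sub>M \<mu>) (\<lambda>(z, g). L z g)"
proof -
  interpret P: prob_space P by (rule prob_P)
  interpret \<mu>: prob_space \<mu> by (rule prob_mu)
  interpret P\<mu>: pair_prob_space P \<mu> ..
  have [measurable, simp]: "snd \<in> P \<Otimes>\<^sub>M \<mu> \<rightarrow>\<^sub>M G"
    unfolding measurable_cong_sets[OF refl sets_mu[symmetric]] by (rule measurable_snd)
  have fst_loss: "(\<lambda>x. L (fst x) g0) \<in> borel_measurable (P \<Otimes>\<^sub>M \<mu>)"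
    using g0(1) by (intro measurable_loss) auto
  have [measurable]: "(\<lambda>x. (L (fst x) g0 - L (fst x) (snd x))\<^sup>2) \<in> borel_measurable (P \<Otimes>\<^sub>M \<mu>)"
    by (intro borel_measurable_power borel_measurable_diff fst_loss measurable_loss) auto
  have sq: "(\<integral>\<^sup>+x. ennreal ((L (fst x) g0 - L (fst x) (snd x))\<^sup>2) \<partial>(P \<Otimes>\<^sub>M \<mu>)) = mean_sq g0"
    unfolding mean_sq_def sq_loss_diff_def by (subst P\<mu>.nn_integral_snd[symmetric]) (auto simp: split_beta)
  have "integrable (P \<Otimes>\<^sub>M \<mu>) (\<lambda>x. (L (fst x) g0 - L (fst x) (snd x))\<^sup>2)"
    using g0(2) by (intro integrableI_nonneg) (simp_all add: sq)
  moreover have "integrable (P \<Otimes>\<^sub>M \<mu>) (\<lambda>x. L (fst x) g0)"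
    using g0(3) by (intro integrable_distr[OF measurable_fst]) (simp add: \<mu>.distr_pair_fst)
  ultimately have "integrable (P \<Otimes>\<^sub>M \<mu>) (\<lambda>x. \<bar>L (fst x) g0\<bar> + (1 * (L (fst x) g0 - L (fst x) (snd x))\<^sup>2 + 1 / (4 * 1)))"
    by auto
  then show ?thesis
  proof (rule Bochner_Integration.integrable_bound)
    show "AE x in P \<Otimes>\<^sub>M \<mu>. norm (case x of (z, g) \<Rightarrow> L z g)
      \<le> norm (\<bar>L (fst x) g0\<bar> + (1 * (L (fst x) g0 - L (fst x) (snd x))\<^sup>2 + 1 / (4 * 1)))"
    proof (rule AE_I2)
      fix x :: "'z \<times> 'g"
      show "norm (case x of (z, g) \<Rightarrow> L z g)
        \<le> norm (\<bar>L (fst x) g0\<bar> + (1 * (L (fst x) g0 - L (fst x) (snd x))\<^sup>2 + 1 / (4 * 1)))"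
        using abs_le_square_plus[of 1 "L (fst x) g0 - L (fst x) (snd x)"] by (auto simp: split_beta)
    qed
  qed measurable
qed

lemma integral_loss_mu:
  "integrable \<mu> mean_loss" "(\<integral>x. (case x of (z, g) \<Rightarrow> L z g) \<partial>(P \<Otimes>\<^sub>M \<mu>)) = (\<integral>g. mean_loss g \<partial>\<mu>)"
  "AE g in \<mu>. risk P L g = ereal (mean_loss g)"
proof -
  interpret P: prob_space P by (rule prob_P)
  interpret \<mu>: prob_space \<mu> by (rule prob_mu)
  interpret pair_sigma_finite P \<mu> ..
  show "integrable \<mu> mean_loss" by (rule integrable_snd[OF integrable_loss_mu])
  show "(\<integral>x. (case x of (z, g) \<Rightarrow> L z g) \<partial>(P \<Otimes>\<^sub>M \<mu>)) = (\<integral>g. mean_loss g \<partial>\<mu>)"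
    by (rule integral_snd[OF integrable_loss_mu, symmetric])
  show "AE g in \<mu>. risk P L g = ereal (mean_loss g)"
    using AE_integrable_snd[OF integrable_loss_mu] by eventually_elim (rule risk_integrable)
qed

lemma
  assumes rho: "\<rho> \<in> space (prob_algebra G)" and sq_fin: "(\<integral>\<^sup>+g. mean_sq g \<partial>\<rho>) < \<infinity>"
  shows integrable_penalized:
      "integrable ((P \<Otimes>\<^sub>M \<mu>) \<Otimes>\<^sub>M \<rho>) (\<lambda>((z, g'), g). L z g + penalty z g g')" (is "integrable ?N _")
    and integral_penalized:
      "(\<integral>x. (case x of ((z, g'), g) \<Rightarrow> L z g + penalty z g g') \<partial>((P \<Otimes>\<^sub>M \<mu>) \<Otimes>\<^sub>M \<rho>)) = (\<integral>g. obj g \<partial>\<rho>)"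
proof -
  note sets [measurable_cong] = sets_rho[OF rho sq_fin]
  interpret P: prob_space P by (rule prob_P)
  interpret \<mu>: prob_space \<mu> by (rule prob_mu)
  interpret \<rho>: prob_space \<rho> by (rule prob_rho[OF rho sq_fin])
  interpret P\<mu>: pair_prob_space P \<mu> ..
  interpret P\<rho>: pair_prob_space P \<rho> ..
  interpret N: pair_sigma_finite "P \<Otimes>\<^sub>M \<mu>" \<rho> ..
  have z: "(\<lambda>x. fst (fst x)) \<in> ?N \<rightarrow>\<^sub>M P" by simp
  have g': "(\<lambda>x. snd (fst x)) \<in> ?N \<rightarrow>\<^sub>M G"
    unfolding measurable_cong_sets[OF refl sets_mu[symmetric]] by simp
  have g: "snd \<in> ?N \<rightarrow>\<^sub>M G"
    unfolding measurable_cong_sets[OF refl sets[symmetric]] by simp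
  have meas: "(\<lambda>x. ennreal ((L (fst (fst x)) (snd x) - L (fst (fst x)) (snd (fst x)))\<^sup>2)) \<in> borel_measurable ?N"
    by (intro measurable_compose[OF _ measurable_ennreal] borel_measurable_power borel_measurable_diff
        measurable_loss z g g')
  \<comment> \<open>The loss at \<open>g\<close> does not involve g', so it is integrated through
    the projection that forgets g'; only the squared difference needs all three coordinates.\<close>
  have distr: "distr ?N (P \<Otimes>\<^sub>M \<rho>) (\<lambda>(x, g). (fst x, g)) = P \<Otimes>\<^sub>M \<rho>"
    using pair_measure_distr[of fst "P \<Otimes>\<^sub>M \<mu>" P "\<lambda>g. g" \<rho> \<rho>]
    by (simp add: \<mu>.distr_pair_fst distr_id2 \<rho>.sigma_finite_measure_axioms)
  have fst: "(\<lambda>(x, g). (fst x, g)) \<in> ?N \<rightarrow>\<^sub>M P \<Otimes>\<^sub>M \<rho>" by measurable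
  note int_L = integrable_loss_pair[OF rho sq_fin]
  have int1: "integrable ?N (\<lambda>x. L (fst (fst x)) (snd x))"
    using int_L integrable_distr[OF fst, of "\<lambda>(z, g). L z g"] unfolding distr by (simp add: split_beta)
  have "(\<integral>x. L (fst (fst x)) (snd x) \<partial>?N) = (\<integral>x. (case x of (z, g) \<Rightarrow> L z g) \<partial>(P \<Otimes>\<^sub>M \<rho>))"
    using integral_distr[OF fst, of "\<lambda>(z, g). L z g"] borel_measurable_integrable[OF int_L]
    unfolding distr by (simp add: case_prod_beta')
  also have "\<dots> = (\<integral>g. mean_loss g \<partial>\<rho>)" by (rule P\<rho>.integral_snd[OF int_L, symmetric])
  finally have val1: "(\<integral>x. L (fst (fst x)) (snd x) \<partial>?N) = (\<integral>g. mean_loss g \<partial>\<rho>)" .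
  have "(\<integral>\<^sup>+x. ennreal ((L (fst (fst x)) (snd x) - L (fst (fst x)) (snd (fst x)))\<^sup>2) \<partial>?N)
    = (\<integral>\<^sup>+g. \<integral>\<^sup>+x. ennreal ((L (fst x) g - L (fst x) (snd x))\<^sup>2) \<partial>(P \<Otimes>\<^sub>M \<mu>) \<partial>\<rho>)"
    using N.nn_integral_snd[OF meas] by simp
  also have "\<dots> = (\<integral>\<^sup>+g. mean_sq g \<partial>\<rho>)"
  proof (rule nn_integral_cong)
    fix g assume "g \<in> space \<rho>"
    then have [simp]: "g \<in> space G" by (simp add: sets_eq_imp_space_eq[OF sets])
    have "(\<lambda>x. ennreal ((L (fst x) g - L (fst x) (snd x))\<^sup>2)) \<in> borel_measurable (P \<Otimes>\<^sub>M \<mu>)"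
      using measurable_Pair1[OF meas \<open>g \<in> space \<rho>\<close>] by simp
    then show "(\<integral>\<^sup>+x. ennreal ((L (fst x) g - L (fst x) (snd x))\<^sup>2) \<partial>(P \<Otimes>\<^sub>M \<mu>)) = mean_sq g"
      unfolding mean_sq_def sq_loss_diff_def by (subst P\<mu>.nn_integral_snd[symmetric]) auto
  qed
  finally have nn: "(\<integral>\<^sup>+x. ennreal ((L (fst (fst x)) (snd x) - L (fst (fst x)) (snd (fst x)))\<^sup>2) \<partial>?N)
    = (\<integral>\<^sup>+g. mean_sq g \<partial>\<rho>)" .
  have meas2: "(\<lambda>x. (L (fst (fst x)) (snd x) - L (fst (fst x)) (snd (fst x)))\<^sup>2) \<in> borel_measurable ?N"
    by (intro borel_measurable_power borel_measurable_diff measurable_loss z g g')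
  have int2: "integrable ?N (\<lambda>x. (L (fst (fst x)) (snd x) - L (fst (fst x)) (snd (fst x)))\<^sup>2)"
    using sq_fin by (intro integrableI_nonneg meas2) (simp_all add: nn)
  have "(\<integral>x. (L (fst (fst x)) (snd x) - L (fst (fst x)) (snd (fst x)))\<^sup>2 \<partial>?N) = enn2real (\<integral>\<^sup>+g. mean_sq g \<partial>\<rho>)"
    using meas2 by (subst integral_eq_nn_integral) (simp_all add: nn)
  also have "\<dots> = (\<integral>g. real_sq g \<partial>\<rho>)"
    by (rule integrable_enn2real(2)[OF measurable_mean_sq_rho[OF rho sq_fin] sq_fin, symmetric])
  finally have val2: "(\<integral>x. (L (fst (fst x)) (snd x) - L (fst (fst x)) (snd (fst x)))\<^sup>2 \<partial>?N) = (\<integral>g. real_sq g \<partial>\<rho>)" .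
  have F: "(\<lambda>((z, g'), g). L z g + penalty z g g') = (\<lambda>x. L (fst (fst x)) (snd x)
      + lam / 2 * (L (fst (fst x)) (snd x) - L (fst (fst x)) (snd (fst x)))\<^sup>2)"
    by (auto simp: fun_eq_iff)
  show "integrable ?N (\<lambda>((z, g'), g). L z g + penalty z g g')"
    unfolding F using int1 int2 by auto
  have "(\<integral>g. obj g \<partial>\<rho>) = (\<integral>g. mean_loss g \<partial>\<rho>) + lam / 2 * (\<integral>g. real_sq g \<partial>\<rho>)"
    unfolding obj_def using integrable_mean_loss[OF rho sq_fin] integrable_real_sq[OF rho sq_fin] by simp
  moreover have "(\<integral>x. (case x of ((z, g'), g) \<Rightarrow> L z g + penalty z g g') \<partial>?N)
    = (\<integral>x. L (fst (fst x)) (snd x)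
      + lam / 2 * (L (fst (fst x)) (snd x) - L (fst (fst x)) (snd (fst x)))\<^sup>2 \<partial>?N)"
    by (rule Bochner_Integration.integral_cong[OF refl]) (auto simp: split_beta)
  ultimately show "(\<integral>x. (case x of ((z, g'), g) \<Rightarrow> L z g + penalty z g g') \<partial>?N) = (\<integral>g. obj g \<partial>\<rho>)"
    using int1 int2 by (simp add: val1 val2)
qed

text \<open>The indicator repairs a default value: where \<open>mean_sq g\<close> is infinite,
  \<open>real_sq g\<close> is 0 and \<open>obj g\<close> is far too small, whereas the true
  objective calls for weight 0.\<close>

definition "weight g = indicator {g \<in> space G. mean_sq g < \<infinity>} g * exp (- (\<beta> * obj g))"

lemma measurable_weight [measurable]: "weight \<in> borel_measurable G"
  unfolding weight_def[abs_def] by measurable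

lemma weight_nonneg: "0 \<le> weight g"
  by (simp add: weight_def)

lemma weight_le: "weight g \<le> exp (- (\<beta> * (mean_loss g0 - slack g0 + lam / 4 * real_sq g)))"
  using obj_lower[of g] beta_pos by (auto simp: weight_def indicator_def)

lemma integrable_weight: "integrable \<pi> weight"
proof -
  interpret prob_space \<pi> by (rule prob_prior)
  have "weight g \<le> exp (- (\<beta> * (mean_loss g0 - slack g0)))" for g
  proof -
    have "weight g \<le> exp (- (\<beta> * (mean_loss g0 - slack g0 + lam / 4 * real_sq g)))" by (rule weight_le)
    also have "\<dots> \<le> exp (- (\<beta> * (mean_loss g0 - slack g0)))" using beta_pos lam_pos by simp
    finally show ?thesis .
  qed
  then show ?thesis
    by (intro integrable_const_bound[of _ "exp (- (\<beta> * (mean_loss g0 - slack g0)))"])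
       (auto simp: weight_nonneg)
qed

text \<open>Donsker--Varadhan for \<open>weight\<close>, which is positive almost everywhere under
  any \<rho> with bound below \<infinity>. The existence of one such \<rho> also makes the
  normalizer positive, so that the Gibbs minimizer can be formed.\<close>

lemma free_energy_le_bound:
  assumes \<rho>: "\<rho> \<in> space (prob_algebra G)" and fin: "bound \<rho> < \<infinity>"
  shows "0 < (\<integral>g. weight g \<partial>\<pi>)"
    and "ereal (- ln (\<integral>g. weight g \<partial>\<pi>) / \<beta>) \<le> bound \<rho>"
proof -
  note b = bound_less_top[OF fin]
  note AE = AE_rho[OF \<rho> b(2)]
  have ln_eq: "AE g in \<rho>. ln (weight g) = - (\<beta> * obj g)"
    using AE by eventually_elim (simp add: weight_def)
  have int: "integrable \<rho> (\<lambda>g. - (\<beta> * obj g))" using integrable_obj[OF \<rho> b(2)] by auto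
  have [measurable_cong]: "sets \<rho> = sets G" and prob: "prob_space \<rho>" using \<rho> by (auto simp: space_prob_algebra)
  have ln_int: "integrable \<rho> (\<lambda>g. ln (weight g))"
    using int by (rule integrable_cong_AE_imp) (use ln_eq in \<open>auto simp: eq_commute\<close>)
  have pos: "AE g in \<rho>. 0 < weight g" using AE by eventually_elim (simp add: weight_def)
  have "sets \<rho> = sets \<pi>" using \<rho> by (simp add: space_prob_algebra)
  note dv = donsker_varadhan[OF prob_prior prob this b(3,4) integrable_weight weight_nonneg pos ln_int]
  show "0 < (\<integral>g. weight g \<partial>\<pi>)" by (rule dv(1))
  have "(\<integral>g. ln (weight g) \<partial>\<rho>) = (\<integral>g. - (\<beta> * obj g) \<partial>\<rho>)"
    using ln_eq by (intro integral_cong_AE) auto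
  then have "- (\<beta> * (\<integral>g. obj g \<partial>\<rho>)) \<le> ln (\<integral>g. weight g \<partial>\<pi>) + KL_divergence (exp 1) \<pi> \<rho>"
    using dv(2) by simp
  then have "- ln (\<integral>g. weight g \<partial>\<pi>) / \<beta> \<le> (\<integral>g. obj g \<partial>\<rho>) + KL_divergence (exp 1) \<pi> \<rho> / \<beta>"
    using beta_pos by (simp add: field_simps)
  then show "ereal (- ln (\<integral>g. weight g \<partial>\<pi>) / \<beta>) \<le> bound \<rho>"
    by (simp add: bound_eq[OF \<rho> b(2-4)])
qed

text \<open>For the normalized \<open>weight\<close> the log-density is
  \<open>- (\<beta> * obj g) - ln C\<close>, so the divergence cancels the objective in the bound.
  Before this can be used, \<open>mean_sq\<close> must be shown integrable under the new
  distribution.\<close>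

lemma free_energy_attained:
  assumes C_pos: "0 < (\<integral>g. weight g \<partial>\<pi>)"
  obtains \<rho> where "\<rho> \<in> space (prob_algebra G)" "bound \<rho> = ereal (- ln (\<integral>g. weight g \<partial>\<pi>) / \<beta>)"
proof -
  interpret \<pi>: prob_space \<pi> by (rule prob_prior)
  define C where "C = (\<integral>g. weight g \<partial>\<pi>)"
  have C: "C > 0" using C_pos by (simp add: C_def)
  define f where "f g = weight g / C" for g
  have [measurable]: "f \<in> borel_measurable G" unfolding f_def[abs_def] by measurable
  have f_nonneg: "0 \<le> f g" for g using weight_nonneg C by (simp add: f_def)
  define \<rho> where "\<rho> = density \<pi> (\<lambda>g. ennreal (f g))"
  have [simp, measurable_cong]: "sets \<rho> = sets G" by (simp add: \<rho>_def)
  have "(\<integral>\<^sup>+g. ennreal (f g) \<partial>\<pi>) = ennreal (\<integral>g. f g \<partial>\<pi>)"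
    using integrable_weight f_nonneg unfolding f_def by (intro nn_integral_eq_integral) auto
  also have "\<dots> = 1" using C by (simp add: f_def C_def)
  finally have total: "(\<integral>\<^sup>+g. ennreal (f g) \<partial>\<pi>) = 1" .
  have prob: "prob_space \<rho>"
  proof
    have "emeasure \<rho> (space \<pi>) = (\<integral>\<^sup>+g. ennreal (f g) * indicator (space \<pi>) g \<partial>\<pi>)"
      unfolding \<rho>_def by (rule emeasure_density[OF _ sets.top]) measurable
    also have "\<dots> = 1" unfolding total[symmetric] by (rule nn_integral_cong) simp
    finally show "emeasure \<rho> (space \<rho>) = 1" by (simp add: \<rho>_def)
  qed
  have \<rho>: "\<rho> \<in> space (prob_algebra G)" using prob by (simp add: space_prob_algebra)
  interpret \<rho>: prob_space \<rho> by (rule prob)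
  \<comment> \<open>An upper bound for \<open>f g * real_sq g\<close>. The weight decays
    exponentially in \<open>real_sq g\<close>, and \<open>t * exp (- t) \<le> 1\<close> with
    \<open>t = \<beta> * (lam / 4 * real_sq g)\<close> absorbs the factor
    \<open>real_sq g\<close>.\<close>
  define K where "K = 4 / (\<beta> * lam) * exp (- (\<beta> * (mean_loss g0 - slack g0))) / C"
  have "(\<integral>\<^sup>+g. mean_sq g \<partial>\<rho>) = (\<integral>\<^sup>+g. ennreal (f g) * mean_sq g \<partial>\<pi>)"
    unfolding \<rho>_def by (rule nn_integral_density) measurable
  also have "\<dots> \<le> (\<integral>\<^sup>+g. ennreal K \<partial>\<pi>)"
  proof (rule nn_integral_mono)
    fix g
    show "ennreal (f g) * mean_sq g \<le> ennreal K"
    proof (cases "g \<in> space G \<and> mean_sq g < \<infinity>")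
      case True
      define t where "t = \<beta> * (lam / 4 * real_sq g)"
      have "t \<le> exp t" using exp_ge_add_one_self[of t] by linarith
      then have t: "t * exp (- t) \<le> 1" by (simp add: exp_minus field_simps)
      have "real_sq g * weight g \<le> real_sq g * exp (- (\<beta> * (mean_loss g0 - slack g0 + lam / 4 * real_sq g)))"
        by (intro mult_left_mono weight_le) simp
      also have "\<dots> = 4 / (\<beta> * lam) * exp (- (\<beta> * (mean_loss g0 - slack g0))) * (t * exp (- t))"
      proof -
        have "exp (- (\<beta> * (mean_loss g0 - slack g0 + lam / 4 * real_sq g)))
          = exp (- (\<beta> * (mean_loss g0 - slack g0))) * exp (- t)"
          by (simp add: exp_add[symmetric] t_def algebra_simps)
        moreover have "real_sq g = 4 / (\<beta> * lam) * t"
          using beta_pos lam_pos by (simp add: t_def)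
        ultimately show ?thesis by simp
      qed
      also have "\<dots> \<le> 4 / (\<beta> * lam) * exp (- (\<beta> * (mean_loss g0 - slack g0))) * 1"
        using t beta_pos lam_pos by (intro mult_left_mono) auto
      finally have "real_sq g * weight g / C \<le> K"
        unfolding K_def mult_1_right using C by (intro divide_right_mono) auto
      then have "f g * real_sq g \<le> K" by (simp add: f_def mult.commute)
      moreover have "mean_sq g = ennreal (real_sq g)" using True by simp
      ultimately show ?thesis
        by (metis ennreal_leI ennreal_mult' f_nonneg)
    next
      case False
      then have "f g = 0" by (auto simp: f_def weight_def indicator_def)
      then show ?thesis by simp
    qed
  qed
  also have "\<dots> < \<infinity>" using \<pi>.emeasure_space_1 by simp
  finally have sq_fin: "(\<integral>\<^sup>+g. mean_sq g \<partial>\<rho>) < \<infinity>" .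
  have ac: "absolutely_continuous \<pi> \<rho>"
    unfolding \<rho>_def by (rule absolutely_continuousI_density) measurable
  have "AE g in \<pi>. ennreal (f g) = RN_deriv \<pi> \<rho> g"
    by (rule \<pi>.RN_deriv_unique) (auto simp: \<rho>_def)
  then have "AE g in \<rho>. ennreal (f g) = RN_deriv \<pi> \<rho> g"
    by (intro absolutely_continuous_AE[OF _ ac]) auto
  then have ed: "AE g in \<rho>. entropy_density (exp 1) \<pi> \<rho> g = - (\<beta> * obj g) - ln C"
    using AE_rho[OF \<rho> sq_fin]
  proof eventually_elim
    case (elim g)
    have "enn2real (RN_deriv \<pi> \<rho> g) = f g" unfolding elim(1)[symmetric] by (simp add: f_nonneg)
    moreover have "f g = exp (- (\<beta> * obj g)) / C" using elim by (simp add: f_def weight_def)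
    ultimately show ?case using C by (simp add: entropy_density_def log_def ln_div)
  qed
  have int: "integrable \<rho> (\<lambda>g. - (\<beta> * obj g) - ln C)" using integrable_obj[OF \<rho> sq_fin] by auto
  have meas: "entropy_density (exp 1) \<pi> \<rho> \<in> borel_measurable \<rho>"
    using measurable_entropy_density[of _ \<pi> \<rho>] by (simp add: measurable_cong_sets[of \<pi> G] measurable_cong_sets[of \<rho> G])
  have int_ed: "integrable \<rho> (entropy_density (exp 1) \<pi> \<rho>)"
    using int meas by (rule integrable_cong_AE_imp) (use ed in \<open>auto simp: eq_commute\<close>)
  have "KL_divergence (exp 1) \<pi> \<rho> = (\<integral>g. - (\<beta> * obj g) - ln C \<partial>\<rho>)"
    unfolding KL_divergence_def using ed int meas by (intro integral_cong_AE) auto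
  also have "\<dots> = - (\<beta> * (\<integral>g. obj g \<partial>\<rho>)) - ln C"
    using integrable_obj[OF \<rho> sq_fin] by (simp add: \<rho>.prob_space)
  finally have "(\<integral>g. obj g \<partial>\<rho>) + KL_divergence (exp 1) \<pi> \<rho> / \<beta> = - ln C / \<beta>"
    using beta_pos by (simp add: diff_divide_distrib)
  then have "bound \<rho> = ereal (- ln C / \<beta>)"
    by (simp add: bound_eq[OF \<rho> sq_fin ac int_ed])
  with \<rho> that show ?thesis by (simp add: C_def)
qed

end

text \<open>If the bound is \<infinity> everywhere, every distribution is a minimizer and \<pi> is
  chosen. If the reference function has risk \<open>- \<infinity>\<close>, any \<rho> with bound
  below \<infinity> already has bound \<open>- \<infinity>\<close>. Otherwise the Gibbs distribution
  of the objective is taken. The second conclusion retains the alternative on which the comparison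
  with the expected risk depends.\<close>

lemma exists_argmin:
  obtains \<rho> where "is_arg_min bound (\<lambda>\<rho>. \<rho> \<in> space (prob_algebra G)) \<rho>"
    and "bound \<rho> < \<infinity> \<Longrightarrow> (AE g in \<mu>. risk P L g = - \<infinity>)
      \<or> (\<exists>g0\<in>space G. mean_sq g0 < \<infinity> \<and> integrable P (\<lambda>z. L z g0))"
proof (cases "\<exists>\<rho>\<in>space (prob_algebra G). bound \<rho> < \<infinity>")
  case False
  then have "bound \<rho> = \<infinity>" if "\<rho> \<in> space (prob_algebra G)" for \<rho>
    using that by auto
  then show ?thesis
    using prior by (intro that[of \<pi>]) (auto simp: is_arg_min_def)
next
  case True
  then obtain \<rho>' where \<rho>': "\<rho>' \<in> space (prob_algebra G)" "bound \<rho>' < \<infinity>" by blast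
  obtain g0 where g0: "g0 \<in> space G" "mean_sq g0 < \<infinity>"
    and cases: "integrable P (\<lambda>z. L z g0) \<or> risk P L g0 = - \<infinity>"
    by (rule obtain_reference[OF \<rho>'])
  from cases show ?thesis
  proof
    assume "risk P L g0 = - \<infinity>"
    note d = degenerate[OF g0 this]
    show ?thesis
      using d(1) \<rho>'(1) by (intro that[of \<rho>']) (auto simp: is_arg_min_def d(2)[OF \<rho>'])
  next
    assume int: "integrable P (\<lambda>z. L z g0)"
    note le = free_energy_le_bound[OF g0 int]
    obtain \<rho> where \<rho>: "\<rho> \<in> space (prob_algebra G)"
      "bound \<rho> = ereal (- ln (\<integral>g. weight g \<partial>\<pi>) / \<beta>)"
      by (rule free_energy_attained[OF g0 int le(1)[OF \<rho>']])
    have "\<not> bound \<rho>'' < bound \<rho>" if "\<rho>'' \<in> space (prob_algebra G)" for \<rho>''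
      using le(2)[OF that] \<rho>(2) by (cases "bound \<rho>'' < \<infinity>") (auto simp: not_less)
    then show ?thesis
      using \<rho>(1) g0 int by (intro that[of \<rho>]) (auto simp: is_arg_min_def)
  qed
qed

end

section \<open>The risk bound\<close>

text \<open>Formulated for any kernel whose mixture is \<open>mixture n\<close>, because the
  observations of the theorem live on an arbitrary probability space. Each finite case of
  \<open>exists_argmin\<close> matches one of the two lemmas that flatten an iterated
  expectation.\<close>

lemma (in seqrand_setting) expected_risk_le_bound:
  fixes n :: nat and \<Omega> :: "'w measure" and K :: "'w \<Rightarrow> 'g measure"
  defines "bd \<equiv> seqrand_tradeoff.bound P L lam \<pi> (mixture n) (lam * (real n + 1))"
  assumes \<Omega>: "prob_space \<Omega>" and K: "K \<in> \<Omega> \<rightarrow>\<^sub>M prob_algebra G" and mix: "\<Omega> \<bind> K = mixture n"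
  obtains \<rho> where "is_arg_min bd (\<lambda>\<rho>. \<rho> \<in> space (prob_algebra G)) \<rho>"
    and "ext_expectation \<Omega> (\<lambda>\<omega>. ext_expectation (K \<omega>) (risk P L)) \<le> bd \<rho>"
proof -
  interpret T: seqrand_tradeoff P G L lam \<pi> "mixture n" "lam * (real n + 1)"
    using lam_pos
    by (intro seqrand_tradeoff.intro seqrand_setting_axioms seqrand_tradeoff_axioms.intro
        prob_mixture sets_mixture) simp
  let ?lhs = "ext_expectation \<Omega> (\<lambda>\<omega>. ext_expectation (K \<omega>) (risk P L))"
  obtain \<rho> where argmin: "is_arg_min T.bound (\<lambda>\<rho>. \<rho> \<in> space (prob_algebra G)) \<rho>"
    and cases: "T.bound \<rho> < \<infinity> \<Longrightarrow> (AE g in mixture n. risk P L g = - \<infinity>)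
      \<or> (\<exists>g0\<in>space G. T.mean_sq g0 < \<infinity> \<and> integrable P (\<lambda>z. L z g0))"
    using T.exists_argmin by blast
  then have \<rho>: "\<rho> \<in> space (prob_algebra G)" by (simp add: is_arg_min_def)
  have "?lhs \<le> T.bound \<rho>"
  proof (cases "T.bound \<rho> < \<infinity>")
    case True
    from cases[OF True] show ?thesis
    proof
      assume "AE g in mixture n. risk P L g = - \<infinity>"
      then have "?lhs = - \<infinity>"
        by (intro ext_expectation_bind_minus_infinity[OF \<Omega> K T.measurable_risk]) (simp only: mix)
      then show ?thesis by simp
    next
      assume "\<exists>g0\<in>space G. T.mean_sq g0 < \<infinity> \<and> integrable P (\<lambda>z. L z g0)"
      then obtain g0 where g0: "g0 \<in> space G" "T.mean_sq g0 < \<infinity>" "integrable P (\<lambda>z. L z g0)"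
        by blast
      note b = T.bound_less_top[OF True] and mu = T.integral_loss_mu[OF g0]
      have lhs: "?lhs = ereal (\<integral>g. (\<integral>z. L z g \<partial>P) \<partial>mixture n)"
        unfolding mix[symmetric]
        using mu(1,3) by (intro ext_expectation_bind[OF measurable_prob_algebraD[OF K] _
            T.measurable_mean_loss T.measurable_risk]) (simp_all only: mix)
      have "lam * (real (Suc n) * (\<integral>g. (\<integral>z. L z g \<partial>P) \<partial>mixture n))
        \<le> lam * (real (Suc n) * (\<integral>g. T.obj g \<partial>\<rho>)) + KL_divergence (exp 1) \<pi> \<rho>"
        using regret_bound[OF \<rho> b(3,4) T.integrable_loss_mu[OF g0] T.integrable_penalized[OF g0 \<rho> b(2)]]
        unfolding mu(2) T.integral_penalized[OF g0 \<rho> b(2)] .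
      then have "((\<integral>g. (\<integral>z. L z g \<partial>P) \<partial>mixture n) - (\<integral>g. T.obj g \<partial>\<rho>)) * (lam * (real n + 1))
          \<le> KL_divergence (exp 1) \<pi> \<rho>"
        by (simp add: algebra_simps)
      then have "(\<integral>g. (\<integral>z. L z g \<partial>P) \<partial>mixture n) - (\<integral>g. T.obj g \<partial>\<rho>)
          \<le> KL_divergence (exp 1) \<pi> \<rho> / (lam * (real n + 1))"
        unfolding pos_le_divide_eq[OF T.beta_pos] .
      then have "(\<integral>g. (\<integral>z. L z g \<partial>P) \<partial>mixture n)
        \<le> (\<integral>g. T.obj g \<partial>\<rho>) + KL_divergence (exp 1) \<pi> \<rho> / (lam * (real n + 1))"
        by linarith
      then show ?thesis
        unfolding lhs by (simp add: T.bound_eq[OF g0 \<rho> b(2-4)])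
    qed
  qed simp
  with argmin that show ?thesis by (simp add: bd_def)
qed

lemma distr_iid_PiM:
  fixes Z :: "nat \<Rightarrow> 'w \<Rightarrow> 'z"
  assumes "prob_space \<Omega>" and indep: "prob_space.indep_vars \<Omega> (\<lambda>_. S) Z I"
    and distr: "\<And>i. i \<in> I \<Longrightarrow> distr \<Omega> S (Z i) = P"
  shows "distr \<Omega> (PiM I (\<lambda>_. S)) (\<lambda>\<omega>. \<lambda>i\<in>I. Z i \<omega>) = PiM I (\<lambda>_. P)"
proof (cases "I = {}")
  \<comment> \<open>This is the sample of size 0: both sides are the point mass at the everywhere
    undefined sequence.\<close>
  case True
  interpret prob_space \<Omega> by fact
  have "emeasure (distr \<Omega> (count_space {\<lambda>_. undefined}) (\<lambda>\<omega>. \<lambda>i\<in>{}. Z i \<omega>)) A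
      = emeasure (count_space {\<lambda>_. undefined}) A" if "A \<subseteq> {\<lambda>_. undefined}" for A
    using that emeasure_space_1
    by (cases "A = {}") (auto simp: emeasure_distr subset_singleton_iff restrict_def)
  then show ?thesis
    unfolding True PiM_empty by (intro measure_eqI) auto
next
  case False
  interpret prob_space \<Omega> by fact
  have "Z i \<in> \<Omega> \<rightarrow>\<^sub>M S" if "i \<in> I" for i
    using indep that by (simp add: indep_vars_def)
  then have "distr \<Omega> (PiM I (\<lambda>_. S)) (\<lambda>\<omega>. \<lambda>i\<in>I. Z i \<omega>) = PiM I (\<lambda>i. distr \<Omega> S (Z i))"
    using indep_vars_iff_distr_eq_PiM'[where M'="\<lambda>_. S" and X=Z, OF False] indep by blast
  also have "\<dots> = PiM I (\<lambda>_. P)"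
    by (intro PiM_cong refl) (simp add: distr)
  finally show ?thesis .
qed

theorem theorem6p1:
  fixes X :: "'x measure" and Y :: "'y measure"
    and P :: "('x \<times> 'y) measure"
    and G :: "('x \<Rightarrow> 'y) measure"
    and L :: "'x \<times> 'y \<Rightarrow> ('x \<Rightarrow> 'y) \<Rightarrow> real"
    and \<Omega> :: "'w measure" and Z :: "nat \<Rightarrow> 'w \<Rightarrow> 'x \<times> 'y"
    and n :: nat and lam :: real
    and \<pi> :: "('x \<Rightarrow> 'y) measure"
    and muhat :: "'w \<Rightarrow> ('x \<Rightarrow> 'y) measure"
  assumes "P \<in> space (prob_algebra (X \<Otimes>\<^sub>M Y))"
    and "space G \<subseteq> measurable X Y"
    and "(\<lambda>(z, g). L z g) \<in> borel_measurable ((X \<Otimes>\<^sub>M Y) \<Otimes>\<^sub>M G)"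
    and "prob_space \<Omega>"
    and "prob_space.indep_vars \<Omega> (\<lambda>_. X \<Otimes>\<^sub>M Y) Z {1..n}"
    and "\<And>i. i \<in> {1..n} \<Longrightarrow> distr \<Omega> (X \<Otimes>\<^sub>M Y) (Z i) = P"
    and "lam > 0"
    and "\<pi> \<in> space (prob_algebra G)"
    and muhat: "\<And>\<omega>. muhat \<omega> =
      seqrand G L lam (\<lambda>z g g'. lam * (L z g - L z g')\<^sup>2 / 2) (\<lambda>\<rho>. \<rho>) \<pi> n (\<lambda>i. Z i \<omega>)"
  shows "let bound = (\<lambda>\<rho>.
           ext_expectation \<rho> (risk P L)
           + ereal (lam / 2) * enn2ereal
               (\<integral>\<^sup>+ g. (\<integral>\<^sup>+ \<omega>. (\<integral>\<^sup>+ g'. sq_loss_diff P L g g' \<partial>muhat \<omega>) \<partial>\<Omega>) \<partial>\<rho>)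
           + KL \<rho> \<pi> / ereal (lam * (real n + 1)))
         in \<exists>\<rho>min. is_arg_min bound (\<lambda>\<rho>. \<rho> \<in> space (prob_algebra G)) \<rho>min \<and>
              ext_expectation \<Omega> (\<lambda>\<omega>. ext_expectation (muhat \<omega>) (risk P L)) \<le> bound \<rho>min"
proof -
  let ?S = "X \<Otimes>\<^sub>M Y"
  interpret \<Omega>: prob_space \<Omega> by fact
  have sets_P: "sets P = sets ?S" and prob_P: "prob_space P"
    using assms(1) by (auto simp: space_prob_algebra)
  have "sets (P \<Otimes>\<^sub>M G) = sets (?S \<Otimes>\<^sub>M G)"
    by (intro sets_pair_measure_cong sets_P refl)
  then have "(\<lambda>(z, g). L z g) \<in> borel_measurable (P \<Otimes>\<^sub>M G)"
    using assms(3) measurable_cong_sets by blast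
  then interpret seqrand_setting P G L lam \<pi>
    by (rule seqrand_setting.intro[OF prob_P _ assms(7,8)])
  define D where "D = PiM {1..n} (\<lambda>_. P)"
  \<comment> \<open>The restriction turns the sample into a point of the product space. It does not
    affect the algorithm, which reads the indices from 1 to \<open>n\<close> only.\<close>
  define W where "W = (\<lambda>\<omega>. \<lambda>i\<in>{1..n}. Z i \<omega>)"
  have Z: "Z i \<in> \<Omega> \<rightarrow>\<^sub>M P" if "i \<in> {1..n}" for i
    using assms(5) that unfolding measurable_cong_sets[OF refl sets_P] by (simp add: \<Omega>.indep_vars_def)
  have W: "W \<in> \<Omega> \<rightarrow>\<^sub>M D" unfolding W_def D_def by (intro measurable_restrict Z)
  have "sets D = sets (PiM {1..n} (\<lambda>_. ?S))" unfolding D_def by (intro sets_PiM_cong refl sets_P)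
  then have distr_W: "distr \<Omega> D W = D"
    using distr_iid_PiM[OF assms(4,5,6)] by (simp add: D_def W_def cong: distr_cong)
  have muhat_eq: "muhat = (\<lambda>\<omega>. output n (W \<omega>))"
  proof
    fix \<omega>
    show "muhat \<omega> = output n (W \<omega>)"
      unfolding muhat by (rule output_cong) (simp add: W_def)
  qed
  have out: "output n \<in> D \<rightarrow>\<^sub>M prob_algebra G" unfolding D_def by (rule measurable_output) simp
  have K: "muhat \<in> \<Omega> \<rightarrow>\<^sub>M prob_algebra G"
    unfolding muhat_eq by (rule measurable_compose[OF W out])
  have "mixture n = distr \<Omega> D W \<bind> output n" by (simp only: distr_W) (simp add: mixture_def D_def)
  also have "\<dots> = \<Omega> \<bind> muhat"
    unfolding muhat_eq by (rule bind_distr[OF W measurable_prob_algebraD[OF out] \<Omega>.not_empty])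
  finally have mix: "\<Omega> \<bind> muhat = mixture n" by (rule sym)
  interpret T: seqrand_tradeoff P G L lam \<pi> "mixture n" "lam * (real n + 1)"
    using lam_pos
    by (intro seqrand_tradeoff.intro seqrand_setting_axioms seqrand_tradeoff_axioms.intro
        prob_mixture sets_mixture) simp
  define bound where "bound \<rho> = ext_expectation \<rho> (risk P L)
           + ereal (lam / 2) * enn2ereal
               (\<integral>\<^sup>+ g. (\<integral>\<^sup>+ \<omega>. (\<integral>\<^sup>+ g'. sq_loss_diff P L g g' \<partial>muhat \<omega>) \<partial>\<Omega>) \<partial>\<rho>)
           + KL \<rho> \<pi> / ereal (lam * (real n + 1))" for \<rho>
  \<comment> \<open>The agreement is claimed for probability distributions on \<open>G\<close> only,
    as the inner integrals are rewritten at points of \<open>space G\<close>; this suffices since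
    the minimum ranges over these distributions.\<close>
  have bound: "bound \<rho> = T.bound \<rho>" if "\<rho> \<in> space (prob_algebra G)" for \<rho>
  proof -
    have space: "space \<rho> = space G" using that by (auto simp: space_prob_algebra dest: sets_eq_imp_space_eq)
    have "(\<integral>\<^sup>+ \<omega>. (\<integral>\<^sup>+ g'. sq_loss_diff P L g g' \<partial>muhat \<omega>) \<partial>\<Omega>) = T.mean_sq g" if "g \<in> space \<rho>" for g
    proof -
      have "(\<lambda>g'. sq_loss_diff P L g g') \<in> borel_measurable G"
        using measurable_Pair2[OF T.measurable_sq_loss_diff] that space by simp
      then show ?thesis
        unfolding T.mean_sq_def unfolding mix[symmetric]
        by (rule nn_integral_bind[OF _ measurable_prob_algebraD[OF K], symmetric])
    qed
    then have "(\<integral>\<^sup>+ g. (\<integral>\<^sup>+ \<omega>. (\<integral>\<^sup>+ g'. sq_loss_diff P L g g' \<partial>muhat \<omega>) \<partial>\<Omega>) \<partial>\<rho>) = (\<integral>\<^sup>+ g. T.mean_sq g \<partial>\<rho>)"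
      by (rule nn_integral_cong)
    then show ?thesis unfolding bound_def T.bound_def by simp
  qed
  obtain \<rho> where argmin: "is_arg_min T.bound (\<lambda>\<rho>. \<rho> \<in> space (prob_algebra G)) \<rho>"
    and le: "ext_expectation \<Omega> (\<lambda>\<omega>. ext_expectation (muhat \<omega>) (risk P L)) \<le> T.bound \<rho>"
    by (rule expected_risk_le_bound[OF assms(4) K mix])
  have "is_arg_min bound (\<lambda>\<rho>. \<rho> \<in> space (prob_algebra G)) \<rho>"
    using argmin by (auto simp: is_arg_min_def bound)
  moreover have "bound \<rho> = T.bound \<rho>" using argmin by (intro bound) (simp add: is_arg_min_def)
  ultimately show ?thesis
    using le unfolding Let_def bound_def[abs_def, symmetric] by (intro exI[of _ \<rho>]) simp
qed

end
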